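(* Let $R$ be a Dedekind domain and let $R\to S$ be a ring homomorphism. Let $M$ be a Noetherian $S$-module, considered as an $R$-module via restriction of scalars. Suppose that for each maximal ideal $\mathfrak m$ of $R$, the $R_{\mathfrak m}$-module $M_{\mathfrak m}$ is faithfully flat and Ohm-Rush. Then $M$ is a faithfully flat Ohm-Rush $R$-module.
   Context: All rings are commutative with identity. For a ring $R$, an $R$-module $M$ and $f\in M$, the (Ohm-Rush) content of $f$ is the ideal $c(f):=\bigcap\{I\subseteq R \text{ ideal} \mid f\in IM\}$. The $R$-module $M$ is Ohm-Rush if $f\in c(f)M$ for all $f\in M$. $M_{\mathfrak m}$ denotes the localization of $M$ at the multiplicative set $R\setminus\mathfrak m$. *)

theory Defs
  imports "HOL-Algebra.Algebra"
begin

section \<open>Modules\<close>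

definition restrict_scalars :: "('r \<Rightarrow> 's) \<Rightarrow> ('s, 'm, 'k) module_scheme \<Rightarrow> ('r, 'm) module"
  where "restrict_scalars \<phi> M =
    \<lparr>carrier = carrier M, monoid.mult = monoid.mult M, one = one M,
     ring.zero = ring.zero M, ring.add = ring.add M,
     smult = (\<lambda>r x. \<phi> r \<odot>\<^bsub>M\<^esub> x)\<rparr>"

definition ring_as_module :: "('r, 'p) ring_scheme \<Rightarrow> ('r, 'r) module"
  where "ring_as_module R =
    \<lparr>carrier = carrier R, monoid.mult = monoid.mult R, one = one R,
     ring.zero = ring.zero R, ring.add = ring.add R,
     smult = monoid.mult R\<rparr>"

definition submodule_span ::
    "('r, 'p) ring_scheme \<Rightarrow> ('r, 'm, 'k) module_scheme \<Rightarrow> 'm set \<Rightarrow> 'm set"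
  where "submodule_span R M A = \<Inter>{H. submodule H R M \<and> A \<subseteq> H}"

locale noetherian_module = module +
  assumes finitely_gen:
    "submodule N R M \<Longrightarrow> \<exists>A \<subseteq> carrier M. finite A \<and> N = submodule_span R M A"

definition linear_maps ::
    "('r, 'p) ring_scheme \<Rightarrow> ('r, 'm, 'k) module_scheme \<Rightarrow> ('r, 'n, 'l) module_scheme
      \<Rightarrow> ('m \<Rightarrow> 'n) set"
  where "linear_maps R M N = {f \<in> carrier M \<rightarrow> carrier N.
    (\<forall>x\<in>carrier M. \<forall>y\<in>carrier M. f (x \<oplus>\<^bsub>M\<^esub> y) = f x \<oplus>\<^bsub>N\<^esub> f y) \<and>
    (\<forall>r\<in>carrier R. \<forall>x\<in>carrier M. f (r \<odot>\<^bsub>M\<^esub> x) = r \<odot>\<^bsub>N\<^esub> f x)}"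


section \<open>Ohm-Rush content\<close>

definition ideal_mult_module ::
    "('r, 'p) ring_scheme \<Rightarrow> 'r set \<Rightarrow> ('r, 'm, 'k) module_scheme \<Rightarrow> 'm set"
  where "ideal_mult_module R I M = submodule_span R M {r \<odot>\<^bsub>M\<^esub> x | r x. r \<in> I \<and> x \<in> carrier M}"

definition content :: "('r, 'p) ring_scheme \<Rightarrow> ('r, 'm, 'k) module_scheme \<Rightarrow> 'm \<Rightarrow> 'r set"
  where "content R M f = \<Inter>{I. ideal I R \<and> f \<in> ideal_mult_module R I M}"

definition ohm_rush :: "('r, 'p) ring_scheme \<Rightarrow> ('r, 'm, 'k) module_scheme \<Rightarrow> bool"
  where "ohm_rush R M \<longleftrightarrow> (\<forall>f\<in>carrier M. f \<in> ideal_mult_module R (content R M f) M)"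


section \<open>Localization\<close>

text \<open>\<open>U\<close> is meant to be a multiplicative subset of \<open>R\<close>; \<open>loc_frac R U M x s\<close> is the fraction
  \<open>x/s\<close>, as an equivalence class. The operations are the usual ones on representatives, in the form of a
  union over all representatives. The fields \<open>mult\<close> and \<open>one\<close> of a module record carry no
  meaning.\<close>

definition loc_rel ::
    "('r, 'p) ring_scheme \<Rightarrow> 'r set \<Rightarrow> ('r, 'm, 'k) module_scheme \<Rightarrow> (('m \<times> 'r) \<times> ('m \<times> 'r)) set"
  where "loc_rel R U M = {((x, s), (y, t)).
    x \<in> carrier M \<and> s \<in> U \<and> y \<in> carrier M \<and> t \<in> U \<and>
    (\<exists>u\<in>U. u \<odot>\<^bsub>M\<^esub> (t \<odot>\<^bsub>M\<^esub> x) = u \<odot>\<^bsub>M\<^esub> (s \<odot>\<^bsub>M\<^esub> y))}"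

definition loc_frac ::
    "('r, 'p) ring_scheme \<Rightarrow> 'r set \<Rightarrow> ('r, 'm, 'k) module_scheme \<Rightarrow> 'm \<Rightarrow> 'r \<Rightarrow> ('m \<times> 'r) set"
  where "loc_frac R U M x s = loc_rel R U M `` {(x, s)}"

definition loc_ring :: "('r, 'p) ring_scheme \<Rightarrow> 'r set \<Rightarrow> ('r \<times> 'r) set ring"
  where "loc_ring R U = (let frac = loc_frac R U (ring_as_module R) in
    \<lparr>carrier = (carrier R \<times> U) // loc_rel R U (ring_as_module R),
     monoid.mult = (\<lambda>A B. \<Union>(a, s)\<in>A. \<Union>(b, t)\<in>B. frac (a \<otimes>\<^bsub>R\<^esub> b) (s \<otimes>\<^bsub>R\<^esub> t)),
     one = frac \<one>\<^bsub>R\<^esub> \<one>\<^bsub>R\<^esub>,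
     ring.zero = frac \<zero>\<^bsub>R\<^esub> \<one>\<^bsub>R\<^esub>,
     ring.add = (\<lambda>A B. \<Union>(a, s)\<in>A. \<Union>(b, t)\<in>B. frac (t \<otimes>\<^bsub>R\<^esub> a \<oplus>\<^bsub>R\<^esub> s \<otimes>\<^bsub>R\<^esub> b) (s \<otimes>\<^bsub>R\<^esub> t))\<rparr>)"

definition loc_module ::
    "('r, 'p) ring_scheme \<Rightarrow> 'r set \<Rightarrow> ('r, 'm, 'k) module_scheme
      \<Rightarrow> (('r \<times> 'r) set, ('m \<times> 'r) set) module"
  where "loc_module R U M = (let frac = loc_frac R U M in
    \<lparr>carrier = (carrier M \<times> U) // loc_rel R U M,
     monoid.mult = (\<lambda>_ _. undefined),
     one = undefined,
     ring.zero = frac \<zero>\<^bsub>M\<^esub> \<one>\<^bsub>R\<^esub>,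
     ring.add = (\<lambda>A B. \<Union>(x, s)\<in>A. \<Union>(y, t)\<in>B. frac (t \<odot>\<^bsub>M\<^esub> x \<oplus>\<^bsub>M\<^esub> s \<odot>\<^bsub>M\<^esub> y) (s \<otimes>\<^bsub>R\<^esub> t)),
     smult = (\<lambda>A B. \<Union>(a, s)\<in>A. \<Union>(x, t)\<in>B. frac (a \<odot>\<^bsub>M\<^esub> x) (s \<otimes>\<^bsub>R\<^esub> t))\<rparr>)"

abbreviation ring_at :: "('r, 'p) ring_scheme \<Rightarrow> 'r set \<Rightarrow> ('r \<times> 'r) set ring"
  where "ring_at R \<mm> \<equiv> loc_ring R (carrier R - \<mm>)"

abbreviation module_at ::
    "('r, 'p) ring_scheme \<Rightarrow> 'r set \<Rightarrow> ('r, 'm, 'k) module_scheme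
      \<Rightarrow> (('r \<times> 'r) set, ('m \<times> 'r) set) module"
  where "module_at R \<mm> M \<equiv> loc_module R (carrier R - \<mm>) M"


section \<open>Dedekind domains\<close>

definition fraction_field :: "('r, 'p) ring_scheme \<Rightarrow> ('r \<times> 'r) set ring"
  where "fraction_field R = loc_ring R (carrier R - {\<zero>\<^bsub>R\<^esub>})"

definition fraction_field_image :: "('r, 'p) ring_scheme \<Rightarrow> ('r \<times> 'r) set set"
  where "fraction_field_image R =
    (\<lambda>r. loc_frac R (carrier R - {\<zero>\<^bsub>R\<^esub>}) (ring_as_module R) r \<one>\<^bsub>R\<^esub>) ` carrier R"

definition integral_over :: "('r, 'p) ring_scheme \<Rightarrow> 'r set \<Rightarrow> 'r \<Rightarrow> bool"
  where "integral_over F K x \<longleftrightarrow>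
    (\<exists>p. polynomial\<^bsub>F\<^esub> K p \<and> p \<noteq> [] \<and> hd p = \<one>\<^bsub>F\<^esub> \<and> ring.eval F p x = \<zero>\<^bsub>F\<^esub>)"

text \<open>Fields are admitted as Dedekind domains.\<close>

locale dedekind_domain = noetherian_domain R for R (structure) +
  assumes integrally_closed:
    "\<lbrakk>x \<in> carrier (fraction_field R); integral_over (fraction_field R) (fraction_field_image R) x\<rbrakk>
      \<Longrightarrow> x \<in> fraction_field_image R"
    and nonzero_prime_maximal: "\<lbrakk>primeideal P R; P \<noteq> {\<zero>}\<rbrakk> \<Longrightarrow> maximalideal P R"


section \<open>Tensor products and flatness\<close>

text \<open>\<open>N \<otimes>\<^sub>R M\<close> as an abelian group: the free abelian group on \<open>N \<times> M\<close> modulo the subgroup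
  generated by the bilinearity relations.\<close>

definition tensor_relators ::
    "('r, 'p) ring_scheme \<Rightarrow> ('r, 'n, 'l) module_scheme \<Rightarrow> ('r, 'm, 'k) module_scheme
      \<Rightarrow> ('n \<times> 'm \<Rightarrow>\<^sub>0 int) set"
  where "tensor_relators R N M =
    {frag_of (x \<oplus>\<^bsub>N\<^esub> x', y) - frag_of (x, y) - frag_of (x', y) | x x' y.
       x \<in> carrier N \<and> x' \<in> carrier N \<and> y \<in> carrier M} \<union>
    {frag_of (x, y \<oplus>\<^bsub>M\<^esub> y') - frag_of (x, y) - frag_of (x, y') | x y y'.
       x \<in> carrier N \<and> y \<in> carrier M \<and> y' \<in> carrier M} \<union>
    {frag_of (r \<odot>\<^bsub>N\<^esub> x, y) - frag_of (x, r \<odot>\<^bsub>M\<^esub> y) | r x y.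
       r \<in> carrier R \<and> x \<in> carrier N \<and> y \<in> carrier M}"

definition tensor_kernel ::
    "('r, 'p) ring_scheme \<Rightarrow> ('r, 'n, 'l) module_scheme \<Rightarrow> ('r, 'm, 'k) module_scheme
      \<Rightarrow> ('n \<times> 'm \<Rightarrow>\<^sub>0 int) set"
  where "tensor_kernel R N M =
    generate (free_Abelian_group (carrier N \<times> carrier M)) (tensor_relators R N M)"

definition tensor_product ::
    "('r, 'p) ring_scheme \<Rightarrow> ('r, 'n, 'l) module_scheme \<Rightarrow> ('r, 'm, 'k) module_scheme
      \<Rightarrow> ('n \<times> 'm \<Rightarrow>\<^sub>0 int) set monoid"
  where "tensor_product R N M =
    free_Abelian_group (carrier N \<times> carrier M) Mod tensor_kernel R N M"

text \<open>\<open>tensor_map R N' M f\<close> is the map \<open>f \<otimes> id\<^sub>M\<close> into \<open>N' \<otimes>\<^sub>R M\<close>.\<close>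

definition tensor_map ::
    "('r, 'p) ring_scheme \<Rightarrow> ('r, 'n2, 'l) module_scheme \<Rightarrow> ('r, 'm, 'k) module_scheme
      \<Rightarrow> ('n1 \<Rightarrow> 'n2) \<Rightarrow> ('n1 \<times> 'm \<Rightarrow>\<^sub>0 int) set \<Rightarrow> ('n2 \<times> 'm \<Rightarrow>\<^sub>0 int) set"
  where "tensor_map R N' M f A =
    (\<Union>c\<in>A. tensor_kernel R N' M #>\<^bsub>free_Abelian_group (carrier N' \<times> carrier M)\<^esub>
             frag_extend (\<lambda>(x, y). frag_of (f x, y)) c)"

text \<open>Quantification over all modules is not possible inside a HOL definition, so the type \<open>'n\<close>
  of the elements of the test modules is a parameter. The property for all \<open>'n\<close> is flatness
  (respectively faithful flatness). It already follows from the case \<open>'n = 'r set\<close>, with \<open>'r\<close> the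
  element type of the ring: this type contains all \<open>R/I\<close> and isomorphic copies of \<open>R\<close> and of all
  its ideals, which detect flatness and faithful flatness. Hence assume the property at \<open>'r set\<close> and
  conclude it at a free type variable.\<close>

definition flat ::
    "'n itself \<Rightarrow> ('r, 'p) ring_scheme \<Rightarrow> ('r, 'm, 'k) module_scheme \<Rightarrow> bool"
  where "flat T R M \<longleftrightarrow>
    (\<forall>(N :: ('r, 'n) module) (N' :: ('r, 'n) module) f.
       module R N \<longrightarrow> module R N' \<longrightarrow> f \<in> linear_maps R N N' \<longrightarrow> inj_on f (carrier N) \<longrightarrow>
       inj_on (tensor_map R N' M f) (carrier (tensor_product R N M)))"

definition faithfully_flat ::
    "'n itself \<Rightarrow> ('r, 'p) ring_scheme \<Rightarrow> ('r, 'm, 'k) module_scheme \<Rightarrow> bool"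
  where "faithfully_flat T R M \<longleftrightarrow> flat T R M \<and>
    (\<forall>N :: ('r, 'n) module. module R N \<longrightarrow>
       carrier (tensor_product R N M) = {\<one>\<^bsub>tensor_product R N M\<^esub>} \<longrightarrow> carrier N = {\<zero>\<^bsub>N\<^esub>})"

end

theory Submission
  imports Defs
begin

text \<open>
  At every maximal ideal \<open>\<mm>\<close> the localization of \<open>R\<close> is a valuation ring: \<open>\<mm>\<close> is locally generated by
  some \<open>\<pi>\<close>, and every nonzero element is locally a unit times a power of \<open>\<pi>\<close>. All local statements
  are phrased in \<open>R\<close> itself, with elements outside \<open>\<mm>\<close> in place of denominators.

  Flatness: the \<open>M\<^sub>\<mm>\<close> are flat, so \<open>M\<close> is torsion-free. Hence any finite subset of \<open>M\<close> lies, after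
  multiplication by some \<open>s \<notin> \<mm>\<close>, in the span of finitely many linearly independent elements.
  Their coordinate functionals show that an element of \<open>N \<otimes> M\<close> dying in \<open>N' \<otimes> M\<close> is annihilated by
  some \<open>s \<notin> \<mm>\<close>, for every \<open>\<mm>\<close>. The same functionals reduce faithfulness to \<open>M\<^sub>\<mm> \<noteq> \<pi> M\<^sub>\<mm>\<close>.

  Ohm-Rush: let \<open>f \<noteq> 0\<close>. As \<open>M\<close> is Noetherian over \<open>S\<close>, there is a nonzero \<open>r \<in> R\<close> such that
  \<open>r x \<in> S f\<close> whenever some nonzero \<open>R\<close>-multiple of \<open>x\<close> is in \<open>S f\<close>. If \<open>f \<in> I M\<close> but \<open>r \<notin> I\<close>, then
  at some \<open>\<mm>\<close> one has \<open>u f = r \<pi> x\<close> with \<open>u \<notin> \<mm>\<close>, so \<open>r x = \<sigma> f\<close> and \<open>u f = \<pi> \<sigma> f\<close>; iterating, \<open>f\<close> is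
  divisible by all powers of \<open>\<pi>\<close> in \<open>M\<^sub>\<mm>\<close>, which is impossible since \<open>M\<^sub>\<mm>\<close> is Ohm-Rush. So
  \<open>r \<in> c(f)\<close>, and \<open>c(f)\<close> localizes at \<open>\<mm>\<close> to \<open>(\<pi>\<^sup>k)\<close> with \<open>k\<close> maximal such that \<open>\<pi>\<^sup>k\<close> divides \<open>f\<close> in \<open>M\<^sub>\<mm>\<close>.
\<close>

section \<open>Localization\<close>

text \<open>Two obstacles shape the proof. First, \<open>M\<close> is finitely generated over
  \<open>S\<close> only, so \<open>M\<^sub>\<mm>\<close> need not have a basis. But a vanishing
  element of a tensor product is a finite combination of relators, which mention finitely many
  elements of \<open>M\<close>, and on finite sets local coordinates do exist. Second, the content
  is an intersection of possibly infinitely many ideals, which need not commute with localization: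
  with \<open>k\<close> the maximal local exponent, every ideal \<open>I\<close> with
  \<open>f\<close> in \<open>I M\<close> contains some \<open>w \<otimes> \<pi> [^] k\<close> with
  \<open>w\<close> outside \<open>\<mm>\<close>, but \<open>w\<close> depends on \<open>I\<close>.
  The nonzero \<open>r\<close> common to all these \<open>I\<close> is what allows \<open>w\<close>
  to be replaced by one multiplier that serves every \<open>I\<close>. The flatness hypotheses,
  given at a fixed type, are used through two test modules over \<open>R\<^sub>\<mm>\<close>: the
  ring itself and its quotient by \<open>\<pi>\<close>. The conclusion at the free type
  \<open>'n\<close> is obtained directly on formal sums, whatever the type.\<close>

lemma abelian_group_cong:
  assumes "abelian_group G" "carrier H = carrier G" "\<zero>\<^bsub>H\<^esub> = \<zero>\<^bsub>G\<^esub>"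
    "\<And>x y. \<lbrakk>x \<in> carrier G; y \<in> carrier G\<rbrakk> \<Longrightarrow> x \<oplus>\<^bsub>H\<^esub> y = x \<oplus>\<^bsub>G\<^esub> y"
  shows "abelian_group H"
proof -
  interpret G: abelian_group G by fact
  show ?thesis
    by (rule abelian_groupI) (use assms(2-4) G.a_assoc G.a_comm G.l_neg in \<open>auto intro: G.a_inv_closed\<close>)
qed

locale localized_module = module R M for R (structure) and M (structure) +
  fixes U
  assumes U_subset: "U \<subseteq> carrier R" and U_one: "\<one> \<in> U"
    and U_mult: "\<lbrakk>s \<in> U; t \<in> U\<rbrakk> \<Longrightarrow> s \<otimes> t \<in> U"
begin

abbreviation frac where "frac \<equiv> loc_frac R U M"

lemma U_carrier: "s \<in> U \<Longrightarrow> s \<in> carrier R"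
  using U_subset by blast

lemmas smult_normalize = smult_assoc1[symmetric] smult_r_distr smult_l_distr
  U_carrier R.m_ac M.a_ac

lemma equiv_loc_rel: "equiv (carrier M \<times> U) (loc_rel R U M)"
proof (rule equivI)
  show "loc_rel R U M \<subseteq> (carrier M \<times> U) \<times> (carrier M \<times> U)"
    by (auto simp: loc_rel_def)
  show "refl_on (carrier M \<times> U) (loc_rel R U M)"
    using U_one by (auto simp: refl_on_def loc_rel_def)
  show "sym (loc_rel R U M)"
    unfolding sym_def loc_rel_def by (auto dest: sym)
  show "trans (loc_rel R U M)"
  proof (rule transI)
    fix p q r
    assume "(p, q) \<in> loc_rel R U M" "(q, r) \<in> loc_rel R U M"
    then obtain x s y t z w u v where pqr: "p = (x, s)" "q = (y, t)" "r = (z, w)"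
      and M: "x \<in> carrier M" "y \<in> carrier M" "z \<in> carrier M"
      and U: "s \<in> U" "t \<in> U" "w \<in> U" "u \<in> U" "v \<in> U"
      and u: "u \<odot>\<^bsub>M\<^esub> (t \<odot>\<^bsub>M\<^esub> x) = u \<odot>\<^bsub>M\<^esub> (s \<odot>\<^bsub>M\<^esub> y)"
      and v: "v \<odot>\<^bsub>M\<^esub> (w \<odot>\<^bsub>M\<^esub> y) = v \<odot>\<^bsub>M\<^esub> (t \<odot>\<^bsub>M\<^esub> z)"
      unfolding loc_rel_def by (cases p, cases q, cases r) blast
    note c = U[THEN U_carrier]
    \<comment> \<open>\<open>M\<close> may have torsion, so the middle denominator \<open>t\<close>
      cannot be cancelled; it becomes part of the witness.\<close>
    have "(u \<otimes> v \<otimes> t) \<odot>\<^bsub>M\<^esub> (w \<odot>\<^bsub>M\<^esub> x) = (v \<otimes> w) \<odot>\<^bsub>M\<^esub> (u \<odot>\<^bsub>M\<^esub> (t \<odot>\<^bsub>M\<^esub> x))"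
      using M c by (simp add: smult_assoc1[symmetric] R.m_ac)
    also have "\<dots> = (u \<otimes> s) \<odot>\<^bsub>M\<^esub> (v \<odot>\<^bsub>M\<^esub> (w \<odot>\<^bsub>M\<^esub> y))"
      unfolding u using M c by (simp add: smult_assoc1[symmetric] R.m_ac)
    also have "\<dots> = (u \<otimes> v \<otimes> t) \<odot>\<^bsub>M\<^esub> (s \<odot>\<^bsub>M\<^esub> z)"
      unfolding v using M c by (simp add: smult_assoc1[symmetric] R.m_ac)
    finally show "(p, r) \<in> loc_rel R U M"
      using pqr M U U_mult unfolding loc_rel_def by blast
  qed
qed

lemma frac_eq_iff:
  assumes "x \<in> carrier M" "y \<in> carrier M" "s \<in> U" "t \<in> U"
  shows "frac x s = frac y t \<longleftrightarrow> (\<exists>u\<in>U. u \<odot>\<^bsub>M\<^esub> (t \<odot>\<^bsub>M\<^esub> x) = u \<odot>\<^bsub>M\<^esub> (s \<odot>\<^bsub>M\<^esub> y))"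
  using eq_equiv_class_iff[OF equiv_loc_rel, of "(x, s)" "(y, t)"] assms
  by (auto simp: loc_frac_def loc_rel_def)

lemma frac_eqI:
  assumes "x \<in> carrier M" "y \<in> carrier M" "s \<in> U" "t \<in> U" "t \<odot>\<^bsub>M\<^esub> x = s \<odot>\<^bsub>M\<^esub> y"
  shows "frac x s = frac y t"
  using assms U_one by (auto simp: frac_eq_iff)

lemma frac_self: "\<lbrakk>x \<in> carrier M; s \<in> U\<rbrakk> \<Longrightarrow> (x, s) \<in> frac x s"
  using equiv_class_self[OF equiv_loc_rel] by (simp add: loc_frac_def)

lemma mem_frac:
  assumes "p \<in> frac x s"
  obtains y t where "p = (y, t)" "y \<in> carrier M" "t \<in> U" "x \<in> carrier M" "s \<in> U" "frac y t = frac x s"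
proof -
  have "((x, s), p) \<in> loc_rel R U M"
    using assms by (simp add: loc_frac_def)
  moreover from this have "frac x s = loc_rel R U M `` {p}"
    unfolding loc_frac_def using equiv_class_eq[OF equiv_loc_rel] by blast
  ultimately show ?thesis
    using that by (auto simp: loc_rel_def loc_frac_def)
qed

text \<open>The operations of the localization are unions over all representatives. A class is
  nonempty, so such a union collapses once the united set is the same for every representative, and
  only well-definedness remains to be shown.\<close>

lemma UN_frac_eq:
  assumes "x \<in> carrier M" "s \<in> U"
    and "\<And>y t. \<lbrakk>y \<in> carrier M; t \<in> U; frac y t = frac x s\<rbrakk> \<Longrightarrow> F y t = c"
  shows "(\<Union>(y, t)\<in>frac x s. F y t) = c"
proof -
  have "(case p of (y, t) \<Rightarrow> F y t) = c" if "p \<in> frac x s" for p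
    using that assms(3) by (auto elim!: mem_frac simp del: subset_antisym)
  then show ?thesis
    using frac_self[OF assms(1,2)] by blast
qed

lemma carrier_loc_module: "carrier (loc_module R U M) = {frac x s | x s. x \<in> carrier M \<and> s \<in> U}"
  by (auto simp: loc_module_def Let_def quotient_def loc_frac_def)

lemma frac_closed: "\<lbrakk>x \<in> carrier M; s \<in> U\<rbrakk> \<Longrightarrow> frac x s \<in> carrier (loc_module R U M)"
  by (auto simp: carrier_loc_module)

lemma zero_loc_module: "\<zero>\<^bsub>loc_module R U M\<^esub> = frac \<zero>\<^bsub>M\<^esub> \<one>"
  by (simp add: loc_module_def Let_def)

lemma frac_eq_zero_iff:
  assumes "x \<in> carrier M" "s \<in> U"
  shows "frac x s = \<zero>\<^bsub>loc_module R U M\<^esub> \<longleftrightarrow> (\<exists>u\<in>U. u \<odot>\<^bsub>M\<^esub> x = \<zero>\<^bsub>M\<^esub>)"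
  using assms U_one by (auto simp: zero_loc_module frac_eq_iff U_carrier)

lemma add_frac:
  assumes "x \<in> carrier M" "y \<in> carrier M" "s \<in> U" "t \<in> U"
  shows "frac x s \<oplus>\<^bsub>loc_module R U M\<^esub> frac y t = frac (t \<odot>\<^bsub>M\<^esub> x \<oplus>\<^bsub>M\<^esub> s \<odot>\<^bsub>M\<^esub> y) (s \<otimes> t)"
proof -
  have *: "frac (t' \<odot>\<^bsub>M\<^esub> x' \<oplus>\<^bsub>M\<^esub> s' \<odot>\<^bsub>M\<^esub> y') (s' \<otimes> t') = frac (t \<odot>\<^bsub>M\<^esub> x \<oplus>\<^bsub>M\<^esub> s \<odot>\<^bsub>M\<^esub> y) (s \<otimes> t)"
    if eqs: "x' \<in> carrier M" "y' \<in> carrier M" "s' \<in> U" "t' \<in> U"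
      "frac x' s' = frac x s" "frac y' t' = frac y t" for x' s' y' t'
  proof -
    obtain u v where uv: "u \<in> U" "v \<in> U" "u \<odot>\<^bsub>M\<^esub> (s \<odot>\<^bsub>M\<^esub> x') = u \<odot>\<^bsub>M\<^esub> (s' \<odot>\<^bsub>M\<^esub> x)"
        "v \<odot>\<^bsub>M\<^esub> (t \<odot>\<^bsub>M\<^esub> y') = v \<odot>\<^bsub>M\<^esub> (t' \<odot>\<^bsub>M\<^esub> y)"
      using assms eqs by (auto simp: frac_eq_iff)
    note c = assms eqs(1-4) uv(1,2) U_carrier
    have "(u \<otimes> v) \<odot>\<^bsub>M\<^esub> ((s \<otimes> t) \<odot>\<^bsub>M\<^esub> (t' \<odot>\<^bsub>M\<^esub> x' \<oplus>\<^bsub>M\<^esub> s' \<odot>\<^bsub>M\<^esub> y'))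
        = (v \<otimes> (t \<otimes> t')) \<odot>\<^bsub>M\<^esub> (u \<odot>\<^bsub>M\<^esub> (s \<odot>\<^bsub>M\<^esub> x')) \<oplus>\<^bsub>M\<^esub> (u \<otimes> (s \<otimes> s')) \<odot>\<^bsub>M\<^esub> (v \<odot>\<^bsub>M\<^esub> (t \<odot>\<^bsub>M\<^esub> y'))"
      using c by (simp add: smult_normalize)
    also have "\<dots> = (u \<otimes> v) \<odot>\<^bsub>M\<^esub> ((s' \<otimes> t') \<odot>\<^bsub>M\<^esub> (t \<odot>\<^bsub>M\<^esub> x \<oplus>\<^bsub>M\<^esub> s \<odot>\<^bsub>M\<^esub> y))"
      unfolding uv(3,4) using c by (simp add: smult_normalize)
    finally show ?thesis
      using c U_mult by (subst frac_eq_iff) auto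
  qed
  have "(\<Union>(x', s')\<in>frac x s. \<Union>(y', t')\<in>frac y t. frac (t' \<odot>\<^bsub>M\<^esub> x' \<oplus>\<^bsub>M\<^esub> s' \<odot>\<^bsub>M\<^esub> y') (s' \<otimes> t'))
      = frac (t \<odot>\<^bsub>M\<^esub> x \<oplus>\<^bsub>M\<^esub> s \<odot>\<^bsub>M\<^esub> y) (s \<otimes> t)"
    using assms by (intro UN_frac_eq *)
  then show ?thesis
    by (simp add: loc_module_def Let_def)
qed

end

section \<open>Localized rings as localized modules\<close>

lemma ring_as_module_simps [simp]:
  fixes R (structure)
  shows "carrier (ring_as_module R) = carrier R" "\<zero>\<^bsub>ring_as_module R\<^esub> = \<zero>"
    "x \<oplus>\<^bsub>ring_as_module R\<^esub> y = x \<oplus> y" "r \<odot>\<^bsub>ring_as_module R\<^esub> x = r \<otimes> x"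
  by (simp_all add: ring_as_module_def)

lemma (in cring) ring_as_module_module: "module R (ring_as_module R)"
proof (rule moduleI)
  show "abelian_group (ring_as_module R)"
    by (rule abelian_group_cong[OF is_abelian_group]) auto
qed (auto simp: is_cring l_distr r_distr m_assoc)

locale mult_subset = cring R for R (structure) +
  fixes U
  assumes subset: "U \<subseteq> carrier R" and one: "\<one> \<in> U"
    and mult: "\<lbrakk>s \<in> U; t \<in> U\<rbrakk> \<Longrightarrow> s \<otimes> t \<in> U"

text \<open>Fractions of ring elements are handled as fractions of the module
  \<open>ring_as_module R\<close>; the product of the localized ring is then its scalar
  multiplication, and calculations on representatives are made only once.\<close>

sublocale mult_subset \<subseteq> rng: localized_module R "ring_as_module R" U
  by (intro localized_module.intro ring_as_module_module localized_module_axioms.intro subset one mult)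

context mult_subset begin

lemma loc_ring_simps:
  "carrier (loc_ring R U) = carrier (loc_module R U (ring_as_module R))"
  "\<zero>\<^bsub>loc_ring R U\<^esub> = \<zero>\<^bsub>loc_module R U (ring_as_module R)\<^esub>"
  "\<one>\<^bsub>loc_ring R U\<^esub> = rng.frac \<one> \<one>"
  "A \<oplus>\<^bsub>loc_ring R U\<^esub> B = A \<oplus>\<^bsub>loc_module R U (ring_as_module R)\<^esub> B"
  "A \<otimes>\<^bsub>loc_ring R U\<^esub> B = A \<odot>\<^bsub>loc_module R U (ring_as_module R)\<^esub> B"
  by (simp_all add: loc_ring_def loc_module_def Let_def)

end

context localized_module begin

sublocale ms: mult_subset R U
  by unfold_locales (auto simp: U_subset U_one U_mult)

lemma smult_frac:
  assumes "a \<in> carrier R" "x \<in> carrier M" "s \<in> U" "t \<in> U"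
  shows "ms.rng.frac a s \<odot>\<^bsub>loc_module R U M\<^esub> frac x t = frac (a \<odot>\<^bsub>M\<^esub> x) (s \<otimes> t)"
proof -
  have *: "frac (a' \<odot>\<^bsub>M\<^esub> x') (s' \<otimes> t') = frac (a \<odot>\<^bsub>M\<^esub> x) (s \<otimes> t)"
    if eqs: "a' \<in> carrier R" "x' \<in> carrier M" "s' \<in> U" "t' \<in> U"
      "ms.rng.frac a' s' = ms.rng.frac a s" "frac x' t' = frac x t" for a' s' x' t'
  proof -
    obtain u v where uv: "u \<in> U" "v \<in> U" "u \<otimes> (s \<otimes> a') = u \<otimes> (s' \<otimes> a)"
        "v \<odot>\<^bsub>M\<^esub> (t \<odot>\<^bsub>M\<^esub> x') = v \<odot>\<^bsub>M\<^esub> (t' \<odot>\<^bsub>M\<^esub> x)"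
      using assms eqs by (auto simp: frac_eq_iff ms.rng.frac_eq_iff)
    note c = assms eqs(1-4) uv(1,2) U_carrier
    have "(u \<otimes> v) \<odot>\<^bsub>M\<^esub> ((s \<otimes> t) \<odot>\<^bsub>M\<^esub> (a' \<odot>\<^bsub>M\<^esub> x'))
        = (u \<otimes> (s \<otimes> a')) \<odot>\<^bsub>M\<^esub> (v \<odot>\<^bsub>M\<^esub> (t \<odot>\<^bsub>M\<^esub> x'))"
      using c by (simp add: smult_normalize)
    also have "\<dots> = (u \<otimes> v) \<odot>\<^bsub>M\<^esub> ((s' \<otimes> t') \<odot>\<^bsub>M\<^esub> (a \<odot>\<^bsub>M\<^esub> x))"
      unfolding uv(3,4) using c by (simp add: smult_normalize)
    finally show ?thesis
      using c U_mult by (subst frac_eq_iff) auto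
  qed
  have "(\<Union>(a', s')\<in>ms.rng.frac a s. \<Union>(x', t')\<in>frac x t. frac (a' \<odot>\<^bsub>M\<^esub> x') (s' \<otimes> t'))
      = frac (a \<odot>\<^bsub>M\<^esub> x) (s \<otimes> t)"
    using assms by (intro UN_frac_eq ms.rng.UN_frac_eq *) simp_all
  then show ?thesis
    by (simp add: loc_module_def Let_def)
qed

lemma loc_module_cases:
  assumes "A \<in> carrier (loc_module R U M)"
  obtains x s where "A = frac x s" "x \<in> carrier M" "s \<in> U"
  using assms by (auto simp: carrier_loc_module)

lemma abelian_group_loc_module: "abelian_group (loc_module R U M)"
proof (rule abelian_groupI)
  note [elim!] = loc_module_cases
  note [simp] = U_mult U_one U_carrier add_frac zero_loc_module frac_closed
  fix A B assume A: "A \<in> carrier (loc_module R U M)"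
  show "\<zero>\<^bsub>loc_module R U M\<^esub> \<oplus>\<^bsub>loc_module R U M\<^esub> A = A"
    using A by auto
  show "\<exists>B\<in>carrier (loc_module R U M). B \<oplus>\<^bsub>loc_module R U M\<^esub> A = \<zero>\<^bsub>loc_module R U M\<^esub>"
  proof -
    from A obtain x s where x: "A = frac x s" "x \<in> carrier M" "s \<in> U" by auto
    have "frac (\<ominus>\<^bsub>M\<^esub> x) s \<oplus>\<^bsub>loc_module R U M\<^esub> A = \<zero>\<^bsub>loc_module R U M\<^esub>"
      unfolding x(1) zero_loc_module using x(2,3)
      by (subst add_frac, (simp_all)[4], intro frac_eqI) (simp_all add: smult_r_minus M.l_neg)
    then show ?thesis
      using x by (intro bexI[of _ "frac (\<ominus>\<^bsub>M\<^esub> x) s"]) auto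
  qed
  assume B: "B \<in> carrier (loc_module R U M)"
  show "A \<oplus>\<^bsub>loc_module R U M\<^esub> B \<in> carrier (loc_module R U M)"
    using A B by auto
  show "A \<oplus>\<^bsub>loc_module R U M\<^esub> B = B \<oplus>\<^bsub>loc_module R U M\<^esub> A"
    using A B by (auto intro!: frac_eqI simp: smult_normalize)
  fix C assume C: "C \<in> carrier (loc_module R U M)"
  show "A \<oplus>\<^bsub>loc_module R U M\<^esub> B \<oplus>\<^bsub>loc_module R U M\<^esub> C = A \<oplus>\<^bsub>loc_module R U M\<^esub> (B \<oplus>\<^bsub>loc_module R U M\<^esub> C)"
    using A B C by (auto intro!: frac_eqI simp: smult_normalize)
qed (auto simp: zero_loc_module frac_closed U_one)

end

context mult_subset begin

lemma frac_closed: "\<lbrakk>a \<in> carrier R; s \<in> U\<rbrakk> \<Longrightarrow> rng.frac a s \<in> carrier (loc_ring R U)"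
  by (simp add: loc_ring_simps rng.frac_closed)

lemma add_frac:
  assumes "a \<in> carrier R" "b \<in> carrier R" "s \<in> U" "t \<in> U"
  shows "rng.frac a s \<oplus>\<^bsub>loc_ring R U\<^esub> rng.frac b t = rng.frac (t \<otimes> a \<oplus> s \<otimes> b) (s \<otimes> t)"
  using assms rng.add_frac[of a b s t] by (simp add: loc_ring_simps)

lemma mult_frac:
  assumes "a \<in> carrier R" "b \<in> carrier R" "s \<in> U" "t \<in> U"
  shows "rng.frac a s \<otimes>\<^bsub>loc_ring R U\<^esub> rng.frac b t = rng.frac (a \<otimes> b) (s \<otimes> t)"
  using assms rng.smult_frac[of a b s t] by (simp add: loc_ring_simps)

lemma one_loc_ring: "\<one>\<^bsub>loc_ring R U\<^esub> = rng.frac \<one> \<one>"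
  by (simp add: loc_ring_simps)

lemma frac_eqI:
  assumes "a \<in> carrier R" "b \<in> carrier R" "s \<in> U" "t \<in> U" "t \<otimes> a = s \<otimes> b"
  shows "rng.frac a s = rng.frac b t"
  using assms by (intro rng.frac_eqI) auto

lemma loc_ring_cases:
  assumes "A \<in> carrier (loc_ring R U)"
  obtains a s where "A = rng.frac a s" "a \<in> carrier R" "s \<in> U"
  using assms by (auto simp: loc_ring_simps elim: rng.loc_module_cases)

lemma cring_loc_ring: "cring (loc_ring R U)"
proof (rule cringI)
  note [elim!] = loc_ring_cases
  note [simp] = mult one rng.U_carrier add_frac mult_frac one_loc_ring frac_closed
  show "abelian_group (loc_ring R U)"
    by (rule abelian_group_cong[OF rng.abelian_group_loc_module]) (simp_all add: loc_ring_simps)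
  show "comm_monoid (loc_ring R U)"
    by (rule comm_monoidI) (auto intro!: frac_eqI simp: m_ac)
  show "(A \<oplus>\<^bsub>loc_ring R U\<^esub> B) \<otimes>\<^bsub>loc_ring R U\<^esub> C
      = A \<otimes>\<^bsub>loc_ring R U\<^esub> C \<oplus>\<^bsub>loc_ring R U\<^esub> B \<otimes>\<^bsub>loc_ring R U\<^esub> C"
    if "A \<in> carrier (loc_ring R U)" "B \<in> carrier (loc_ring R U)" "C \<in> carrier (loc_ring R U)" for A B C
  proof -
    from that obtain a s b t c u where abc: "A = rng.frac a s" "B = rng.frac b t" "C = rng.frac c u"
      and [simp]: "a \<in> carrier R" "b \<in> carrier R" "c \<in> carrier R" "s \<in> U" "t \<in> U" "u \<in> U"
      by blast
    show ?thesis
      unfolding abc by (simp, intro frac_eqI) (simp_all add: m_ac r_distr l_distr)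
  qed
qed

lemma frac_eq_zero_iff:
  assumes "a \<in> carrier R" "s \<in> U"
  shows "rng.frac a s = \<zero>\<^bsub>loc_ring R U\<^esub> \<longleftrightarrow> (\<exists>u\<in>U. u \<otimes> a = \<zero>)"
  using assms rng.frac_eq_zero_iff[of a s] by (simp add: loc_ring_simps)

lemma pow_frac:
  "a \<in> carrier R \<Longrightarrow> rng.frac a \<one> [^]\<^bsub>loc_ring R U\<^esub> (n::nat) = rng.frac (a [^] n) \<one>"
proof (induction n)
  case 0
  interpret L: cring "loc_ring R U" by (rule cring_loc_ring)
  show ?case by (simp add: one_loc_ring)
next
  case (Suc n)
  interpret L: cring "loc_ring R U" by (rule cring_loc_ring)
  show ?case using Suc by (simp add: mult_frac one)
qed

lemma domain_loc_ring:
  assumes "domain R" "\<zero> \<notin> U"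
  shows "domain (loc_ring R U)"
proof -
  interpret D: domain R by fact
  interpret L: cring "loc_ring R U" by (rule cring_loc_ring)
  have *: "rng.frac a s = \<zero>\<^bsub>loc_ring R U\<^esub> \<longleftrightarrow> a = \<zero>" if "a \<in> carrier R" "s \<in> U" for a s
    using that assms(2) D.integral_iff one by (auto simp: frac_eq_zero_iff rng.U_carrier)
  show ?thesis
  proof (intro domain.intro domain_axioms.intro L.is_cring)
    show "\<one>\<^bsub>loc_ring R U\<^esub> \<noteq> \<zero>\<^bsub>loc_ring R U\<^esub>"
      using one by (simp add: one_loc_ring *)
    fix A B
    assume AB: "A \<otimes>\<^bsub>loc_ring R U\<^esub> B = \<zero>\<^bsub>loc_ring R U\<^esub>"
      "A \<in> carrier (loc_ring R U)" "B \<in> carrier (loc_ring R U)"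
    then obtain a s b t where "A = rng.frac a s" "B = rng.frac b t" "a \<in> carrier R" "b \<in> carrier R" "s \<in> U" "t \<in> U"
      by (auto elim!: loc_ring_cases)
    then show "A = \<zero>\<^bsub>loc_ring R U\<^esub> \<or> B = \<zero>\<^bsub>loc_ring R U\<^esub>"
      using AB(1) by (simp add: mult_frac * mult D.integral_iff)
  qed
qed

end

context localized_module begin

lemma module_loc_module: "module (loc_ring R U) (loc_module R U M)"
proof (rule moduleI)
  note [elim!] = loc_module_cases ms.loc_ring_cases
  note [simp] = U_mult U_one U_carrier add_frac frac_closed ms.add_frac ms.mult_frac ms.one_loc_ring smult_frac
  show "cring (loc_ring R U)" by (rule ms.cring_loc_ring)
  show "abelian_group (loc_module R U M)" by (rule abelian_group_loc_module)
  show "\<one>\<^bsub>loc_ring R U\<^esub> \<odot>\<^bsub>loc_module R U M\<^esub> P = P"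
    if "P \<in> carrier (loc_module R U M)" for P
    using that by (auto intro!: frac_eqI simp: smult_normalize)
  fix A P assume A: "A \<in> carrier (loc_ring R U)" and P: "P \<in> carrier (loc_module R U M)"
  show "A \<odot>\<^bsub>loc_module R U M\<^esub> P \<in> carrier (loc_module R U M)"
    using A P by auto
  show "(A \<oplus>\<^bsub>loc_ring R U\<^esub> B) \<odot>\<^bsub>loc_module R U M\<^esub> P
      = A \<odot>\<^bsub>loc_module R U M\<^esub> P \<oplus>\<^bsub>loc_module R U M\<^esub> B \<odot>\<^bsub>loc_module R U M\<^esub> P"
    if B: "B \<in> carrier (loc_ring R U)" for B
  proof -
    from A B P obtain a s b t x u where abx: "A = ms.rng.frac a s" "B = ms.rng.frac b t" "P = frac x u"
      and [simp]: "a \<in> carrier R" "b \<in> carrier R" "x \<in> carrier M" "s \<in> U" "t \<in> U" "u \<in> U"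
      by blast
    show ?thesis
      unfolding abx by (simp, intro frac_eqI) (simp_all add: smult_normalize R.r_distr R.l_distr)
  qed
  show "A \<odot>\<^bsub>loc_module R U M\<^esub> (P \<oplus>\<^bsub>loc_module R U M\<^esub> Q)
      = A \<odot>\<^bsub>loc_module R U M\<^esub> P \<oplus>\<^bsub>loc_module R U M\<^esub> A \<odot>\<^bsub>loc_module R U M\<^esub> Q"
    if Q: "Q \<in> carrier (loc_module R U M)" for Q
  proof -
    from A P Q obtain a s x t y u where axy: "A = ms.rng.frac a s" "P = frac x t" "Q = frac y u"
      and [simp]: "a \<in> carrier R" "x \<in> carrier M" "y \<in> carrier M" "s \<in> U" "t \<in> U" "u \<in> U"
      by blast
    show ?thesis
      unfolding axy by (simp, intro frac_eqI) (simp_all add: smult_normalize)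
  qed
  show "(A \<otimes>\<^bsub>loc_ring R U\<^esub> B) \<odot>\<^bsub>loc_module R U M\<^esub> P = A \<odot>\<^bsub>loc_module R U M\<^esub> (B \<odot>\<^bsub>loc_module R U M\<^esub> P)"
    if "B \<in> carrier (loc_ring R U)" for B
    using that A P by (auto intro!: frac_eqI simp: smult_normalize)
qed

end

section \<open>Tensor products\<close>

lemma keys_frag_extend_frag_of:
  "Poly_Mapping.keys c \<subseteq> A \<Longrightarrow> g ` A \<subseteq> B \<Longrightarrow> Poly_Mapping.keys (frag_extend (\<lambda>p. frag_of (g p)) c) \<subseteq> B"
  by (rule order_trans[OF keys_frag_extend]) auto

locale module_pair =
  fixes R (structure) and N and M
  assumes N: "module R N" and M: "module R M"
begin

sublocale N: module R N by (rule N)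
sublocale M: module R M by (rule M)

abbreviation K where "K \<equiv> tensor_kernel R N M"
abbreviation pairs where "pairs \<equiv> carrier N \<times> carrier M"

lemma keys_relators: "c \<in> tensor_relators R N M \<Longrightarrow> Poly_Mapping.keys c \<subseteq> pairs"
  unfolding tensor_relators_def
  by (auto dest!: subsetD[OF keys_diff])

lemma relators_subset: "tensor_relators R N M \<subseteq> carrier (free_Abelian_group pairs)"
  using keys_relators by (simp add: subsetI)

lemma keys_kernel: "c \<in> K \<Longrightarrow> Poly_Mapping.keys c \<subseteq> pairs"
  using subsetD[OF group.generate_incl[OF group_free_Abelian_group relators_subset], of c]
  by (simp add: tensor_kernel_def)

lemma kernel_zero: "0 \<in> K"
  using generate.one[of "free_Abelian_group pairs"] by (simp add: tensor_kernel_def)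

lemma kernel_relator: "c \<in> tensor_relators R N M \<Longrightarrow> c \<in> K"
  by (simp add: tensor_kernel_def generate.incl)

lemma kernel_add: "\<lbrakk>c \<in> K; d \<in> K\<rbrakk> \<Longrightarrow> c + d \<in> K"
  using generate.eng[of c "free_Abelian_group pairs" _ d] by (simp add: tensor_kernel_def)

lemma kernel_uminus: "c \<in> K \<Longrightarrow> - c \<in> K"
  using group.generate_m_inv_closed[OF group_free_Abelian_group relators_subset, of c] keys_kernel[of c]
  by (simp add: tensor_kernel_def)

lemma kernel_diff: "\<lbrakk>c \<in> K; d \<in> K\<rbrakk> \<Longrightarrow> c - d \<in> K"
  using kernel_add[of c "- d"] kernel_uminus by simp

lemma kernel_sum: "(\<And>i. i \<in> I \<Longrightarrow> c i \<in> K) \<Longrightarrow> sum c I \<in> K"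
  by (induction I rule: infinite_finite_induct) (auto simp: kernel_zero kernel_add)

lemma kernel_add_left:
  "\<lbrakk>x \<in> carrier N; x' \<in> carrier N; y \<in> carrier M\<rbrakk>
    \<Longrightarrow> frag_of (x \<oplus>\<^bsub>N\<^esub> x', y) - frag_of (x, y) - frag_of (x', y) \<in> K"
  by (rule kernel_relator) (auto simp: tensor_relators_def)

lemma kernel_add_right:
  "\<lbrakk>x \<in> carrier N; y \<in> carrier M; y' \<in> carrier M\<rbrakk>
    \<Longrightarrow> frag_of (x, y \<oplus>\<^bsub>M\<^esub> y') - frag_of (x, y) - frag_of (x, y') \<in> K"
  by (rule kernel_relator) (auto simp: tensor_relators_def)

lemma kernel_smult:
  "\<lbrakk>r \<in> carrier R; x \<in> carrier N; y \<in> carrier M\<rbrakk>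
    \<Longrightarrow> frag_of (r \<odot>\<^bsub>N\<^esub> x, y) - frag_of (x, r \<odot>\<^bsub>M\<^esub> y) \<in> K"
  by (rule kernel_relator) (auto simp: tensor_relators_def)

lemma kernel_zero_left: "y \<in> carrier M \<Longrightarrow> frag_of (\<zero>\<^bsub>N\<^esub>, y) \<in> K"
  using kernel_uminus[OF kernel_add_left[of "\<zero>\<^bsub>N\<^esub>" "\<zero>\<^bsub>N\<^esub>" y]] by simp

lemma kernel_zero_right: "x \<in> carrier N \<Longrightarrow> frag_of (x, \<zero>\<^bsub>M\<^esub>) \<in> K"
  using kernel_uminus[OF kernel_add_right[of x "\<zero>\<^bsub>M\<^esub>" "\<zero>\<^bsub>M\<^esub>"]] by simp

lemma kernel_induct [consumes 1, case_names zero add_left add_right smult uminus add]: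
  assumes "c \<in> K" and "P 0"
    and "\<And>x x' y. \<lbrakk>x \<in> carrier N; x' \<in> carrier N; y \<in> carrier M\<rbrakk>
      \<Longrightarrow> P (frag_of (x \<oplus>\<^bsub>N\<^esub> x', y) - frag_of (x, y) - frag_of (x', y))"
    and "\<And>x y y'. \<lbrakk>x \<in> carrier N; y \<in> carrier M; y' \<in> carrier M\<rbrakk>
      \<Longrightarrow> P (frag_of (x, y \<oplus>\<^bsub>M\<^esub> y') - frag_of (x, y) - frag_of (x, y'))"
    and "\<And>r x y. \<lbrakk>r \<in> carrier R; x \<in> carrier N; y \<in> carrier M\<rbrakk>
      \<Longrightarrow> P (frag_of (r \<odot>\<^bsub>N\<^esub> x, y) - frag_of (x, r \<odot>\<^bsub>M\<^esub> y))"
    and "\<And>c. \<lbrakk>c \<in> K; P c\<rbrakk> \<Longrightarrow> P (- c)" and "\<And>c d. \<lbrakk>c \<in> K; d \<in> K; P c; P d\<rbrakk> \<Longrightarrow> P (c + d)"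
  shows "P c"
proof -
  have rel: "P c" if "c \<in> tensor_relators R N M" for c
    using that unfolding tensor_relators_def by (auto intro: assms(3-5))
  have "c \<in> K \<and> P c"
    using assms(1) unfolding tensor_kernel_def
  proof (induction rule: generate.induct)
    case one then show ?case
      using assms(2) kernel_zero by (simp add: tensor_kernel_def)
  next
    case (incl c) then show ?case
      using rel kernel_relator by (simp add: tensor_kernel_def)
  next
    case (inv c)
    then have "inv\<^bsub>free_Abelian_group pairs\<^esub> c = - c"
      by (simp add: keys_relators)
    then show ?case
      using inv rel assms(6) kernel_relator kernel_uminus by (simp add: tensor_kernel_def)
  next
    case (eng c d) then show ?case
      using assms(7) kernel_add by (simp add: tensor_kernel_def)
  qed
  then show ?thesis ..
qed

lemma carrier_tensor_product:
  "carrier (tensor_product R N M) = (\<lambda>c. {k + c | k. k \<in> K}) ` {c. Poly_Mapping.keys c \<subseteq> pairs}"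
proof -
  have "K #>\<^bsub>free_Abelian_group pairs\<^esub> c = {k + c | k. k \<in> K}" for c
    by (auto simp: r_coset_def)
  moreover have "carrier (free_Abelian_group pairs) = {c. Poly_Mapping.keys c \<subseteq> pairs}"
    by auto
  ultimately show ?thesis
    by (simp add: tensor_product_def carrier_FactGroup)
qed

lemma coset_eq_iff: "{k + c | k. k \<in> K} = {k + d | k. k \<in> K} \<longleftrightarrow> c - d \<in> K"
proof
  assume "{k + c | k. k \<in> K} = {k + d | k. k \<in> K}"
  moreover have "c \<in> {k + c | k. k \<in> K}"
    using kernel_zero by force
  ultimately obtain k where "c = k + d" "k \<in> K"
    by blast
  then show "c - d \<in> K" by simp
next
  have *: "\<exists>k'. k + c = k' + d \<and> k' \<in> K" if "c - d \<in> K" "k \<in> K" for c d k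
    using that kernel_add by (intro exI[of _ "k + (c - d)"]) auto
  assume "c - d \<in> K"
  moreover have "d - c \<in> K"
    using kernel_uminus[OF calculation] by simp
  ultimately show "{k + c | k. k \<in> K} = {k + d | k. k \<in> K}"
    using * by blast
qed

text \<open>Elementary tensors suffice because they generate the free group and \<open>K\<close> is
  closed under differences.\<close>

lemma tensor_product_trivial_iff:
  "carrier (tensor_product R N M) = {\<one>\<^bsub>tensor_product R N M\<^esub>}
    \<longleftrightarrow> (\<forall>x\<in>carrier N. \<forall>y\<in>carrier M. frag_of (x, y) \<in> K)"
proof -
  have coset: "{k + c | k. k \<in> K} = K \<longleftrightarrow> c \<in> K" for c
    using coset_eq_iff[of c 0] by simp
  have "carrier (tensor_product R N M) = {\<one>\<^bsub>tensor_product R N M\<^esub>}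
    \<longleftrightarrow> (\<forall>c. Poly_Mapping.keys c \<subseteq> pairs \<longrightarrow> {k + c | k. k \<in> K} = K)"
  proof -
    have image: "F ` S = {a} \<longleftrightarrow> (\<forall>x\<in>S. F x = a)" if "S \<noteq> {}" for F :: "'x \<Rightarrow> 'y" and S a
    proof
      assume "F ` S = {a}"
      then show "\<forall>x\<in>S. F x = a" by (metis imageI singletonD)
    next
      assume "\<forall>x\<in>S. F x = a"
      then have "F ` S = (\<lambda>_. a) ` S" by (intro image_cong) auto
      then show "F ` S = {a}" using that by (simp add: image_constant_conv)
    qed
    have "{c. Poly_Mapping.keys c \<subseteq> pairs} \<noteq> {}"
      by (auto intro!: exI[of _ 0])
    from image[OF this] show ?thesis
      unfolding carrier_tensor_product by (simp add: tensor_product_def)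
  qed
  also have "\<dots> \<longleftrightarrow> (\<forall>c. Poly_Mapping.keys c \<subseteq> pairs \<longrightarrow> c \<in> K)"
    unfolding coset ..
  also have "\<dots> \<longleftrightarrow> (\<forall>x\<in>carrier N. \<forall>y\<in>carrier M. frag_of (x, y) \<in> K)"
  proof (intro iffI allI impI ballI)
    fix c :: "_ \<Rightarrow>\<^sub>0 int"
    assume *: "\<forall>x\<in>carrier N. \<forall>y\<in>carrier M. frag_of (x, y) \<in> K" and "Poly_Mapping.keys c \<subseteq> pairs"
    from this(2) show "c \<in> K"
    proof (induction c rule: frag_induction)
      case (one p)
      with * show ?case by (cases p) simp
    qed (simp_all add: kernel_zero kernel_diff)
  next
    fix x y
    assume "\<forall>c. Poly_Mapping.keys c \<subseteq> pairs \<longrightarrow> c \<in> K" "x \<in> carrier N" "y \<in> carrier M"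
    then show "frag_of (x, y) \<in> K" by simp
  qed
  finally show ?thesis .
qed

end

section \<open>Homomorphisms out of the tensor product\<close>

lemma abelian_group_hom_frag:
  assumes "abelian_group G" "h \<in> hom (free_Abelian_group A) (add_monoid G)"
  shows "h 0 = \<zero>\<^bsub>G\<^esub>"
    and "Poly_Mapping.keys c \<subseteq> A \<Longrightarrow> h c \<in> carrier G"
    and "\<lbrakk>Poly_Mapping.keys c \<subseteq> A; Poly_Mapping.keys d \<subseteq> A\<rbrakk> \<Longrightarrow> h (c + d) = h c \<oplus>\<^bsub>G\<^esub> h d"
    and "Poly_Mapping.keys c \<subseteq> A \<Longrightarrow> h (- c) = \<ominus>\<^bsub>G\<^esub> h c"
    and "\<lbrakk>Poly_Mapping.keys c \<subseteq> A; Poly_Mapping.keys d \<subseteq> A\<rbrakk> \<Longrightarrow> h (c - d) = h c \<ominus>\<^bsub>G\<^esub> h d"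
proof -
  interpret G: abelian_group G by fact
  interpret h: group_hom "free_Abelian_group A" "add_monoid G" h
    by (intro group_hom.intro group_hom_axioms.intro assms group_free_Abelian_group) (rule G.a_group)
  show "h 0 = \<zero>\<^bsub>G\<^esub>"
    using h.hom_one by simp
  show closed: "h c \<in> carrier G" if "Poly_Mapping.keys c \<subseteq> A" for c
    using h.hom_closed[of c] that by simp
  show add: "h (c + d) = h c \<oplus>\<^bsub>G\<^esub> h d" if "Poly_Mapping.keys c \<subseteq> A" "Poly_Mapping.keys d \<subseteq> A" for c d
    using h.hom_mult[of c d] that by simp
  show minus: "h (- c) = \<ominus>\<^bsub>G\<^esub> h c" if "Poly_Mapping.keys c \<subseteq> A" for c
    using h.hom_inv[of c] that by (simp add: a_inv_def)
  show "h (c - d) = h c \<ominus>\<^bsub>G\<^esub> h d" if "Poly_Mapping.keys c \<subseteq> A" "Poly_Mapping.keys d \<subseteq> A"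
    using add[of c "- d"] minus[of d] that by (simp add: a_minus_def)
qed

lemma ex_frag_hom:
  assumes "abelian_group G" "\<And>a. a \<in> A \<Longrightarrow> f a \<in> carrier G"
  shows "\<exists>h\<in>hom (free_Abelian_group A) (add_monoid G). \<forall>a\<in>A. h (frag_of a) = f a"
proof -
  interpret G: abelian_group G by fact
  have "f ` A \<subseteq> carrier (add_monoid G)"
    using assms(2) by auto
  from comm_group.free_Abelian_group_universal[OF G.a_comm_group this] show ?thesis by metis
qed

context module_pair begin

text \<open>The universal property of the tensor product in kernel form: a biadditive balanced
  \<open>b\<close> makes \<open>h\<close> vanish on each of the three kinds of relators.\<close>

lemma kernel_eval_zero:
  assumes "abelian_group G" and h: "h \<in> hom (free_Abelian_group pairs) (add_monoid G)"
    and hf: "\<And>x y. \<lbrakk>x \<in> carrier N; y \<in> carrier M\<rbrakk> \<Longrightarrow> h (frag_of (x, y)) = b x y"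
    and add_left: "\<And>x x' y. \<lbrakk>x \<in> carrier N; x' \<in> carrier N; y \<in> carrier M\<rbrakk> \<Longrightarrow> b (x \<oplus>\<^bsub>N\<^esub> x') y = b x y \<oplus>\<^bsub>G\<^esub> b x' y"
    and add_right: "\<And>x y y'. \<lbrakk>x \<in> carrier N; y \<in> carrier M; y' \<in> carrier M\<rbrakk> \<Longrightarrow> b x (y \<oplus>\<^bsub>M\<^esub> y') = b x y \<oplus>\<^bsub>G\<^esub> b x y'"
    and smult: "\<And>r x y. \<lbrakk>r \<in> carrier R; x \<in> carrier N; y \<in> carrier M\<rbrakk> \<Longrightarrow> b (r \<odot>\<^bsub>N\<^esub> x) y = b x (r \<odot>\<^bsub>M\<^esub> y)"
    and "c \<in> K"
  shows "h c = \<zero>\<^bsub>G\<^esub>"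
proof -
  interpret G: abelian_group G by fact
  note hom = abelian_group_hom_frag[OF assms(1) h]
  have closed: "b x y \<in> carrier G" if "x \<in> carrier N" "y \<in> carrier M" for x y
    using hom(2)[of "frag_of (x, y)"] hf that by simp
  note [simp] = hom hf closed keys_diff[THEN order_trans]
  show ?thesis
    using \<open>c \<in> K\<close>
  proof (induction rule: kernel_induct)
    case (add_left x x' y)
    then have "h (frag_of (x \<oplus>\<^bsub>N\<^esub> x', y) - frag_of (x, y) - frag_of (x', y))
        = (b x y \<oplus>\<^bsub>G\<^esub> b x' y) \<ominus>\<^bsub>G\<^esub> b x y \<ominus>\<^bsub>G\<^esub> b x' y"
      by (simp add: assms(4))
    then show ?case
      using add_left by (simp add: a_minus_def G.minus_add G.r_neg G.a_ac)
  next
    case (add_right x y y')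
    then have "h (frag_of (x, y \<oplus>\<^bsub>M\<^esub> y') - frag_of (x, y) - frag_of (x, y'))
        = (b x y \<oplus>\<^bsub>G\<^esub> b x y') \<ominus>\<^bsub>G\<^esub> b x y \<ominus>\<^bsub>G\<^esub> b x y'"
      by (simp add: assms(5))
    then show ?case
      using add_right by (simp add: a_minus_def G.minus_add G.r_neg G.a_ac)
  next
    case (smult r x y)
    then show ?case
      by (simp add: assms(6) G.minus_eq G.r_neg)
  qed (simp_all add: keys_kernel)
qed

end

text \<open>Each kind of relator goes to a relator of the same kind; this is why \<open>f\<close>
  and the identity induce a map of tensor products.\<close>

lemma frag_map_linear_maps:
  assumes "module R N" "module R N'" "module R M" "f \<in> linear_maps R N N'" "c \<in> tensor_kernel R N M"
  shows "frag_extend (\<lambda>(x, y). frag_of (f x, y)) c \<in> tensor_kernel R N' M"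
proof -
  interpret P: module_pair R N M by (intro module_pair.intro assms)
  interpret P': module_pair R N' M by (intro module_pair.intro assms)
  have f: "f x \<in> carrier N'" if "x \<in> carrier N" for x
    using assms(4) that by (auto simp: linear_maps_def)
  show ?thesis
    using assms(5)
  proof (induction rule: P.kernel_induct)
    case (add_left x x' y)
    then show ?case
      using P'.kernel_add_left[of "f x" "f x'" y] assms(4) f by (simp add: frag_extend_diff linear_maps_def)
  next
    case (add_right x y y')
    then show ?case
      using P'.kernel_add_right[of "f x" y y'] assms(4) f by (simp add: frag_extend_diff linear_maps_def)
  next
    case (smult r x y)
    then show ?case
      using P'.kernel_smult[of r "f x" y] assms(4) f by (simp add: frag_extend_diff linear_maps_def)
  qed (simp_all add: P'.kernel_zero P'.kernel_uminus P'.kernel_add frag_extend_minus frag_extend_add)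
qed

text \<open>The map on cosets is induced by an additive map on formal sums, so its injectivity is
  triviality of its kernel. From here on flatness is a statement about formal sums.\<close>

lemma inj_on_tensor_map_iff:
  fixes R :: "('r, 'p) ring_scheme" and M :: "('r, 'm, 'k) module_scheme"
  assumes "module R N" "module R N'" "module R M" "f \<in> linear_maps R N N'"
  shows "inj_on (tensor_map R N' M f) (carrier (tensor_product R N M)) \<longleftrightarrow>
    (\<forall>c. Poly_Mapping.keys c \<subseteq> carrier N \<times> carrier M \<longrightarrow>
      frag_extend (\<lambda>(x, y). frag_of (f x, y)) c \<in> tensor_kernel R N' M \<longrightarrow> c \<in> tensor_kernel R N M)"
proof -
  interpret P: module_pair R N M by (intro module_pair.intro assms)
  interpret P': module_pair R N' M by (intro module_pair.intro assms)
  define F where "F = frag_extend (\<lambda>(x, y). frag_of (f x, y :: 'm))"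
  define C where "C c = {k + c | k. k \<in> P.K}" for c
  define C' where "C' c = {k + c | k. k \<in> P'.K}" for c
  have coset: "P'.K #>\<^bsub>free_Abelian_group P'.pairs\<^esub> d = C' d" for d
    by (auto simp: r_coset_def C'_def)
  have map: "tensor_map R N' M f (C c) = C' (F c)" for c
  proof -
    have "C' (F d) = C' (F c)" if "d \<in> C c" for d
    proof -
      have "d - c \<in> P.K"
        using that by (auto simp: C_def)
      then have "F d - F c \<in> P'.K"
        using frag_map_linear_maps[OF assms] by (simp add: F_def flip: frag_extend_diff)
      then show ?thesis
        unfolding C'_def by (simp only: P'.coset_eq_iff)
    qed
    moreover have "c \<in> C c"
      using P.kernel_zero by (force simp: C_def)
    ultimately show ?thesis
      unfolding tensor_map_def coset F_def[symmetric] by (intro UN_constant_eq ballI)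
  qed
  have "inj_on (tensor_map R N' M f) (carrier (tensor_product R N M)) \<longleftrightarrow>
     (\<forall>c d. Poly_Mapping.keys c \<subseteq> P.pairs \<longrightarrow> Poly_Mapping.keys d \<subseteq> P.pairs \<longrightarrow> C' (F c) = C' (F d) \<longrightarrow> C c = C d)"
    unfolding P.carrier_tensor_product C_def[symmetric] inj_on_def by (simp add: map)
  also have "\<dots> \<longleftrightarrow> (\<forall>c d. Poly_Mapping.keys c \<subseteq> P.pairs \<longrightarrow> Poly_Mapping.keys d \<subseteq> P.pairs \<longrightarrow> F (c - d) \<in> P'.K \<longrightarrow> c - d \<in> P.K)"
    unfolding C_def C'_def P.coset_eq_iff P'.coset_eq_iff by (simp add: F_def frag_extend_diff)
  also have "\<dots> \<longleftrightarrow> (\<forall>c. Poly_Mapping.keys c \<subseteq> P.pairs \<longrightarrow> F c \<in> P'.K \<longrightarrow> c \<in> P.K)"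
  proof safe
    fix c assume "\<forall>c d. Poly_Mapping.keys c \<subseteq> P.pairs \<longrightarrow> Poly_Mapping.keys d \<subseteq> P.pairs \<longrightarrow> F (c - d) \<in> P'.K \<longrightarrow> c - d \<in> P.K"
      and "Poly_Mapping.keys c \<subseteq> P.pairs" "F c \<in> P'.K"
    from this(1)[rule_format, of c 0] this(2,3) show "c \<in> P.K"
      by simp
  next
    fix c d
    assume "\<forall>c. Poly_Mapping.keys c \<subseteq> P.pairs \<longrightarrow> F c \<in> P'.K \<longrightarrow> c \<in> P.K"
      and "Poly_Mapping.keys c \<subseteq> P.pairs" "Poly_Mapping.keys d \<subseteq> P.pairs" "F (c - d) \<in> P'.K"
    then show "c - d \<in> P.K"
      using order_trans[OF keys_diff, of c d P.pairs] by simp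
  qed
  finally show ?thesis
    unfolding F_def .
qed

section \<open>Test modules\<close>

lemma restrict_scalars_simps [simp]:
  "carrier (restrict_scalars \<phi> M) = carrier M" "\<zero>\<^bsub>restrict_scalars \<phi> M\<^esub> = \<zero>\<^bsub>M\<^esub>"
  "x \<oplus>\<^bsub>restrict_scalars \<phi> M\<^esub> y = x \<oplus>\<^bsub>M\<^esub> y" "r \<odot>\<^bsub>restrict_scalars \<phi> M\<^esub> x = \<phi> r \<odot>\<^bsub>M\<^esub> x"
  by (simp_all add: restrict_scalars_def)

lemma module_restrict_scalars:
  assumes "cring R" "\<phi> \<in> ring_hom R S" "module S M"
  shows "module R (restrict_scalars \<phi> M)"
proof -
  interpret M: module S M by fact
  note [simp] = ring_hom_closed[OF assms(2)] ring_hom_add[OF assms(2)] ring_hom_mult[OF assms(2)]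
    ring_hom_one[OF assms(2)]
  show ?thesis
    by (rule moduleI[OF assms(1) abelian_group_cong[OF M.M.abelian_group_axioms]])
      (simp_all add: M.smult_l_distr M.smult_r_distr M.smult_assoc1)
qed

text \<open>The elements are cosets, so the module lives at the element type \<open>'r set\<close>
  at which the flatness hypotheses are available.\<close>

definition quotient_module :: "('r, 'p) ring_scheme \<Rightarrow> 'r set \<Rightarrow> ('r, 'r set) module"
  where "quotient_module R I = restrict_scalars (\<lambda>r. I +>\<^bsub>R\<^esub> r) (ring_as_module (R Quot I))"

context cring begin

context
  fixes I
  assumes I: "ideal I R"
begin

interpretation Q: cring "R Quot I"
  by (rule ideal.quotient_is_cring[OF I is_cring])

lemma module_quotient_module: "module R (quotient_module R I)"
  unfolding quotient_module_def
  by (rule module_restrict_scalars[OF is_cring ideal.rcos_ring_hom[OF I] Q.ring_as_module_module])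

lemma carrier_quotient_module: "carrier (quotient_module R I) = (\<lambda>r. I +> r) ` carrier R"
  unfolding quotient_module_def restrict_scalars_simps ring_as_module_simps
  by (auto simp: FactRing_def A_RCOSETS_def')

lemma zero_quotient_module: "\<zero>\<^bsub>quotient_module R I\<^esub> = I"
  unfolding quotient_module_def restrict_scalars_simps ring_as_module_simps by (simp add: FactRing_def)

lemma add_quotient_module:
  "\<lbrakk>r \<in> carrier R; s \<in> carrier R\<rbrakk> \<Longrightarrow> (I +> r) \<oplus>\<^bsub>quotient_module R I\<^esub> (I +> s) = I +> (r \<oplus> s)"
  using ring_hom_add[OF ideal.rcos_ring_hom[OF I]] by (simp add: quotient_module_def)

lemma smult_quotient_module:
  "\<lbrakk>r \<in> carrier R; s \<in> carrier R\<rbrakk> \<Longrightarrow> r \<odot>\<^bsub>quotient_module R I\<^esub> (I +> s) = I +> (r \<otimes> s)"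
  using ring_hom_mult[OF ideal.rcos_ring_hom[OF I]] by (simp add: quotient_module_def)

end

lemma cgenideal_iff: "a \<in> carrier R \<Longrightarrow> c \<in> PIdl a \<longleftrightarrow> (\<exists>d\<in>carrier R. c = a \<otimes> d)"
  unfolding cgenideal_def using m_comm[of a] by auto

text \<open>The quotient by the zero ideal serves as a copy of \<open>R\<close> with elements of type \<^typ>\<open>'a set\<close>.\<close>

lemma flat_regular_smult_zero:
  assumes "module R M" and "flat TYPE('a set) R M" and a: "a \<in> carrier R"
    and regular: "\<And>b. \<lbrakk>b \<in> carrier R; a \<otimes> b = \<zero>\<rbrakk> \<Longrightarrow> b = \<zero>"
    and x: "x \<in> carrier M" "a \<odot>\<^bsub>M\<^esub> x = \<zero>\<^bsub>M\<^esub>"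
  shows "x = \<zero>\<^bsub>M\<^esub>"
proof -
  interpret M: module R M by fact
  let ?N = "quotient_module R {\<zero>}"
  have I: "ideal {\<zero>} R"
    by (rule zeroideal)
  have N: "module R ?N"
    by (rule module_quotient_module[OF I])
  interpret P: module_pair R ?N M
    by (intro module_pair.intro N assms(1))
  have coset: "{\<zero>} +> r = {r}" if "r \<in> carrier R" for r
    using that by (simp add: a_r_coset_def')
  have carrier: "carrier ?N = (\<lambda>r. {r}) ` carrier R"
    using carrier_quotient_module[OF I] coset by simp
  have add: "{r} \<oplus>\<^bsub>?N\<^esub> {s} = {r \<oplus> s}" and smult: "r \<odot>\<^bsub>?N\<^esub> {s} = {r \<otimes> s}"
    if "r \<in> carrier R" "s \<in> carrier R" for r s
    using add_quotient_module[OF I that] smult_quotient_module[OF I that] that by (simp_all add: coset)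
  let ?f = "\<lambda>A. a \<odot>\<^bsub>?N\<^esub> A"
  have f: "?f \<in> linear_maps R ?N ?N"
    using a by (auto simp: linear_maps_def P.N.smult_r_distr P.N.smult_assoc1[symmetric] m_comm)
  have "inj_on ?f (carrier ?N)"
  proof (rule inj_onI)
    fix A B assume "A \<in> carrier ?N" "B \<in> carrier ?N" "?f A = ?f B"
    then obtain r s where rs: "A = {r}" "B = {s}" "r \<in> carrier R" "s \<in> carrier R" "a \<otimes> r = a \<otimes> s"
      using a by (auto simp: carrier smult)
    then have "a \<otimes> (r \<ominus> s) = \<zero>"
      using a by (simp add: a_minus_def r_distr r_minus r_neg)
    then have "r \<ominus> s = \<zero>"
      using rs regular by simp
    then show "A = B"
      using rs by simp
  qed
  with assms(2) N f have "inj_on (tensor_map R ?N M ?f) (carrier (tensor_product R ?N M))"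
    unfolding flat_def by blast
  \<comment> \<open>Multiplication by \<open>a\<close> sends \<open>1 \<otimes> x\<close> to
    \<open>a \<otimes> x = 1 \<otimes> a x = 0\<close>, so flatness makes
    \<open>1 \<otimes> x\<close> vanish.\<close>
  moreover have "frag_of (a \<odot>\<^bsub>?N\<^esub> {\<one>}, x) \<in> P.K"
  proof -
    have "{\<one>} \<in> carrier ?N"
      by (simp add: carrier)
    then have "frag_of (a \<odot>\<^bsub>?N\<^esub> {\<one>}, x) - frag_of ({\<one>}, \<zero>\<^bsub>M\<^esub>) \<in> P.K" "frag_of ({\<one>}, \<zero>\<^bsub>M\<^esub>) \<in> P.K"
      using P.kernel_smult[of a "{\<one>}" x] P.kernel_zero_right[of "{\<one>}"] a x by simp_all
    from P.kernel_add[OF this] show ?thesis by simp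
  qed
  ultimately have K: "frag_of ({\<one>}, x) \<in> P.K"
    unfolding inj_on_tensor_map_iff[OF N N assms(1) f] using x by (auto simp: carrier)
  \<comment> \<open>Multiplication \<open>r \<otimes> y \<mapsto> r y\<close> carries this vanishing
    from \<open>R \<otimes> M\<close> to \<open>M\<close>; \<open>the_elem\<close> unwraps the
    singletons that stand for elements of \<open>R\<close>.\<close>
  have closed: "(case p of (A, y) \<Rightarrow> the_elem A \<odot>\<^bsub>M\<^esub> y) \<in> carrier M" if "p \<in> P.pairs" for p
    using that by (auto simp: carrier)
  obtain h where h: "h \<in> hom (free_Abelian_group P.pairs) (add_monoid M)"
      "\<forall>p\<in>P.pairs. h (frag_of p) = (case p of (A, y) \<Rightarrow> the_elem A \<odot>\<^bsub>M\<^esub> y)"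
    using ex_frag_hom[OF M.M.abelian_group_axioms, of P.pairs "\<lambda>(A, y). the_elem A \<odot>\<^bsub>M\<^esub> y", OF closed] by blast
  have "h (frag_of ({\<one>}, x)) = \<zero>\<^bsub>M\<^esub>"
  proof (rule P.kernel_eval_zero[OF M.M.abelian_group_axioms h(1) _ _ _ _ K, where b="\<lambda>A y. the_elem A \<odot>\<^bsub>M\<^esub> y"])
    fix A y assume A: "A \<in> carrier ?N" and y: "y \<in> carrier M"
    from A obtain r where r: "A = {r}" "r \<in> carrier R"
      by (auto simp: carrier)
    show "h (frag_of (A, y)) = the_elem A \<odot>\<^bsub>M\<^esub> y"
      using h(2) A y by simp
    show "the_elem (A \<oplus>\<^bsub>?N\<^esub> B) \<odot>\<^bsub>M\<^esub> y = the_elem A \<odot>\<^bsub>M\<^esub> y \<oplus>\<^bsub>M\<^esub> the_elem B \<odot>\<^bsub>M\<^esub> y"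
      if "B \<in> carrier ?N" for B
      using that r y by (auto simp: carrier add M.smult_l_distr)
    show "the_elem A \<odot>\<^bsub>M\<^esub> (y \<oplus>\<^bsub>M\<^esub> z) = the_elem A \<odot>\<^bsub>M\<^esub> y \<oplus>\<^bsub>M\<^esub> the_elem A \<odot>\<^bsub>M\<^esub> z"
      if "z \<in> carrier M" for z
      using that r y by (simp add: M.smult_r_distr)
    show "the_elem (s \<odot>\<^bsub>?N\<^esub> A) \<odot>\<^bsub>M\<^esub> y = the_elem A \<odot>\<^bsub>M\<^esub> (s \<odot>\<^bsub>M\<^esub> y)" if "s \<in> carrier R" for s
      using that r y by (simp add: smult M.smult_assoc1[symmetric] m_comm)
  qed
  moreover have "({\<one>}, x) \<in> P.pairs"
    using x by (simp add: carrier)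
  ultimately show ?thesis
    using h(2) x by simp
qed

text \<open>Every \<open>x\<close> is some \<open>a y\<close>, and
  \<open>r \<otimes> a y = a r \<otimes> y\<close> vanishes over \<open>R/(a)\<close>. So the tensor
  product with \<open>R/(a)\<close> is trivial, and faithfulness forces
  \<open>R/(a) = 0\<close>.\<close>

lemma faithfully_flat_divisible_unit:
  assumes "module R M" and "faithfully_flat TYPE('a set) R M" and a: "a \<in> carrier R"
    and div: "\<And>x. x \<in> carrier M \<Longrightarrow> \<exists>y\<in>carrier M. x = a \<odot>\<^bsub>M\<^esub> y"
  shows "\<exists>b\<in>carrier R. a \<otimes> b = \<one>"
proof -
  interpret M: module R M by fact
  have I: "ideal (PIdl a) R"
    by (rule cgenideal_ideal[OF a])
  interpret I: ideal "PIdl a" R by (rule I)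
  let ?N = "quotient_module R (PIdl a)"
  have N: "module R ?N"
    by (rule module_quotient_module[OF I])
  interpret P: module_pair R ?N M
    by (intro module_pair.intro N assms(1))
  have "frag_of (A, x) \<in> P.K" if A: "A \<in> carrier ?N" and x: "x \<in> carrier M" for A x
  proof -
    from A obtain r where r: "A = PIdl a +> r" "r \<in> carrier R"
      by (auto simp: carrier_quotient_module[OF I])
    obtain y where y: "y \<in> carrier M" "x = a \<odot>\<^bsub>M\<^esub> y"
      using div[OF x] by blast
    have "a \<otimes> r \<in> PIdl a"
      using a r(2) by (auto simp: cgenideal_iff)
    then have "a \<odot>\<^bsub>?N\<^esub> A = \<zero>\<^bsub>?N\<^esub>"
      using r a by (simp add: smult_quotient_module[OF I] zero_quotient_module[OF I] I.a_rcos_const)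
    then have "frag_of (\<zero>\<^bsub>?N\<^esub>, y) - frag_of (A, x) \<in> P.K"
      using P.kernel_smult[of a A y] A a y by simp
    from P.kernel_diff[OF P.kernel_zero_left[OF y(1)] this] show ?thesis
      by simp
  qed
  then have "carrier (tensor_product R ?N M) = {\<one>\<^bsub>tensor_product R ?N M\<^esub>}"
    unfolding P.tensor_product_trivial_iff by blast
  with assms(2) N have "carrier ?N = {\<zero>\<^bsub>?N\<^esub>}"
    unfolding faithfully_flat_def by meson
  then have "PIdl a +> \<one> = PIdl a"
    by (auto simp: carrier_quotient_module[OF I] zero_quotient_module[OF I])
  then have "\<one> \<in> PIdl a"
    using I.a_rcos_self[OF one_closed] by simp
  then show ?thesis
    using a by (auto simp: cgenideal_iff)
qed

end

section \<open>Separatedness of Ohm-Rush modules\<close>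

lemma submodule_span_subset: "\<lbrakk>submodule H R M; A \<subseteq> H\<rbrakk> \<Longrightarrow> submodule_span R M A \<subseteq> H"
  by (auto simp: submodule_span_def)

lemma (in module) ideal_mult_module_subset:
  assumes "submodule H R M" "\<And>r x. \<lbrakk>r \<in> I; x \<in> carrier M\<rbrakk> \<Longrightarrow> r \<odot>\<^bsub>M\<^esub> x \<in> H"
  shows "ideal_mult_module R I M \<subseteq> H"
  unfolding ideal_mult_module_def by (rule submodule_span_subset) (use assms in auto)

lemma smult_in_ideal_mult_module:
  "\<lbrakk>r \<in> I; x \<in> carrier M\<rbrakk> \<Longrightarrow> r \<odot>\<^bsub>M\<^esub> x \<in> ideal_mult_module R I M"
  by (auto simp: ideal_mult_module_def submodule_span_def)

text \<open>The content of \<open>f\<close> is contained in every ideal \<open>(a\<^sup>n)\<close>,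
  hence in the zero ideal by \<open>sep\<close>; the Ohm-Rush property then places \<open>f\<close>
  in the zero submodule.\<close>

lemma (in module) ohm_rush_separated:
  assumes "ohm_rush R M" and a: "a \<in> carrier R"
    and sep: "\<And>c. \<lbrakk>c \<in> carrier R; \<And>n::nat. \<exists>d\<in>carrier R. c = a [^] n \<otimes> d\<rbrakk> \<Longrightarrow> c = \<zero>"
    and f: "f \<in> carrier M" "\<And>n::nat. \<exists>y\<in>carrier M. f = a [^] n \<odot>\<^bsub>M\<^esub> y"
  shows "f = \<zero>\<^bsub>M\<^esub>"
proof -
  have mem: "f \<in> ideal_mult_module R (PIdl (a [^] n)) M" for n :: nat
  proof -
    obtain y where "y \<in> carrier M" "f = a [^] n \<odot>\<^bsub>M\<^esub> y"
      using f(2) by blast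
    then show ?thesis
      using smult_in_ideal_mult_module[OF cgenideal_self[of "a [^] n"]] a by simp
  qed
  have "content R M f \<subseteq> {\<zero>}"
  proof
    fix c assume c: "c \<in> content R M f"
    have *: "c \<in> PIdl (a [^] n)" for n :: nat
      using c mem cgenideal_ideal[of "a [^] n"] a unfolding content_def by blast
    have "c \<in> carrier R" "\<exists>d\<in>carrier R. c = a [^] n \<otimes> d" for n :: nat
      using *[of n] a by (auto simp: R.cgenideal_iff)
    then show "c \<in> {\<zero>}"
      using sep by simp
  qed
  moreover have "submodule {\<zero>\<^bsub>M\<^esub>} R M"
    by (rule submoduleI) auto
  ultimately have "ideal_mult_module R (content R M f) M \<subseteq> {\<zero>\<^bsub>M\<^esub>}"
    by (intro ideal_mult_module_subset) auto
  then show ?thesis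
    using assms(1) f(1) by (auto simp: ohm_rush_def)
qed

section \<open>Localizations of Dedekind domains\<close>

text \<open>The ascending chain condition as a maximum principle: a nonempty chain of ideals
  contains its union. It is applied below to proper ideals, to colon ideals and to contractions of
  local ideals.\<close>

lemma (in noetherian_ring) exists_maximal_in:
  assumes "\<I> \<noteq> {}" "\<And>I. I \<in> \<I> \<Longrightarrow> ideal I R"
  shows "\<exists>I\<in>\<I>. \<forall>J\<in>\<I>. I \<subseteq> J \<longrightarrow> J = I"
proof (rule subset_Zorn)
  fix C assume C: "subset.chain \<I> C"
  show "\<exists>J\<in>\<I>. \<forall>I\<in>C. I \<subseteq> J"
  proof (cases "C = {}")
    case False
    have "subset.chain {I. ideal I R} C"
      using C assms(2) by (auto simp: pred_on.chain_def)
    then have "\<Union>C \<in> C"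
      by (rule ideal_chain_is_trivial[OF False])
    then show ?thesis
      using C by (auto simp: pred_on.chain_def)
  qed (use assms(1) in blast)
qed

lemma (in noetherian_domain) exists_maximalideal:
  assumes "ideal I R" "I \<noteq> carrier R"
  shows "\<exists>\<mm>. maximalideal \<mm> R \<and> I \<subseteq> \<mm>"
proof -
  let ?S = "{J. ideal J R \<and> I \<subseteq> J \<and> J \<noteq> carrier R}"
  have "\<exists>\<mm>\<in>?S. \<forall>J\<in>?S. \<mm> \<subseteq> J \<longrightarrow> J = \<mm>"
    by (rule exists_maximal_in) (use assms in auto)
  then obtain \<mm> where m: "ideal \<mm> R" "I \<subseteq> \<mm>" "\<mm> \<noteq> carrier R"
    and max: "\<forall>J\<in>?S. \<mm> \<subseteq> J \<longrightarrow> J = \<mm>"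
    by auto
  have "maximalideal \<mm> R"
  proof (rule maximalidealI)
    fix J assume "ideal J R" "\<mm> \<subseteq> J"
    then show "J = \<mm> \<or> J = carrier R"
      using max m(2) by blast
  qed (use m in auto)
  with m(2) show ?thesis by blast
qed

text \<open>The local-global principle behind all gluing steps: when the multipliers that make a
  claim true form an ideal, one multiplier outside each maximal ideal turns \<open>\<one>\<close>
  into a multiplier.\<close>

lemma (in noetherian_domain) ideal_eq_carrierI:
  assumes "ideal I R" "\<And>\<mm>. maximalideal \<mm> R \<Longrightarrow> \<exists>u\<in>I. u \<notin> \<mm>"
  shows "I = carrier R"
  using exists_maximalideal[OF assms(1)] assms(2) by blast

section \<open>Integrality from the ascending chain condition\<close>

primrec (in ring) initial_ideal :: "(nat \<Rightarrow> 'a) \<Rightarrow> nat \<Rightarrow> 'a set" where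
  "initial_ideal d 0 = {\<zero>}"
| "initial_ideal d (Suc n) = PIdl (d n) <+>\<^bsub>R\<^esub> initial_ideal d n"

context noetherian_domain begin

lemma ideal_initial_ideal: "(\<And>n. d n \<in> carrier R) \<Longrightarrow> ideal (initial_ideal d n) R"
  by (induction n) (auto intro: add_ideals cgenideal_ideal zeroideal)

text \<open>\<open>initial_ideal d n\<close> is generated by \<open>d 0, ..., d (n - 1)\<close>. Its
  recursion peels off the newest generator first, which matches coefficient lists that start with
  the leading coefficient.\<close>

lemma initial_ideal_Suc_iff:
  "d n \<in> carrier R \<Longrightarrow>
    z \<in> initial_ideal d (Suc n) \<longleftrightarrow> (\<exists>r\<in>carrier R. \<exists>y\<in>initial_ideal d n. z = r \<otimes> d n \<oplus> y)"
  by (auto simp: set_add_def' cgenideal_def)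

text \<open>The union of these increasing ideals is one of them, say the one at \<open>n\<close>;
  since \<open>d n\<close> occurs at stage \<open>Suc n\<close>, it already lies in stage
  \<open>n\<close>.\<close>

lemma sequence_in_initial_ideal:
  assumes d: "\<And>n. d n \<in> carrier R"
  shows "\<exists>n. d n \<in> initial_ideal d n"
proof -
  have ideal: "ideal (initial_ideal d n) R" for n
    by (rule ideal_initial_ideal[OF d])
  have zero: "\<zero> \<in> initial_ideal d n" and sub: "initial_ideal d n \<subseteq> carrier R" for n
    by (rule additive_subgroup.zero_closed[OF ideal.axioms(1)[OF ideal]],
        rule additive_subgroup.a_subset[OF ideal.axioms(1)[OF ideal]])
  have "initial_ideal d n \<subseteq> initial_ideal d (Suc n)" for n
  proof
    fix z assume "z \<in> initial_ideal d n"
    moreover from this have "z = \<zero> \<otimes> d n \<oplus> z"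
      using d sub[of n] by (simp add: subset_iff)
    ultimately show "z \<in> initial_ideal d (Suc n)"
      unfolding initial_ideal_Suc_iff[OF d] by blast
  qed
  then have mono: "initial_ideal d m \<subseteq> initial_ideal d n" if "m \<le> n" for m n
    using that by (rule lift_Suc_mono_le)
  have "subset.chain {I. ideal I R} (range (initial_ideal d))"
    unfolding subset_chain_def
  proof (intro conjI ballI)
    fix I J assume "I \<in> range (initial_ideal d)" "J \<in> range (initial_ideal d)"
    then obtain m n where "I = initial_ideal d m" "J = initial_ideal d n" by auto
    then show "I \<subseteq> J \<or> J \<subseteq> I"
      using mono[of m n] mono[of n m] by (cases "m \<le> n") auto
  qed (use ideal in auto)
  then have "\<Union>(range (initial_ideal d)) \<in> range (initial_ideal d)"
    by (rule ideal_chain_is_trivial[rotated]) simp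
  then obtain n where n: "\<Union>(range (initial_ideal d)) = initial_ideal d n"
    by auto
  have "d n \<in> initial_ideal d (Suc n)"
    unfolding initial_ideal_Suc_iff[OF d] using d zero by (intro bexI[of _ \<one>] bexI[of _ \<zero>]) auto
  then show ?thesis
    using n by blast
qed

abbreviation "F \<equiv> fraction_field R"
abbreviation "\<iota> r \<equiv> loc_frac R (carrier R - {\<zero>}) (ring_as_module R) r \<one>"

sublocale nonzero: mult_subset R "carrier R - {\<zero>}"
  by unfold_locales (auto simp: integral_iff)

lemma domain_fraction_field: "domain F"
  unfolding fraction_field_def by (rule nonzero.domain_loc_ring) (auto intro: domain_axioms)

lemma iota_ring_hom: "\<iota> \<in> ring_hom R F"
  unfolding fraction_field_def
  by (rule ring_hom_memI) (simp_all add: nonzero.frac_closed nonzero.add_frac nonzero.mult_frac nonzero.one_loc_ring)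

lemma iota_eq_iff: "\<lbrakk>r \<in> carrier R; s \<in> carrier R\<rbrakk> \<Longrightarrow> \<iota> r = \<iota> s \<longleftrightarrow> r = s"
  by (subst nonzero.rng.frac_eq_iff) (auto simp: m_lcancel intro!: bexI[of _ \<one>])

text \<open>Since \<open>\<iota> (d n)\<close> is \<open>x\<^sup>n\<close> times
  \<open>\<iota> (d 0)\<close>, a relation expressing \<open>d n\<close> through
  \<open>d 0, ..., d (n - 1)\<close> becomes a monic equation of degree \<open>n\<close> for
  \<open>x\<close> once the nonzero \<open>\<iota> (d 0)\<close> is cancelled.\<close>

lemma integral_overI:
  assumes x: "x \<in> carrier F" and d: "\<And>n. d n \<in> carrier R" "d 0 \<noteq> \<zero>"
    and step: "\<And>n. \<iota> (d (Suc n)) = x \<otimes>\<^bsub>F\<^esub> \<iota> (d n)"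
  shows "integral_over F (fraction_field_image R) x"
proof -
  interpret F: domain F by (rule domain_fraction_field)
  note hom = ring_hom_closed[OF iota_ring_hom] ring_hom_add[OF iota_ring_hom]
    ring_hom_mult[OF iota_ring_hom] ring_hom_one[OF iota_ring_hom]
  have pow: "x [^]\<^bsub>F\<^esub> n \<otimes>\<^bsub>F\<^esub> \<iota> (d 0) = \<iota> (d n)" for n
  proof (induction n)
    case (Suc n)
    have "x [^]\<^bsub>F\<^esub> Suc n \<otimes>\<^bsub>F\<^esub> \<iota> (d 0) = x \<otimes>\<^bsub>F\<^esub> (x [^]\<^bsub>F\<^esub> n \<otimes>\<^bsub>F\<^esub> \<iota> (d 0))"
      using x d hom by (simp add: F.m_ac)
    then show ?case
      using Suc step by simp
  qed (use d hom in simp)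
  \<comment> \<open>The length of \<open>q\<close> is prescribed because \<open>eval\<close> takes
    the exponent of the leading coefficient from the length of the tail: prepending
    \<open>\<iota> r\<close> contributes exactly \<open>\<iota> r\<close> times
    \<open>x\<^sup>n\<close>.\<close>
  have ex: "\<exists>q. length q = n \<and> set q \<subseteq> fraction_field_image R \<and> F.eval q x \<otimes>\<^bsub>F\<^esub> \<iota> (d 0) = \<iota> z"
    if "z \<in> initial_ideal d n" for z n
    using that
  proof (induction n arbitrary: z)
    case 0
    have "\<iota> \<zero> = \<zero>\<^bsub>F\<^esub>"
      by (simp add: fraction_field_def nonzero.loc_ring_simps nonzero.rng.zero_loc_module)
    with 0 show ?case
      using hom d by simp
  next
    case (Suc n)
    then obtain r y where r: "r \<in> carrier R" "y \<in> initial_ideal d n" "z = r \<otimes> d n \<oplus> y"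
      unfolding initial_ideal_Suc_iff[OF d(1)] by blast
    then obtain q where q: "length q = n" "set q \<subseteq> fraction_field_image R" "F.eval q x \<otimes>\<^bsub>F\<^esub> \<iota> (d 0) = \<iota> y"
      using Suc.IH by blast
    have y: "y \<in> carrier R"
      by (rule ideal.Icarr[OF ideal_initial_ideal r(2)]) (rule d(1))
    have "set q \<subseteq> carrier F"
      using q(2) hom(1) by (auto simp: fraction_field_image_def)
    then have [simp]: "F.eval q x \<in> carrier F"
      using x by (rule F.eval_in_carrier)
    have "F.eval (\<iota> r # q) x \<otimes>\<^bsub>F\<^esub> \<iota> (d 0)
        = \<iota> r \<otimes>\<^bsub>F\<^esub> (x [^]\<^bsub>F\<^esub> n \<otimes>\<^bsub>F\<^esub> \<iota> (d 0)) \<oplus>\<^bsub>F\<^esub> F.eval q x \<otimes>\<^bsub>F\<^esub> \<iota> (d 0)"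
      using x hom(1) r(1) d q(1) by (simp add: F.l_distr F.m_assoc)
    also have "\<dots> = \<iota> z"
      unfolding pow q(3) using r d hom y by simp
    finally show ?case
      using q r(1) by (intro exI[of _ "\<iota> r # q"]) (auto simp: fraction_field_image_def)
  qed
  obtain n where n: "d n \<in> initial_ideal d n"
    using sequence_in_initial_ideal[of d] d(1) by auto
  \<comment> \<open>The negative is the one expanded, so that its coefficients can follow the
    leading \<open>\<one>\<close> unchanged.\<close>
  then have "\<ominus> d n \<in> initial_ideal d n"
    by (rule additive_subgroup.a_inv_closed[OF ideal.axioms(1)[OF ideal_initial_ideal], rotated]) (rule d(1))
  from ex[OF this] obtain q where q: "length q = n" "set q \<subseteq> fraction_field_image R"
      "F.eval q x \<otimes>\<^bsub>F\<^esub> \<iota> (d 0) = \<iota> (\<ominus> d n)"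
    by blast
  have "set q \<subseteq> carrier F"
    using q(2) hom(1) by (auto simp: fraction_field_image_def)
  then have [simp]: "F.eval q x \<in> carrier F"
    using x by (rule F.eval_in_carrier)
  let ?p = "\<one>\<^bsub>F\<^esub> # q"
  have "F.eval ?p x \<otimes>\<^bsub>F\<^esub> \<iota> (d 0) = x [^]\<^bsub>F\<^esub> n \<otimes>\<^bsub>F\<^esub> \<iota> (d 0) \<oplus>\<^bsub>F\<^esub> F.eval q x \<otimes>\<^bsub>F\<^esub> \<iota> (d 0)"
    using x hom(1) d q(1) by (simp add: F.l_distr F.m_assoc)
  also have "\<dots> = \<iota> (d n \<oplus> \<ominus> d n)"
    unfolding pow q(3) using d hom(2)[of "d n" "\<ominus> d n"] by simp
  also have "\<dots> = \<zero>\<^bsub>F\<^esub>"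
    using d by (simp add: r_neg fraction_field_def nonzero.loc_ring_simps nonzero.rng.zero_loc_module)
  finally have "F.eval ?p x \<otimes>\<^bsub>F\<^esub> \<iota> (d 0) = \<zero>\<^bsub>F\<^esub>" .
  moreover have "\<iota> (d 0) \<noteq> \<zero>\<^bsub>F\<^esub>"
    using d iota_eq_iff[of "d 0" \<zero>] by (simp add: fraction_field_def nonzero.loc_ring_simps nonzero.rng.zero_loc_module)
  ultimately have "F.eval ?p x = \<zero>\<^bsub>F\<^esub>"
    using F.integral[of "F.eval ?p x" "\<iota> (d 0)"] x hom(1) d \<open>F.eval q x \<in> carrier F\<close> by simp
  moreover have "polynomial\<^bsub>F\<^esub> (fraction_field_image R) ?p"
    using q(2) hom(4)[symmetric] by (auto simp: polynomial_def fraction_field_image_def)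
  ultimately show ?thesis
    unfolding integral_over_def by (intro exI[of _ ?p]) simp
qed

end

lemma (in cring) colon_ideal:
  assumes b: "b \<in> carrier R" and I: "ideal I R"
  shows "ideal {r \<in> carrier R. r \<otimes> b \<in> I} R"
proof -
  interpret I: ideal I R by fact
  show ?thesis
  proof (rule idealI[OF ring_axioms])
    show "subgroup {r \<in> carrier R. r \<otimes> b \<in> I} (add_monoid R)"
      using b by (intro group.subgroupI[OF a_group])
        (auto simp: l_distr l_minus I.a_closed I.a_inv_closed simp flip: a_inv_def intro!: exI[of _ \<zero>])
    fix r x assume "r \<in> {r \<in> carrier R. r \<otimes> b \<in> I}" and x: "x \<in> carrier R"
    then have r: "r \<in> carrier R" "r \<otimes> b \<in> I" by auto
    have "x \<otimes> (r \<otimes> b) \<in> I"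
      using r x I.I_l_closed by blast
    then show "x \<otimes> r \<in> {r \<in> carrier R. r \<otimes> b \<in> I}"
      using r x b by (simp add: m_assoc)
    then show "r \<otimes> x \<in> {r \<in> carrier R. r \<otimes> b \<in> I}"
      using r x by (simp add: m_comm)
  qed
qed

section \<open>Local structure of a Dedekind domain at a maximal ideal\<close>

locale dedekind_at = dedekind_domain R for R (structure) +
  fixes \<mm>
  assumes maximal: "maximalideal \<mm> R"
begin

sublocale m: maximalideal \<mm> R by (rule maximal)
sublocale m: primeideal \<mm> R by (rule maximalideal_prime[OF maximal])

abbreviation U where "U \<equiv> carrier R - \<mm>"

lemma one_U: "\<one> \<in> U"
  using m.one_imp_carrier m.I_notcarr by auto

lemma mult_U: "\<lbrakk>s \<in> U; t \<in> U\<rbrakk> \<Longrightarrow> s \<otimes> t \<in> U"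
  using m.I_prime by auto

lemma U_nonzero: "s \<in> U \<Longrightarrow> s \<noteq> \<zero>"
  using m.zero_closed by auto

lemma pow_U: "s \<in> U \<Longrightarrow> s [^] (n::nat) \<in> U"
  by (induction n) (use one_U mult_U in auto)

text \<open>A colon ideal \<open>(a : b)\<close> that is maximal among those contained in \<open>\<mm>\<close> is prime, hence equal to \<open>\<mm>\<close>.\<close>

lemma coprime_fraction:
  assumes "\<mm> \<noteq> {\<zero>}"
  shows "\<exists>a\<in>\<mm>. a \<noteq> \<zero> \<and> (\<exists>b\<in>carrier R. b \<notin> PIdl a \<and> (\<forall>c\<in>\<mm>. c \<otimes> b \<in> PIdl a))"
proof -
  obtain a where a: "a \<in> \<mm>" "a \<noteq> \<zero>"
    using assms m.zero_closed by blast
  then have aR: "a \<in> carrier R"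
    using m.Icarr by blast
  interpret A: ideal "PIdl a" R
    by (rule cgenideal_ideal[OF aR])
  define C where "C b = {r \<in> carrier R. r \<otimes> b \<in> PIdl a}" for b
  have C_ideal: "ideal (C b) R" if "b \<in> carrier R" for b
    unfolding C_def by (rule colon_ideal[OF that A.is_ideal])
  define T where "T = C ` {b \<in> carrier R. C b \<subseteq> \<mm>}"
  have "C \<one> \<subseteq> \<mm>"
  proof
    fix r assume "r \<in> C \<one>"
    then obtain d where "d \<in> carrier R" "r = a \<otimes> d"
      using aR by (auto simp: C_def cgenideal_iff)
    then show "r \<in> \<mm>"
      using a(1) m.I_r_closed by simp
  qed
  then have "T \<noteq> {}"
    by (auto simp: T_def)
  then have "\<exists>P\<in>T. \<forall>Q\<in>T. P \<subseteq> Q \<longrightarrow> Q = P"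
    by (rule exists_maximal_in) (auto simp: T_def C_ideal)
  then obtain b where b: "b \<in> carrier R" "C b \<subseteq> \<mm>" and "\<forall>Q\<in>T. C b \<subseteq> Q \<longrightarrow> Q = C b"
    unfolding T_def by auto
  then have max: "C b' = C b" if "b' \<in> carrier R" "C b' \<subseteq> \<mm>" "C b \<subseteq> C b'" for b'
    using that unfolding T_def by blast
  have mono: "C b \<subseteq> C (s \<otimes> b)" if "s \<in> carrier R" for s
  proof
    fix r assume "r \<in> C b"
    then have r: "r \<in> carrier R" "r \<otimes> b \<in> PIdl a" by (simp_all add: C_def)
    have "s \<otimes> (r \<otimes> b) \<in> PIdl a"
      using r(2) that A.I_l_closed by blast
    then show "r \<in> C (s \<otimes> b)"
      using r that b by (simp add: C_def m_lcomm)
  qed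
  \<comment> \<open>Maximality makes elements outside \<open>\<mm>\<close> cancellable modulo
    \<open>C b\<close>: as \<open>\<mm>\<close> is prime, \<open>C (s \<otimes> b)\<close> still
    lies in \<open>\<mm>\<close>, and it contains \<open>C b\<close>.\<close>
  have s_cancel: "x \<in> C b" if x: "x \<in> carrier R" "s \<in> U" "s \<otimes> x \<in> C b" for x s
  proof -
    have "C (s \<otimes> b) \<subseteq> \<mm>"
    proof
      fix r assume r: "r \<in> C (s \<otimes> b)"
      then have "r \<otimes> s \<in> C b"
        using b x(2) by (auto simp: C_def m_assoc)
      then show "r \<in> \<mm>"
        using b(2) m.I_prime[of r s] r x(2) by (auto simp: C_def)
    qed
    then have "C (s \<otimes> b) = C b"
      using b x(2) mono by (intro max) auto
    moreover have "x \<in> C (s \<otimes> b)"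
      using x b by (auto simp: C_def m_ac)
    ultimately show ?thesis by simp
  qed
  have "primeideal (C b) R"
  proof (rule primeidealI[OF C_ideal[OF b(1)] is_cring])
    show "carrier R \<noteq> C b"
      using b(2) one_U by blast
    fix x y assume xy: "x \<in> carrier R" "y \<in> carrier R" "x \<otimes> y \<in> C b"
    show "x \<in> C b \<or> y \<in> C b"
    proof (rule ccontr)
      assume neg: "\<not> (x \<in> C b \<or> y \<in> C b)"
      have "y \<in> C (x \<otimes> b)"
        using xy b by (auto simp: C_def m_ac)
      \<comment> \<open>The colon ideal has become strictly larger, so by maximality it leaves
        \<open>\<mm>\<close>; any \<open>s\<close> in it outside \<open>\<mm>\<close> puts
        \<open>s \<otimes> x\<close> into \<open>C b\<close>, against
        \<open>s_cancel\<close>.\<close>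
      then have "C (x \<otimes> b) \<noteq> C b"
        using neg by blast
      then have "\<not> C (x \<otimes> b) \<subseteq> \<mm>"
        using max[of "x \<otimes> b"] mono xy(1) b(1) by blast
      then obtain s where s: "s \<in> U" "s \<in> C (x \<otimes> b)"
        by (auto simp: C_def)
      then have "s \<otimes> x \<in> C b"
        using xy b by (auto simp: C_def m_assoc)
      then show False
        using s_cancel xy(1) s(1) neg by blast
    qed
  qed
  moreover have aC: "a \<in> C b"
    using aR b by (auto simp: C_def cgenideal_iff)
  ultimately have "maximalideal (C b) R"
    using a(2) by (intro nonzero_prime_maximal) auto
  then have mC: "\<mm> = C b"
    using maximalideal.I_maximal[OF _ m.is_ideal b(2)] m.I_notcarr m.a_subset by blast
  have "\<forall>c\<in>\<mm>. c \<otimes> b \<in> PIdl a"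
    using eqset_imp_iff[OF mC] by (simp add: C_def)
  moreover have "b \<notin> PIdl a"
    using b one_U by (auto simp: C_def)
  ultimately show ?thesis
    using a b(1) by blast
qed

text \<open>If \<open>(b/a) \<mm> \<subseteq> \<mm>\<close>, then all \<open>a (b/a)\<^sup>n\<close> are in \<open>R\<close>, and the ascending chain condition makes
  \<open>b/a\<close> integral without any determinant.\<close>

lemma fraction_not_stable:
  assumes a: "a \<in> \<mm>" "a \<noteq> \<zero>" and b: "b \<in> carrier R" "b \<notin> PIdl a"
  shows "\<exists>c\<in>\<mm>. \<forall>d\<in>\<mm>. b \<otimes> c \<noteq> a \<otimes> d"
proof (rule ccontr)
  assume "\<not> (\<exists>c\<in>\<mm>. \<forall>d\<in>\<mm>. b \<otimes> c \<noteq> a \<otimes> d)"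
  then obtain g where g: "\<And>c. c \<in> \<mm> \<Longrightarrow> g c \<in> \<mm>" "\<And>c. c \<in> \<mm> \<Longrightarrow> b \<otimes> c = a \<otimes> g c"
    by metis
  define d where "d n = (g ^^ n) a" for n
  have dm: "d n \<in> \<mm>" for n
    by (induction n) (auto simp: d_def a g)
  then have dR: "d n \<in> carrier R" for n
    using m.Icarr by blast
  have aR: "a \<in> carrier R"
    using a m.Icarr by blast
  define x where "x = loc_frac R (carrier R - {\<zero>}) (ring_as_module R) b a"
  have x: "x \<in> carrier F"
    using a aR b by (simp add: x_def fraction_field_def nonzero.frac_closed)
  have "\<iota> (d (Suc n)) = x \<otimes>\<^bsub>F\<^esub> \<iota> (d n)" for n
  proof -
    have "b \<otimes> d n = a \<otimes> d (Suc n)"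
      using g(2)[OF dm] by (simp add: d_def)
    then show ?thesis
      using a aR b dR by (simp add: x_def fraction_field_def nonzero.mult_frac nonzero.frac_eqI)
  qed
  then have "integral_over F (fraction_field_image R) x"
    using x dR a by (intro integral_overI[of x d]) (auto simp: d_def)
  then have "x \<in> fraction_field_image R"
    using x by (intro integrally_closed)
  then obtain r where r: "r \<in> carrier R" "x = \<iota> r"
    by (auto simp: fraction_field_image_def)
  then obtain u where "u \<in> carrier R - {\<zero>}" "u \<otimes> b = u \<otimes> (a \<otimes> r)"
    unfolding x_def using a aR b by (subst (asm) nonzero.rng.frac_eq_iff) auto
  then have "b = a \<otimes> r"
    using a aR b r by (simp add: m_lcancel)
  then show False
    using b r aR by (auto simp: cgenideal_iff)
qed

text \<open>The fraction \<open>b/a\<close> multiplies \<open>\<mm>\<close> into \<open>R\<close>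
  but not into \<open>\<mm>\<close>. So some \<open>\<pi>\<close> in \<open>\<mm>\<close> goes to a
  \<open>v\<close> outside \<open>\<mm>\<close>; if \<open>c\<close> in \<open>\<mm>\<close> goes to
  \<open>d\<close>, then \<open>v c\<close> and \<open>\<pi> d\<close> are both equal to
  \<open>(b/a) \<pi> c\<close>.\<close>

lemma ex_local_generator:
  "\<exists>\<pi>\<in>\<mm>. \<exists>v\<in>U. \<forall>c\<in>\<mm>. \<exists>d\<in>carrier R. v \<otimes> c = \<pi> \<otimes> d"
proof (cases "\<mm> = {\<zero>}")
  \<comment> \<open>Here \<open>R\<close> is a field, and \<open>\<zero>\<close> serves as the
    generator.\<close>
  case True
  then show ?thesis
    using one_U by (intro bexI[of _ \<zero>] bexI[of _ \<one>]) auto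
next
  case False
  obtain a b where a: "a \<in> \<mm>" "a \<noteq> \<zero>" and b: "b \<in> carrier R" "b \<notin> PIdl a"
    and ab: "\<forall>c\<in>\<mm>. c \<otimes> b \<in> PIdl a"
    using coprime_fraction[OF False] by auto
  have aR: "a \<in> carrier R"
    using a m.Icarr by blast
  have div: "\<exists>d\<in>carrier R. b \<otimes> c = a \<otimes> d" if "c \<in> \<mm>" for c
    using bspec[OF ab that] b aR m.Icarr[OF that] by (auto simp: cgenideal_iff m_comm[of b])
  obtain \<pi> where \<pi>: "\<pi> \<in> \<mm>" "\<forall>d\<in>\<mm>. b \<otimes> \<pi> \<noteq> a \<otimes> d"
    using fraction_not_stable[OF a b] by blast
  then obtain v where v: "v \<in> U" "b \<otimes> \<pi> = a \<otimes> v"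
    using div[of \<pi>] by blast
  have "\<exists>d\<in>carrier R. v \<otimes> c = \<pi> \<otimes> d" if c: "c \<in> \<mm>" for c
  proof -
    obtain d where d: "d \<in> carrier R" "b \<otimes> c = a \<otimes> d"
      using div[OF c] by blast
    have R: "c \<in> carrier R" "\<pi> \<in> carrier R" "v \<in> carrier R"
      using c \<pi> v m.Icarr by auto
    have "a \<otimes> (v \<otimes> c) = (b \<otimes> \<pi>) \<otimes> c"
      using R aR v by (simp add: m_assoc)
    also have "\<dots> = (b \<otimes> c) \<otimes> \<pi>"
      using R b by (simp add: m_ac)
    also have "\<dots> = a \<otimes> (\<pi> \<otimes> d)"
      unfolding d(2) using R aR d(1) by (simp add: m_ac)
    finally show ?thesis
      using a aR R d(1) by (auto simp: m_lcancel)
  qed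
  then show ?thesis
    using \<pi>(1) v(1) by blast
qed

text \<open>\<open>\<pi>\<close> generates the maximal ideal of \<open>R\<^sub>\<mm>\<close> and is
  zero if \<open>\<mm>\<close> is; \<open>\<nu>\<close> is one common denominator for writing all
  elements of \<open>\<mm>\<close> as multiples of \<open>\<pi>\<close>. Both depend on
  \<open>R\<close> and \<open>\<mm>\<close> alone, which matters when a multiplier has to serve many
  ideals at once.\<close>

definition \<pi> where "\<pi> = (SOME p. p \<in> \<mm> \<and> (\<exists>v\<in>U. \<forall>c\<in>\<mm>. \<exists>d\<in>carrier R. v \<otimes> c = p \<otimes> d))"
definition \<nu> where "\<nu> = (SOME v. v \<in> U \<and> (\<forall>c\<in>\<mm>. \<exists>d\<in>carrier R. v \<otimes> c = \<pi> \<otimes> d))"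

lemma pi_mem: "\<pi> \<in> \<mm>" and nu_U: "\<nu> \<in> U"
  and nu_mult: "c \<in> \<mm> \<Longrightarrow> \<exists>d\<in>carrier R. \<nu> \<otimes> c = \<pi> \<otimes> d"
proof -
  have pi: "\<pi> \<in> \<mm> \<and> (\<exists>v\<in>U. \<forall>c\<in>\<mm>. \<exists>d\<in>carrier R. v \<otimes> c = \<pi> \<otimes> d)"
    unfolding \<pi>_def by (rule someI_ex) (use ex_local_generator in blast)
  then show "\<pi> \<in> \<mm>" ..
  have "\<nu> \<in> U \<and> (\<forall>c\<in>\<mm>. \<exists>d\<in>carrier R. \<nu> \<otimes> c = \<pi> \<otimes> d)"
    unfolding \<nu>_def by (rule someI_ex) (use pi in blast)
  then show "\<nu> \<in> U" "c \<in> \<mm> \<Longrightarrow> \<exists>d\<in>carrier R. \<nu> \<otimes> c = \<pi> \<otimes> d"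
    by auto
qed

lemma pi_carrier [simp]: "\<pi> \<in> carrier R"
  using pi_mem m.Icarr by blast

text \<open>A counterexample \<open>c\<close> with \<open>L c\<close> maximal lies in
  \<open>\<mm>\<close>, so \<open>\<nu> c = \<pi> d\<close>, and \<open>d\<close> is a
  counterexample too. As \<open>L d\<close> contains \<open>L c\<close>, the two agree, and
  \<open>d\<close> is locally a multiple of \<open>c\<close>; cancelling \<open>c\<close> shows that
  \<open>\<pi>\<close> divides an element outside \<open>\<mm>\<close>, which is absurd.\<close>

lemma factor_pi_pow:
  assumes "c \<in> carrier R" "c \<noteq> \<zero>"
  shows "\<exists>k::nat. \<exists>u\<in>U. \<exists>e\<in>U. u \<otimes> c = e \<otimes> \<pi> [^] k"
proof (rule ccontr)
  define good where "good c \<longleftrightarrow> (\<exists>k::nat. \<exists>u\<in>U. \<exists>e\<in>U. u \<otimes> c = e \<otimes> \<pi> [^] k)" for c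
  assume "\<not> ?thesis"
  then have "\<not> good c"
    by (simp add: good_def)
  \<comment> \<open>\<open>L c\<close> is the contraction to \<open>R\<close> of the ideal generated
    by \<open>c\<close> in \<open>R\<^sub>\<mm>\<close>.\<close>
  define L where "L c = {r \<in> carrier R. \<exists>u\<in>U. \<exists>d\<in>carrier R. u \<otimes> r = c \<otimes> d}" for c
  have L_ideal: "ideal (L c) R" if c: "c \<in> carrier R" for c
  proof (rule idealI[OF ring_axioms])
    show "subgroup (L c) (add_monoid R)"
    proof (rule group.subgroupI[OF a_group])
      show "L c \<subseteq> carrier (add_monoid R)"
        by (auto simp: L_def)
      have "\<zero> \<in> L c"
        using one_U c by (auto simp: L_def intro!: bexI[of _ \<one>] bexI[of _ \<zero>])
      then show "L c \<noteq> {}" by blast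
    next
      fix r assume "r \<in> L c"
      then obtain u d where "r \<in> carrier R" "u \<in> U" "d \<in> carrier R" "u \<otimes> r = c \<otimes> d"
        by (auto simp: L_def)
      then have "\<ominus> r \<in> carrier R" "u \<otimes> \<ominus> r = c \<otimes> \<ominus> d" "u \<in> U" "\<ominus> d \<in> carrier R"
        using c by (auto simp: r_minus)
      then show "inv\<^bsub>add_monoid R\<^esub> r \<in> L c"
        unfolding L_def a_inv_def[symmetric] by blast
    next
      fix r s assume "r \<in> L c" "s \<in> L c"
      then obtain u d v e where r: "r \<in> carrier R" "u \<in> U" "d \<in> carrier R" "u \<otimes> r = c \<otimes> d"
        and s: "s \<in> carrier R" "v \<in> U" "e \<in> carrier R" "v \<otimes> s = c \<otimes> e"
        by (auto simp: L_def)
      have "(u \<otimes> v) \<otimes> (r \<oplus> s) = v \<otimes> (u \<otimes> r) \<oplus> u \<otimes> (v \<otimes> s)"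
        using r(1,2) s(1,2) by (simp add: r_distr m_ac)
      also have "\<dots> = c \<otimes> (v \<otimes> d \<oplus> u \<otimes> e)"
        unfolding r(4) s(4) using r(1-3) s(1-3) c by (simp add: r_distr m_ac)
      finally show "r \<otimes>\<^bsub>add_monoid R\<^esub> s \<in> L c"
        using r(1-3) s(1-3) mult_U[of u v] by (auto simp: L_def)
    qed
    fix r x assume "r \<in> L c" and x: "x \<in> carrier R"
    then obtain u d where r: "r \<in> carrier R" "u \<in> U" "d \<in> carrier R" "u \<otimes> r = c \<otimes> d"
      by (auto simp: L_def)
    have "u \<otimes> (x \<otimes> r) = (u \<otimes> r) \<otimes> x"
      using r(1,2) x by (simp add: m_ac)
    also have "\<dots> = c \<otimes> (x \<otimes> d)"
      unfolding r(4) using r(3) x c by (simp add: m_ac)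
    finally show "x \<otimes> r \<in> L c"
      using r x by (auto simp: L_def)
    then show "r \<otimes> x \<in> L c"
      using r(1) x by (simp add: m_comm)
  qed
  let ?S = "L ` {c \<in> carrier R. c \<noteq> \<zero> \<and> \<not> good c}"
  have "?S \<noteq> {}"
    using assms \<open>\<not> good c\<close> by blast
  then have "\<exists>I\<in>?S. \<forall>J\<in>?S. I \<subseteq> J \<longrightarrow> J = I"
    by (rule exists_maximal_in) (auto simp: L_ideal)
  then obtain c where c: "c \<in> carrier R" "c \<noteq> \<zero>" "\<not> good c" and "\<forall>J\<in>?S. L c \<subseteq> J \<longrightarrow> J = L c"
    by auto
  then have max: "L d = L c" if "d \<in> carrier R" "d \<noteq> \<zero>" "\<not> good d" "L c \<subseteq> L d" for d
    using that by blast
  have "c \<in> \<mm>"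
  proof (rule ccontr)
    assume "c \<notin> \<mm>"
    then have "good c"
      unfolding good_def using c one_U by (intro exI[of _ 0] bexI[of _ \<one>] bexI[of _ c]) auto
    with c show False by simp
  qed
  then obtain d where d: "d \<in> carrier R" "\<nu> \<otimes> c = \<pi> \<otimes> d"
    using nu_mult by blast
  have nu: "\<nu> \<in> carrier R" "\<nu> \<noteq> \<zero>"
    using nu_U U_nonzero by auto
  then have "\<nu> \<otimes> c \<noteq> \<zero>"
    using c by (simp add: integral_iff)
  then have pi: "\<pi> \<noteq> \<zero>" and "d \<noteq> \<zero>"
    using d by auto
  have "\<not> good d"
  proof
    assume "good d"
    then obtain k u e where k: "u \<in> U" "e \<in> U" "u \<otimes> d = e \<otimes> \<pi> [^] (k::nat)"
      by (auto simp: good_def)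
    have "(u \<otimes> \<nu>) \<otimes> c = u \<otimes> (\<nu> \<otimes> c)"
      using k nu c by (simp add: m_assoc)
    also have "\<dots> = (u \<otimes> d) \<otimes> \<pi>"
      unfolding d(2) using k(1) d(1) by (simp add: m_ac)
    also have "\<dots> = e \<otimes> \<pi> [^] Suc k"
      unfolding k(3) using k(2) by (simp add: m_assoc)
    finally have "good c"
      unfolding good_def using k mult_U[OF k(1) nu_U] by blast
    with c show False by simp
  qed
  moreover have "L c \<subseteq> L d"
  proof
    fix r assume "r \<in> L c"
    then obtain u t where r: "r \<in> carrier R" "u \<in> U" "t \<in> carrier R" "u \<otimes> r = c \<otimes> t"
      by (auto simp: L_def)
    have "(\<nu> \<otimes> u) \<otimes> r = \<nu> \<otimes> c \<otimes> t"
      using nu r c by (simp add: m_assoc)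
    also have "\<dots> = d \<otimes> (\<pi> \<otimes> t)"
      unfolding d(2) using d(1) r(3) by (simp add: m_ac)
    finally have "\<exists>w\<in>U. \<exists>e\<in>carrier R. w \<otimes> r = d \<otimes> e"
      using r(3) mult_U[OF nu_U r(2)] pi_carrier by (meson m_closed)
    then show "r \<in> L d"
      using r(1) by (simp add: L_def)
  qed
  ultimately have "L d = L c"
    using d \<open>d \<noteq> \<zero>\<close> by (intro max) auto
  moreover have "d \<in> L d"
    using d one_U by (auto simp: L_def intro!: bexI[of _ \<one>])
  ultimately have "d \<in> L c" by simp
  then obtain u t where t: "u \<in> U" "t \<in> carrier R" "u \<otimes> d = c \<otimes> t"
    by (auto simp: L_def)
  have "c \<otimes> (u \<otimes> \<nu>) = u \<otimes> (\<nu> \<otimes> c)"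
    using c t(1) nu by (simp add: m_ac)
  also have "\<dots> = \<pi> \<otimes> (u \<otimes> d)"
    unfolding d(2) using t(1) d(1) by (simp add: m_ac)
  also have "\<dots> = c \<otimes> (\<pi> \<otimes> t)"
    unfolding t(3) using t(2) c by (simp add: m_ac)
  finally have "u \<otimes> \<nu> = \<pi> \<otimes> t"
    using c t nu by (simp add: m_lcancel)
  moreover have "\<pi> \<otimes> t \<in> \<mm>"
    using pi_mem t(2) by (rule m.I_r_closed)
  ultimately show False
    using mult_U[OF t(1) nu_U] by auto
qed

text \<open>Up to local units both elements are powers of \<open>\<pi>\<close>, and the one with the
  smaller exponent divides the other. Zero has no exponent and is treated apart.\<close>

lemma local_comparable:
  assumes a: "a \<in> carrier R" and b: "b \<in> carrier R"
  shows "\<exists>u\<in>U. (\<exists>d\<in>carrier R. u \<otimes> b = a \<otimes> d) \<or> (\<exists>d\<in>carrier R. u \<otimes> a = b \<otimes> d)"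
proof -
  have *: "\<exists>u\<in>U. \<exists>d\<in>carrier R. u \<otimes> b = a \<otimes> d"
    if ab: "a \<in> carrier R" "b \<in> carrier R" and u: "u \<in> U" "e \<in> U" "u \<otimes> a = e \<otimes> \<pi> [^] i"
      and v: "v \<in> U" "f \<in> U" "v \<otimes> b = f \<otimes> \<pi> [^] j" and ij: "i \<le> j" for a b u e v f and i j :: nat
  proof -
    have pow: "\<pi> [^] j = \<pi> [^] i \<otimes> \<pi> [^] (j - i)"
      using ij by (simp add: nat_pow_mult)
    have "(e \<otimes> v) \<otimes> b = e \<otimes> (v \<otimes> b)"
      using ab u v by (simp add: m_assoc)
    also have "\<dots> = (e \<otimes> \<pi> [^] i) \<otimes> (f \<otimes> \<pi> [^] (j - i))"
      unfolding v(3) pow using u(2) v(2) by (simp add: m_ac)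
    also have "\<dots> = a \<otimes> (u \<otimes> (f \<otimes> \<pi> [^] (j - i)))"
      unfolding u(3)[symmetric] using u(1) v(2) ab by (simp add: m_ac)
    finally have eq: "(e \<otimes> v) \<otimes> b = a \<otimes> (u \<otimes> (f \<otimes> \<pi> [^] (j - i)))" .
    show ?thesis
      by (rule bexI[where x="e \<otimes> v"], rule bexI[where x="u \<otimes> (f \<otimes> \<pi> [^] (j - i))"])
        (use eq mult_U[OF u(2) v(1)] u(1) v(2) in auto)
  qed
  show ?thesis
  proof (cases "a = \<zero> \<or> b = \<zero>")
    case True
    then show ?thesis
      using a b one_U by (intro bexI[of _ \<one>]) (auto intro!: bexI[of _ \<zero>])
  next
    case False
    obtain i u e where u: "u \<in> U" "e \<in> U" "u \<otimes> a = e \<otimes> \<pi> [^] (i::nat)"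
      using factor_pi_pow[OF a] False by blast
    obtain j v f where v: "v \<in> U" "f \<in> U" "v \<otimes> b = f \<otimes> \<pi> [^] (j::nat)"
      using factor_pi_pow[OF b] False by blast
    show ?thesis
      using *[OF a b u v] *[OF b a v u] by (cases "i \<le> j") auto
  qed
qed

text \<open>A relation \<open>u a = i d\<close> would put \<open>u a\<close> into \<open>I\<close>,
  so comparability gives \<open>u i = a d\<close>. If \<open>d\<close> were outside
  \<open>\<mm>\<close>, then \<open>d a\<close> would be in \<open>I\<close>; hence \<open>d\<close>
  is in \<open>\<mm>\<close> and supplies the extra factor \<open>\<pi>\<close>.\<close>

lemma ideal_locally_below:
  assumes "ideal I R" and a: "a \<in> carrier R" and notin: "\<And>t. t \<in> U \<Longrightarrow> t \<otimes> a \<notin> I" and i: "i \<in> I"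
  shows "\<exists>u\<in>U. \<exists>d\<in>carrier R. u \<otimes> i = a \<otimes> \<pi> \<otimes> d"
proof -
  interpret I: ideal I R by fact
  have iR: "i \<in> carrier R"
    using i I.Icarr by blast
  have "i \<otimes> d \<in> I" if "d \<in> carrier R" for d
    using I.I_r_closed[OF i that] .
  then obtain u d where u: "u \<in> U" "d \<in> carrier R" "u \<otimes> i = a \<otimes> d"
    using local_comparable[OF a iR] notin by metis
  have "d \<in> \<mm>"
  proof (rule ccontr)
    assume "d \<notin> \<mm>"
    then have "d \<otimes> a \<notin> I"
      using u notin by blast
    moreover have "u \<otimes> i \<in> I"
      using u(1) i I.I_l_closed by blast
    ultimately show False
      using u a by (simp add: m_comm)
  qed
  then obtain d' where d': "d' \<in> carrier R" "\<nu> \<otimes> d = \<pi> \<otimes> d'"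
    using nu_mult by blast
  have "(\<nu> \<otimes> u) \<otimes> i = a \<otimes> (\<nu> \<otimes> d)"
    using nu_U u iR a by (simp add: m_assoc m_lcomm)
  also have "\<dots> = a \<otimes> \<pi> \<otimes> d'"
    unfolding d'(2) using a d'(1) by (simp add: m_assoc)
  finally show ?thesis
    using mult_U[OF nu_U u(1)] d'(1) by blast
qed

end

section \<open>Torsion-free modules over Dedekind domains\<close>

context module begin

abbreviation lincomb :: "'c set \<Rightarrow> ('c \<Rightarrow> 'a) \<Rightarrow> 'c"
  where "lincomb Y a \<equiv> (\<Oplus>\<^bsub>M\<^esub>y\<in>Y. a y \<odot>\<^bsub>M\<^esub> y)"

lemma lincomb_closed: "\<lbrakk>Y \<subseteq> carrier M; a \<in> Y \<rightarrow> carrier R\<rbrakk> \<Longrightarrow> lincomb Y a \<in> carrier M"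
  by (intro M.finsum_closed) auto

lemma lincomb_cong:
  "\<lbrakk>Y \<subseteq> carrier M; b \<in> Y \<rightarrow> carrier R; \<And>y. y \<in> Y \<Longrightarrow> a y = b y\<rbrakk> \<Longrightarrow> lincomb Y a = lincomb Y b"
  by (intro M.finsum_cong') auto

lemma lincomb_add:
  assumes "finite Y" "Y \<subseteq> carrier M" "a \<in> Y \<rightarrow> carrier R" "b \<in> Y \<rightarrow> carrier R"
  shows "lincomb Y (\<lambda>y. a y \<oplus> b y) = lincomb Y a \<oplus>\<^bsub>M\<^esub> lincomb Y b"
proof -
  have "lincomb Y (\<lambda>y. a y \<oplus> b y) = (\<Oplus>\<^bsub>M\<^esub>y\<in>Y. a y \<odot>\<^bsub>M\<^esub> y \<oplus>\<^bsub>M\<^esub> b y \<odot>\<^bsub>M\<^esub> y)"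
    using assms by (intro M.finsum_cong') (auto simp: Pi_iff smult_l_distr subset_iff)
  also have "\<dots> = lincomb Y a \<oplus>\<^bsub>M\<^esub> lincomb Y b"
    using assms by (intro M.finsum_addf) (auto simp: Pi_iff subset_iff)
  finally show ?thesis .
qed

lemma lincomb_smult:
  assumes "finite Y" "Y \<subseteq> carrier M" "a \<in> Y \<rightarrow> carrier R" "r \<in> carrier R"
  shows "lincomb Y (\<lambda>y. r \<otimes> a y) = r \<odot>\<^bsub>M\<^esub> lincomb Y a"
proof -
  have "lincomb Y (\<lambda>y. r \<otimes> a y) = (\<Oplus>\<^bsub>M\<^esub>y\<in>Y. r \<odot>\<^bsub>M\<^esub> (a y \<odot>\<^bsub>M\<^esub> y))"
    using assms by (intro M.finsum_cong') (auto simp: Pi_iff smult_assoc1 subset_iff)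
  also have "\<dots> = r \<odot>\<^bsub>M\<^esub> lincomb Y a"
    using assms by (intro finsum_smult_ldistr[symmetric]) (auto simp: Pi_iff subset_iff)
  finally show ?thesis .
qed

lemma lincomb_uminus:
  assumes "finite Y" "Y \<subseteq> carrier M" "a \<in> Y \<rightarrow> carrier R"
  shows "lincomb Y (\<lambda>y. \<ominus> a y) = \<ominus>\<^bsub>M\<^esub> lincomb Y a"
proof -
  have "lincomb Y (\<lambda>y. \<ominus> a y) = lincomb Y (\<lambda>y. \<ominus> \<one> \<otimes> a y)"
    using assms by (intro lincomb_cong) (auto simp: Pi_iff R.l_minus)
  also have "\<dots> = \<ominus>\<^bsub>M\<^esub> lincomb Y a"
    using assms by (simp add: lincomb_smult smult_l_minus lincomb_closed)
  finally show ?thesis .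
qed

lemma lincomb_insert:
  assumes "finite Y" "y \<notin> Y" "insert y Y \<subseteq> carrier M" "a \<in> insert y Y \<rightarrow> carrier R"
  shows "lincomb (insert y Y) a = a y \<odot>\<^bsub>M\<^esub> y \<oplus>\<^bsub>M\<^esub> lincomb Y a"
  using assms by (intro M.finsum_insert) (auto simp: Pi_iff subset_iff)

lemma lincomb_zero:
  assumes "Y \<subseteq> carrier M"
  shows "lincomb Y (\<lambda>_. \<zero>) = \<zero>\<^bsub>M\<^esub>"
proof -
  have "lincomb Y (\<lambda>_. \<zero>) = (\<Oplus>\<^bsub>M\<^esub>y\<in>Y. \<zero>\<^bsub>M\<^esub>)"
    using assms by (intro M.finsum_cong') auto
  then show ?thesis by simp
qed

lemma lincomb_single:
  assumes "finite Y" "Y \<subseteq> carrier M" "x \<in> Y"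
  shows "\<exists>a\<in>Y \<rightarrow> carrier R. x = lincomb Y a"
proof -
  let ?a = "\<lambda>y. if y = x then \<one> else \<zero>"
  have "lincomb (insert x (Y - {x})) ?a = \<one> \<odot>\<^bsub>M\<^esub> x \<oplus>\<^bsub>M\<^esub> lincomb (Y - {x}) ?a"
    using assms by (subst lincomb_insert) auto
  also have "lincomb (Y - {x}) ?a = lincomb (Y - {x}) (\<lambda>_. \<zero>)"
    using assms by (intro lincomb_cong) auto
  also have "\<dots> = \<zero>\<^bsub>M\<^esub>"
    using assms by (intro lincomb_zero) auto
  finally show ?thesis
    using assms by (intro bexI[of _ ?a]) (auto simp: insert_absorb subset_iff)
qed

text \<open>This is the submodule on which \<open>local_coordinates\<close> defines its functionals;
  keeping \<open>s\<close> on the left avoids division.\<close>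

lemma submodule_lincomb:
  assumes "finite Y" "Y \<subseteq> carrier M" "s \<in> carrier R"
  shows "submodule {x \<in> carrier M. \<exists>a\<in>Y \<rightarrow> carrier R. s \<odot>\<^bsub>M\<^esub> x = lincomb Y a} R M"
proof (rule submoduleI)
  have "s \<odot>\<^bsub>M\<^esub> \<zero>\<^bsub>M\<^esub> = lincomb Y (\<lambda>_. \<zero>)"
    using assms by (simp add: lincomb_zero)
  then show "\<zero>\<^bsub>M\<^esub> \<in> {x \<in> carrier M. \<exists>a\<in>Y \<rightarrow> carrier R. s \<odot>\<^bsub>M\<^esub> x = lincomb Y a}"
    by (auto intro!: bexI[of _ "\<lambda>_. \<zero>"])
next
  fix x assume "x \<in> {x \<in> carrier M. \<exists>a\<in>Y \<rightarrow> carrier R. s \<odot>\<^bsub>M\<^esub> x = lincomb Y a}"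
  then obtain a where x: "x \<in> carrier M" "a \<in> Y \<rightarrow> carrier R" "s \<odot>\<^bsub>M\<^esub> x = lincomb Y a"
    by auto
  then have "s \<odot>\<^bsub>M\<^esub> (\<ominus>\<^bsub>M\<^esub> x) = lincomb Y (\<lambda>y. \<ominus> a y)"
    using assms by (simp add: lincomb_uminus smult_r_minus)
  moreover have "(\<lambda>y. \<ominus> a y) \<in> Y \<rightarrow> carrier R"
    using x(2) by auto
  ultimately show "\<ominus>\<^bsub>M\<^esub> x \<in> {x \<in> carrier M. \<exists>a\<in>Y \<rightarrow> carrier R. s \<odot>\<^bsub>M\<^esub> x = lincomb Y a}"
    using x(1) by (auto simp: Bex_def)
next
  fix x x' assume "x \<in> {x \<in> carrier M. \<exists>a\<in>Y \<rightarrow> carrier R. s \<odot>\<^bsub>M\<^esub> x = lincomb Y a}"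
    "x' \<in> {x \<in> carrier M. \<exists>a\<in>Y \<rightarrow> carrier R. s \<odot>\<^bsub>M\<^esub> x = lincomb Y a}"
  then obtain a b where x: "x \<in> carrier M" "a \<in> Y \<rightarrow> carrier R" "s \<odot>\<^bsub>M\<^esub> x = lincomb Y a"
    and x': "x' \<in> carrier M" "b \<in> Y \<rightarrow> carrier R" "s \<odot>\<^bsub>M\<^esub> x' = lincomb Y b"
    by auto
  then have "s \<odot>\<^bsub>M\<^esub> (x \<oplus>\<^bsub>M\<^esub> x') = lincomb Y (\<lambda>y. a y \<oplus> b y)"
    using assms by (simp add: lincomb_add smult_r_distr)
  moreover have "(\<lambda>y. a y \<oplus> b y) \<in> Y \<rightarrow> carrier R"
    using x(2) x'(2) by auto
  ultimately show "x \<oplus>\<^bsub>M\<^esub> x' \<in> {x \<in> carrier M. \<exists>a\<in>Y \<rightarrow> carrier R. s \<odot>\<^bsub>M\<^esub> x = lincomb Y a}"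
    using x(1) x'(1) by (auto simp: Bex_def)
next
  fix r x assume r: "r \<in> carrier R" and "x \<in> {x \<in> carrier M. \<exists>a\<in>Y \<rightarrow> carrier R. s \<odot>\<^bsub>M\<^esub> x = lincomb Y a}"
  then obtain a where x: "x \<in> carrier M" "a \<in> Y \<rightarrow> carrier R" "s \<odot>\<^bsub>M\<^esub> x = lincomb Y a"
    by auto
  have "s \<odot>\<^bsub>M\<^esub> (r \<odot>\<^bsub>M\<^esub> x) = r \<odot>\<^bsub>M\<^esub> (s \<odot>\<^bsub>M\<^esub> x)"
    using x(1) r assms(3) by (simp add: smult_assoc1[symmetric] R.m_comm)
  also have "\<dots> = lincomb Y (\<lambda>y. r \<otimes> a y)"
    unfolding x(3) using assms x(2) r by (simp add: lincomb_smult)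
  finally have "s \<odot>\<^bsub>M\<^esub> (r \<odot>\<^bsub>M\<^esub> x) = lincomb Y (\<lambda>y. r \<otimes> a y)" .
  moreover have "(\<lambda>y. r \<otimes> a y) \<in> Y \<rightarrow> carrier R"
    using x(2) r by auto
  ultimately show "r \<odot>\<^bsub>M\<^esub> x \<in> {x \<in> carrier M. \<exists>a\<in>Y \<rightarrow> carrier R. s \<odot>\<^bsub>M\<^esub> x = lincomb Y a}"
    using x(1) r by (auto simp: Bex_def)
qed auto

lemma submodule_zero_closed: "submodule H R M \<Longrightarrow> \<zero>\<^bsub>M\<^esub> \<in> H"
  using subgroup.one_closed[OF submodule.axioms(1)] by fastforce

text \<open>Makes membership in a submodule accessible to \<open>ideal_eq_carrierI\<close>.\<close>

lemma ideal_colon_submodule: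
  assumes H: "submodule H R M" and x: "x \<in> carrier M"
  shows "ideal {r \<in> carrier R. r \<odot>\<^bsub>M\<^esub> x \<in> H} R" (is "ideal ?I R")
proof (rule idealI[OF R.ring_axioms])
  have mult: "r \<otimes> s \<in> ?I" if "s \<in> ?I" "r \<in> carrier R" for r s
    using that x submoduleE(4)[OF H] by (simp add: smult_assoc1)
  show "r \<otimes> a \<in> ?I" "a \<otimes> r \<in> ?I" if "a \<in> ?I" "r \<in> carrier R" for a r
    using mult[OF that] that R.m_comm[of a r] by auto
  show "subgroup ?I (add_monoid R)"
  proof (rule group.subgroupI[OF abelian_group.a_group[OF R.is_abelian_group]])
    have "\<zero> \<in> ?I" using x submodule_zero_closed[OF H] by simp
    then show "?I \<noteq> {}" by blast
    show "inv\<^bsub>add_monoid R\<^esub> s \<in> ?I" if "s \<in> ?I" for s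
      using that x submoduleE(3)[OF H] by (simp add: smult_l_minus a_inv_def[symmetric])
    show "r \<otimes>\<^bsub>add_monoid R\<^esub> s \<in> ?I" if "r \<in> ?I" "s \<in> ?I" for r s
      using that x submoduleE(5)[OF H] by (simp add: smult_l_distr)
  qed auto
qed

lemma submodule_zero: "submodule {\<zero>\<^bsub>M\<^esub>} R M"
  by (rule submoduleI) auto

lemma submodule_submodule_span:
  assumes "A \<subseteq> carrier M"
  shows "submodule (submodule_span R M A) R M"
proof (rule submoduleI)
  show "submodule_span R M A \<subseteq> carrier M"
    by (rule submodule_span_subset[OF carrier_is_submodule assms])
  show "\<zero>\<^bsub>M\<^esub> \<in> submodule_span R M A"
    using submodule_zero_closed by (auto simp: submodule_span_def)
qed (auto simp: submodule_span_def submoduleE)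

definition lin_independent :: "'c set \<Rightarrow> bool"
  where "lin_independent Y \<longleftrightarrow> (\<forall>a\<in>Y \<rightarrow> carrier R. lincomb Y a = \<zero>\<^bsub>M\<^esub> \<longrightarrow> (\<forall>y\<in>Y. a y = \<zero>))"

lemma lin_independent_unique:
  assumes "lin_independent Y" "finite Y" "Y \<subseteq> carrier M" "a \<in> Y \<rightarrow> carrier R" "b \<in> Y \<rightarrow> carrier R"
    "lincomb Y a = lincomb Y b" "y \<in> Y"
  shows "a y = b y"
proof -
  have "lincomb Y (\<lambda>y. a y \<oplus> \<ominus> b y) = lincomb Y a \<oplus>\<^bsub>M\<^esub> lincomb Y (\<lambda>y. \<ominus> b y)"
    using assms(2-5) by (intro lincomb_add) auto
  also have "\<dots> = \<zero>\<^bsub>M\<^esub>"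
    using assms(2-6) by (simp add: lincomb_uminus lincomb_closed M.r_neg)
  finally have "lincomb Y (\<lambda>y. a y \<oplus> \<ominus> b y) = \<zero>\<^bsub>M\<^esub>" .
  moreover have "(\<lambda>y. a y \<oplus> \<ominus> b y) \<in> Y \<rightarrow> carrier R"
    using assms(4,5) by auto
  ultimately have "\<forall>y\<in>Y. a y \<oplus> \<ominus> b y = \<zero>"
    using assms(1)[unfolded lin_independent_def, THEN bspec, THEN mp] by simp
  then show ?thesis
    using assms(4,5,7) by (metis Pi_mem R.minus_equality R.minus_minus R.add.inv_closed R.a_comm)
qed

end

section \<open>Local bases of finite subsets\<close>

locale torsion_free_at = dedekind_at R \<mm> + module R M for R (structure) and M (structure) and \<mm> +
  assumes torsion_free: "\<lbrakk>r \<in> carrier R; x \<in> carrier M; r \<odot>\<^bsub>M\<^esub> x = \<zero>\<^bsub>M\<^esub>; r \<noteq> \<zero>\<rbrakk> \<Longrightarrow> x = \<zero>\<^bsub>M\<^esub>"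
begin

text \<open>By \<open>local_comparable\<close> divisibility is total locally, so a finite nonempty
  family has a least member; the denominators met on the way are multiplied into
  \<open>u\<close>.\<close>

lemma ex_minimal_coefficient:
  assumes "finite Y" "Y \<noteq> {}" "a \<in> Y \<rightarrow> carrier R"
  shows "\<exists>z\<in>Y. \<exists>u\<in>U. \<forall>y\<in>Y. \<exists>d\<in>carrier R. u \<otimes> a y = a z \<otimes> d"
  using assms
proof (induction rule: finite_ne_induct)
  case (singleton z)
  then have "\<one> \<otimes> a z = a z \<otimes> \<one>" by simp
  then show ?case
    using one_U by blast
next
  case (insert x Y)
  then obtain z u where z: "z \<in> Y" "u \<in> U" "\<forall>y\<in>Y. \<exists>d\<in>carrier R. u \<otimes> a y = a z \<otimes> d"
    by auto
  have aR: "a y \<in> carrier R" if "y \<in> insert x Y" for y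
    using insert.prems that by auto
  have xz: "a x \<in> carrier R" "a z \<in> carrier R"
    using aR z(1) by auto
  obtain w where w: "w \<in> U" "(\<exists>d\<in>carrier R. w \<otimes> a x = a z \<otimes> d) \<or> (\<exists>d\<in>carrier R. w \<otimes> a z = a x \<otimes> d)"
    using local_comparable[OF xz(2,1)] by blast
  have uw: "u \<otimes> w \<in> U" "u \<in> carrier R" "w \<in> carrier R"
    using mult_U[OF z(2) w(1)] z(2) w(1) by auto
  from w(2) show ?case
  proof
    assume "\<exists>d\<in>carrier R. w \<otimes> a x = a z \<otimes> d"
    then obtain d where d: "d \<in> carrier R" "w \<otimes> a x = a z \<otimes> d" by blast
    have "\<exists>e\<in>carrier R. (u \<otimes> w) \<otimes> a y = a z \<otimes> e" if y: "y \<in> insert x Y" for y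
    proof (cases "y = x")
      case True
      have "(u \<otimes> w) \<otimes> a x = u \<otimes> (w \<otimes> a x)"
        using uw xz by (simp add: m_assoc)
      also have "\<dots> = a z \<otimes> (u \<otimes> d)"
        unfolding d(2) using uw xz d(1) by (simp add: m_lcomm)
      finally show ?thesis
        unfolding True using d(1) uw by (meson m_closed)
    next
      case False
      then obtain e where e: "e \<in> carrier R" "u \<otimes> a y = a z \<otimes> e"
        using z(3) y by blast
      have "(u \<otimes> w) \<otimes> a y = w \<otimes> (u \<otimes> a y)"
        using uw aR[OF y] by (simp add: m_ac)
      also have "\<dots> = a z \<otimes> (w \<otimes> e)"
        unfolding e(2) using uw xz e(1) by (simp add: m_lcomm)
      finally show ?thesis
        using e(1) uw by (meson m_closed)
    qed
    then show ?thesis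
      using z(1) uw(1) by blast
  next
    assume "\<exists>d\<in>carrier R. w \<otimes> a z = a x \<otimes> d"
    then obtain d where d: "d \<in> carrier R" "w \<otimes> a z = a x \<otimes> d" by blast
    have "\<exists>e\<in>carrier R. (u \<otimes> w) \<otimes> a y = a x \<otimes> e" if y: "y \<in> insert x Y" for y
    proof (cases "y = x")
      case True
      have "(u \<otimes> w) \<otimes> a x = a x \<otimes> (u \<otimes> w)"
        using uw xz by (simp add: m_comm)
      then show ?thesis
        unfolding True using uw by blast
    next
      case False
      then obtain e where e: "e \<in> carrier R" "u \<otimes> a y = a z \<otimes> e"
        using z(3) y by blast
      have "(u \<otimes> w) \<otimes> a y = w \<otimes> (u \<otimes> a y)"
        using uw aR[OF y] by (simp add: m_ac)
      also have "\<dots> = (w \<otimes> a z) \<otimes> e"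
        unfolding e(2) using uw xz e(1) by (simp add: m_assoc)
      also have "\<dots> = a x \<otimes> (d \<otimes> e)"
        unfolding d(2) using xz e(1) d(1) by (simp add: m_assoc)
      finally show ?thesis
        using e(1) d(1) by (meson m_closed)
    qed
    then show ?thesis
      using uw(1) by blast
  qed
qed

text \<open>Take a set with the fewest elements among those that generate \<open>B\<close> up to a
  denominator. In a nontrivial relation the minimal coefficient \<open>a z\<close> can be divided
  out, by torsion-freeness; the coefficient left at \<open>z\<close> is outside
  \<open>\<mm>\<close>, so \<open>z\<close> could be eliminated.\<close>

lemma local_basis:
  assumes "finite B" "B \<subseteq> carrier M"
  shows "\<exists>s\<in>U. \<exists>Y\<subseteq>carrier M. finite Y \<and> lin_independent Y \<and>
    (\<forall>x\<in>B. \<exists>a\<in>Y \<rightarrow> carrier R. s \<odot>\<^bsub>M\<^esub> x = lincomb Y a)"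
proof -
  define gen where "gen s Y \<longleftrightarrow> s \<in> U \<and> finite Y \<and> Y \<subseteq> carrier M \<and>
    (\<forall>x\<in>B. \<exists>a\<in>Y \<rightarrow> carrier R. s \<odot>\<^bsub>M\<^esub> x = lincomb Y a)" for s Y
  have "gen \<one> B"
    using assms one_U lincomb_single[OF assms] by (auto simp: gen_def subset_iff)
  then have "\<exists>p. gen (fst p) (snd p) \<and> (\<forall>q. gen (fst q) (snd q) \<longrightarrow> card (snd p) \<le> card (snd q))"
    by (intro ex_has_least_nat[of _ "(\<one>, B)"]) simp
  then obtain p where p: "gen (fst p) (snd p)" "\<forall>q. gen (fst q) (snd q) \<longrightarrow> card (snd p) \<le> card (snd q)"
    by (elim exE conjE)
  obtain s Y where pair: "p = (s, Y)" by (cases p)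
  have sY: "gen s Y"
    using p(1) by (simp add: pair)
  have min: "card Y \<le> card Y'" if "gen s' Y'" for s' Y'
    using p(2)[rule_format, of "(s', Y')"] that by (simp add: pair)
  have s: "s \<in> U" and fin: "finite Y" and Y: "Y \<subseteq> carrier M"
    and lc: "\<forall>x\<in>B. \<exists>a\<in>Y \<rightarrow> carrier R. s \<odot>\<^bsub>M\<^esub> x = lincomb Y a"
    using sY by (auto simp: gen_def)
  have "lin_independent Y"
    unfolding lin_independent_def
  proof (intro ballI impI, rule ccontr)
    fix a y0
    assume a: "a \<in> Y \<rightarrow> carrier R" "lincomb Y a = \<zero>\<^bsub>M\<^esub>" and y0: "y0 \<in> Y" "a y0 \<noteq> \<zero>"
    obtain z u where z: "z \<in> Y" "u \<in> U" "\<forall>y\<in>Y. \<exists>d\<in>carrier R. u \<otimes> a y = a z \<otimes> d"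
      using ex_minimal_coefficient[OF fin _ a(1)] y0 by blast
    then obtain d where d: "\<And>y. y \<in> Y \<Longrightarrow> d y \<in> carrier R" "\<And>y. y \<in> Y \<Longrightarrow> u \<otimes> a y = a z \<otimes> d y"
      by metis
    have dR: "d \<in> Y \<rightarrow> carrier R"
      using d(1) by blast
    have u: "u \<in> carrier R" "u \<noteq> \<zero>"
      using z(2) U_nonzero by auto
    have az: "a z \<in> carrier R" "a z \<noteq> \<zero>"
    proof -
      show "a z \<in> carrier R" using a(1) z(1) by blast
      have "u \<otimes> a y0 \<noteq> \<zero>"
        using u y0 a(1) integral_iff[of u "a y0"] by blast
      then show "a z \<noteq> \<zero>"
        using d(2)[OF y0(1)] d(1)[OF y0(1)] by auto
    qed
    \<comment> \<open>After the division the coefficient of \<open>z\<close> is the denominator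
      \<open>u\<close> itself, which lies outside \<open>\<mm>\<close>.\<close>
    have "d z = u"
      using d(2)[OF z(1)] d(1)[OF z(1)] az u by (simp add: m_comm[of u] m_lcancel)
    have "a z \<odot>\<^bsub>M\<^esub> lincomb Y d = lincomb Y (\<lambda>y. a z \<otimes> d y)"
      using lincomb_smult[OF fin Y dR az(1)] by simp
    also have "\<dots> = lincomb Y (\<lambda>y. u \<otimes> a y)"
      using d u a by (intro lincomb_cong[OF Y]) auto
    also have "\<dots> = \<zero>\<^bsub>M\<^esub>"
      using lincomb_smult[OF fin Y a(1) u(1)] a(2) u by simp
    finally have lc_d: "lincomb Y d = \<zero>\<^bsub>M\<^esub>"
      using torsion_free[OF az(1) lincomb_closed[OF Y dR]] az by blast
    have "gen (u \<otimes> s) (Y - {z})"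
      unfolding gen_def
    proof (intro conjI ballI)
      show "u \<otimes> s \<in> U" using mult_U[OF z(2) s] .
      show "finite (Y - {z})" "Y - {z} \<subseteq> carrier M" using fin Y by auto
      fix x assume x: "x \<in> B"
      then obtain b where b: "b \<in> Y \<rightarrow> carrier R" "s \<odot>\<^bsub>M\<^esub> x = lincomb Y b"
        using lc by blast
      have bz: "b z \<in> carrier R" using b(1) z(1) by blast
      \<comment> \<open>From \<open>u\<close> times the expansion of \<open>s x\<close>, the
        relation \<open>d\<close> is subtracted \<open>b z\<close> times; at \<open>z\<close> this
        leaves \<open>u (b z) - (b z) u = 0\<close>.\<close>
      let ?c = "\<lambda>y. u \<otimes> b y \<oplus> (\<ominus> b z) \<otimes> d y"
      have c: "?c \<in> Y \<rightarrow> carrier R"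
        using u b(1) bz dR by auto
      have "(u \<otimes> s) \<odot>\<^bsub>M\<^esub> x = u \<odot>\<^bsub>M\<^esub> lincomb Y b"
        unfolding b(2)[symmetric] using u s x assms(2) by (intro smult_assoc1) auto
      also have "\<dots> = u \<odot>\<^bsub>M\<^esub> lincomb Y b \<oplus>\<^bsub>M\<^esub> (\<ominus> b z) \<odot>\<^bsub>M\<^esub> lincomb Y d"
        using lc_d bz u lincomb_closed[OF Y b(1)] by simp
      also have "\<dots> = lincomb Y (\<lambda>y. u \<otimes> b y) \<oplus>\<^bsub>M\<^esub> lincomb Y (\<lambda>y. (\<ominus> b z) \<otimes> d y)"
        using lincomb_smult[OF fin Y b(1) u(1)] lincomb_smult[OF fin Y dR, of "\<ominus> b z"] bz by simp
      also have "\<dots> = lincomb Y ?c"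
        using u b(1) bz dR by (intro lincomb_add[OF fin Y, symmetric]) auto
      also have "\<dots> = lincomb (insert z (Y - {z})) ?c"
        using z(1) by (simp add: insert_absorb)
      also have "\<dots> = ?c z \<odot>\<^bsub>M\<^esub> z \<oplus>\<^bsub>M\<^esub> lincomb (Y - {z}) ?c"
        using fin Y c z(1) by (intro lincomb_insert) auto
      also have "?c z = \<zero>"
        using u bz \<open>d z = u\<close> by (simp add: l_minus m_comm[of u] abelian_group.r_neg[OF is_abelian_group])
      also have "\<zero> \<odot>\<^bsub>M\<^esub> z \<oplus>\<^bsub>M\<^esub> lincomb (Y - {z}) ?c = lincomb (Y - {z}) ?c"
      proof -
        have "lincomb (Y - {z}) ?c \<in> carrier M"
          using Y c by (intro lincomb_closed) auto
        moreover have "z \<in> carrier M" using Y z(1) by blast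
        ultimately show ?thesis by simp
      qed
      finally have "(u \<otimes> s) \<odot>\<^bsub>M\<^esub> x = lincomb (Y - {z}) ?c" .
      moreover have "?c \<in> Y - {z} \<rightarrow> carrier R" using c by auto
      ultimately show "\<exists>a\<in>Y - {z} \<rightarrow> carrier R. (u \<otimes> s) \<odot>\<^bsub>M\<^esub> x = lincomb (Y - {z}) a"
        by (rule bexI)
    qed
    then have "card Y \<le> card (Y - {z})" by (rule min)
    then show False
      using card_Diff1_less[OF fin z(1)] by linarith
  qed
  then show ?thesis
    using s fin Y lc by blast
qed

text \<open>Independence makes coordinates unique and hence linear in \<open>x\<close>. They are the
  coordinates of \<open>s x\<close> instead of \<open>x\<close>, so that they take values in
  \<open>R\<close>.\<close>

lemma local_coordinates:
  assumes "finite B" "B \<subseteq> carrier M"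
  shows "\<exists>s\<in>U. \<exists>Y P \<phi>. finite Y \<and> Y \<subseteq> carrier M \<and> submodule P R M \<and> B \<subseteq> P \<and>
    (\<forall>y\<in>Y. \<phi> y \<in> linear_maps R (M\<lparr>carrier := P\<rparr>) (ring_as_module R)) \<and>
    (\<forall>x\<in>P. s \<odot>\<^bsub>M\<^esub> x = lincomb Y (\<lambda>y. \<phi> y x))"
proof -
  obtain s Y where s: "s \<in> U" and Y: "Y \<subseteq> carrier M" "finite Y" and ind: "lin_independent Y"
    and B: "\<forall>x\<in>B. \<exists>a\<in>Y \<rightarrow> carrier R. s \<odot>\<^bsub>M\<^esub> x = lincomb Y a"
    using local_basis[OF assms] by auto
  define P where "P = {x \<in> carrier M. \<exists>a\<in>Y \<rightarrow> carrier R. s \<odot>\<^bsub>M\<^esub> x = lincomb Y a}"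
  have sub: "submodule P R M"
    unfolding P_def using submodule_lincomb[OF Y(2,1)] s by simp
  have "\<forall>x\<in>P. \<exists>a. a \<in> Y \<rightarrow> carrier R \<and> s \<odot>\<^bsub>M\<^esub> x = lincomb Y a"
    by (auto simp: P_def)
  then obtain c where "\<forall>x\<in>P. c x \<in> Y \<rightarrow> carrier R \<and> s \<odot>\<^bsub>M\<^esub> x = lincomb Y (c x)"
    by (rule bchoice[THEN exE])
  then have c: "c x \<in> Y \<rightarrow> carrier R" "s \<odot>\<^bsub>M\<^esub> x = lincomb Y (c x)" if "x \<in> P" for x
    using that by auto
  have PM: "x \<in> carrier M" if "x \<in> P" for x
    using that by (simp add: P_def)
  have cR: "c x y \<in> carrier R" if "x \<in> P" "y \<in> Y" for x y
    using c(1) that by blast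
  have sR: "s \<in> carrier R" using s by simp
  have linear: "(\<lambda>x. c x y) \<in> linear_maps R (M\<lparr>carrier := P\<rparr>) (ring_as_module R)" if y: "y \<in> Y" for y
  proof -
    have add: "c (x \<oplus>\<^bsub>M\<^esub> x') y = c x y \<oplus> c x' y" if x: "x \<in> P" "x' \<in> P" for x x'
    proof (rule lin_independent_unique[OF ind Y(2,1) _ _ _ y])
      have xx: "x \<oplus>\<^bsub>M\<^esub> x' \<in> P"
        using submoduleE(5)[OF sub x] .
      show "c (x \<oplus>\<^bsub>M\<^esub> x') \<in> Y \<rightarrow> carrier R" by (rule c(1)[OF xx])
      show "(\<lambda>y. c x y \<oplus> c x' y) \<in> Y \<rightarrow> carrier R" using cR x by auto
      have "lincomb Y (c (x \<oplus>\<^bsub>M\<^esub> x')) = s \<odot>\<^bsub>M\<^esub> x \<oplus>\<^bsub>M\<^esub> s \<odot>\<^bsub>M\<^esub> x'"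
        using c(2)[OF xx] x PM sR by (simp add: smult_r_distr)
      also have "\<dots> = lincomb Y (\<lambda>y. c x y \<oplus> c x' y)"
        unfolding c(2)[OF x(1)] c(2)[OF x(2)] by (rule lincomb_add[OF Y(2,1) c(1)[OF x(1)] c(1)[OF x(2)], symmetric])
      finally show "lincomb Y (c (x \<oplus>\<^bsub>M\<^esub> x')) = lincomb Y (\<lambda>y. c x y \<oplus> c x' y)" .
    qed
    have smult: "c (r \<odot>\<^bsub>M\<^esub> x) y = r \<otimes> c x y" if x: "x \<in> P" and r: "r \<in> carrier R" for x r
    proof (rule lin_independent_unique[OF ind Y(2,1) _ _ _ y])
      have rx: "r \<odot>\<^bsub>M\<^esub> x \<in> P"
        using submoduleE(4)[OF sub r x] .
      show "c (r \<odot>\<^bsub>M\<^esub> x) \<in> Y \<rightarrow> carrier R" by (rule c(1)[OF rx])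
      show "(\<lambda>y. r \<otimes> c x y) \<in> Y \<rightarrow> carrier R" using cR x r by auto
      have "lincomb Y (c (r \<odot>\<^bsub>M\<^esub> x)) = r \<odot>\<^bsub>M\<^esub> (s \<odot>\<^bsub>M\<^esub> x)"
        using c(2)[OF rx] x r PM sR by (simp add: smult_assoc1[symmetric] m_comm)
      also have "\<dots> = lincomb Y (\<lambda>y. r \<otimes> c x y)"
        unfolding c(2)[OF x] by (rule lincomb_smult[OF Y(2,1) c(1)[OF x] r, symmetric])
      finally show "lincomb Y (c (r \<odot>\<^bsub>M\<^esub> x)) = lincomb Y (\<lambda>y. r \<otimes> c x y)" .
    qed
    show ?thesis
      using add smult cR y by (auto simp: linear_maps_def)
  qed
  have "B \<subseteq> P"
    using B assms(2) by (auto simp: P_def)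
  then show ?thesis
    using s Y sub linear c(2)
    by (intro bexI[OF _ s] exI[of _ Y] exI[of _ P] exI[of _ "\<lambda>y x. c x y"]) auto
qed

end

section \<open>Formal tensors: scaling, coordinates and vanishing\<close>

context module_pair begin

text \<open>\<open>tensor_product\<close> is only a group. This is the \<open>R\<close>-action
  lifted to formal sums, so that annihilators of tensors can be formed; it acts on the right factor,
  where coordinates are taken.\<close>

definition scale :: "'a \<Rightarrow> ('c \<times> 'e \<Rightarrow>\<^sub>0 int) \<Rightarrow> ('c \<times> 'e \<Rightarrow>\<^sub>0 int)"
  where "scale s = frag_extend (\<lambda>p. frag_of (fst p, s \<odot>\<^bsub>M\<^esub> snd p))"

lemma scale_simps [simp]:
  "scale s 0 = 0" "scale s (frag_of (x, y)) = frag_of (x, s \<odot>\<^bsub>M\<^esub> y)"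
  "scale s (c - d) = scale s c - scale s d" "scale s (c + d) = scale s c + scale s d" "scale s (- c) = - scale s c"
  by (simp_all add: scale_def frag_extend_diff frag_extend_add frag_extend_minus)

lemma scale_kernel:
  assumes "c \<in> K" and s: "s \<in> carrier R"
  shows "scale s c \<in> K"
  using assms(1)
proof (induction rule: kernel_induct)
  case (add_left x x' y)
  then show ?case
    using kernel_add_left[of x x' "s \<odot>\<^bsub>M\<^esub> y"] s by simp
next
  case (add_right x y y')
  then show ?case
    using kernel_add_right[of x "s \<odot>\<^bsub>M\<^esub> y" "s \<odot>\<^bsub>M\<^esub> y'"] s by (simp add: M.smult_r_distr)
next
  case (smult r x y)
  then have "s \<odot>\<^bsub>M\<^esub> (r \<odot>\<^bsub>M\<^esub> y) = r \<odot>\<^bsub>M\<^esub> (s \<odot>\<^bsub>M\<^esub> y)"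
    using s by (simp add: M.smult_assoc1[symmetric] N.m_comm)
  with smult show ?case
    using kernel_smult[of r x "s \<odot>\<^bsub>M\<^esub> y"] s by simp
qed (simp_all add: kernel_zero kernel_uminus kernel_add)

lemma scale_one: "Poly_Mapping.keys c \<subseteq> pairs \<Longrightarrow> scale \<one> c = c"
proof (induction c rule: frag_induction)
  case (one p)
  then show ?case by (cases p) simp
qed simp_all

lemma scale_mult:
  assumes "Poly_Mapping.keys c \<subseteq> pairs" "r \<in> carrier R" "s \<in> carrier R"
  shows "scale (r \<otimes> s) c = scale r (scale s c)"
  using assms(1)
proof (induction c rule: frag_induction)
  case (one p)
  then show ?case
    using assms(2,3) by (cases p) (simp add: M.smult_assoc1)
qed simp_all

text \<open>On formal sums the action is not additive in the scalar; it becomes so modulo the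
  relators for addition in the right factor.\<close>

lemma scale_add:
  assumes "Poly_Mapping.keys c \<subseteq> pairs" and r: "r \<in> carrier R" and s: "s \<in> carrier R"
  shows "scale (r \<oplus> s) c - scale r c - scale s c \<in> K"
  using assms(1)
proof (induction c rule: frag_induction)
  case zero
  show ?case by (simp add: kernel_zero)
next
  case (one p)
  then show ?case
    using kernel_add_right[of "fst p" "r \<odot>\<^bsub>M\<^esub> snd p" "s \<odot>\<^bsub>M\<^esub> snd p"] r s
    by (cases p) (simp add: M.smult_l_distr)
next
  case (diff c d)
  from kernel_diff[OF this] show ?case
    by (simp add: algebra_simps)
qed

text \<open>This annihilator is the input for \<open>ideal_eq_carrierI\<close>: a tensor vanishes if
  for each \<open>\<mm>\<close> some scalar outside \<open>\<mm>\<close> kills it.\<close>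

lemma ideal_scale_kernel:
  assumes c: "Poly_Mapping.keys c \<subseteq> pairs"
  shows "ideal {s \<in> carrier R. scale s c \<in> K} R" (is "ideal ?I R")
proof (rule idealI[OF N.ring_axioms])
  have mult: "r \<otimes> s \<in> ?I" if "s \<in> ?I" "r \<in> carrier R" for r s
    using that scale_mult[OF c] scale_kernel by auto
  show "x \<otimes> a \<in> ?I" "a \<otimes> x \<in> ?I" if "a \<in> ?I" "x \<in> carrier R" for a x
    using mult[OF that] that N.m_comm[of a x] by auto
  show "subgroup ?I (add_monoid R)"
  proof (rule group.subgroupI[OF N.R.a_group])
    show "?I \<subseteq> carrier (add_monoid R)" by auto
    \<comment> \<open>For the scalars \<open>\<zero>\<close> and \<open>\<zero>\<close> the three
      terms of \<open>scale_add\<close> collapse to this negative.\<close>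
    have "- (scale \<zero> c) \<in> K"
      using scale_add[OF c N.R.zero_closed N.R.zero_closed] by simp
    then have "\<zero> \<in> ?I"
      using kernel_uminus[of "- (scale \<zero> c)"] by simp
    then show "?I \<noteq> {}" by blast
  next
    fix s assume s: "s \<in> ?I"
    then have "\<ominus> \<one> \<otimes> s \<in> ?I" by (intro mult) auto
    then show "inv\<^bsub>add_monoid R\<^esub> s \<in> ?I"
      using s by (simp add: N.R.l_minus a_inv_def[symmetric])
  next
    fix r s assume rs: "r \<in> ?I" "s \<in> ?I"
    then have "scale (r \<oplus> s) c - scale r c - scale s c \<in> K"
      by (intro scale_add[OF c]) auto
    then have "(scale (r \<oplus> s) c - scale r c - scale s c) + scale r c + scale s c \<in> K"
      using rs by (intro kernel_add) auto
    then show "r \<otimes>\<^bsub>add_monoid R\<^esub> s \<in> ?I"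
      using rs by simp
  qed
qed

lemma kernel_finsum:
  assumes "finite Y" "g \<in> Y \<rightarrow> carrier M" and x: "x \<in> carrier N"
  shows "frag_of (x, \<Oplus>\<^bsub>M\<^esub>y\<in>Y. g y) - (\<Sum>y\<in>Y. frag_of (x, g y)) \<in> K"
  using assms(1,2)
proof (induction Y)
  case empty
  then show ?case
    using x by (simp add: kernel_zero_right)
next
  case (insert z Y)
  then have "frag_of (x, g z \<oplus>\<^bsub>M\<^esub> (\<Oplus>\<^bsub>M\<^esub>y\<in>Y. g y)) - frag_of (x, g z) - frag_of (x, \<Oplus>\<^bsub>M\<^esub>y\<in>Y. g y) \<in> K"
    by (intro kernel_add_right x M.M.finsum_closed) auto
  moreover have "frag_of (x, \<Oplus>\<^bsub>M\<^esub>y\<in>Y. g y) - (\<Sum>y\<in>Y. frag_of (x, g y)) \<in> K"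
    using insert by (intro insert.IH) auto
  ultimately have "(frag_of (x, g z \<oplus>\<^bsub>M\<^esub> (\<Oplus>\<^bsub>M\<^esub>y\<in>Y. g y)) - frag_of (x, g z) - frag_of (x, \<Oplus>\<^bsub>M\<^esub>y\<in>Y. g y))
      + (frag_of (x, \<Oplus>\<^bsub>M\<^esub>y\<in>Y. g y) - (\<Sum>y\<in>Y. frag_of (x, g y))) \<in> K"
    by (rule kernel_add)
  moreover have "(\<Oplus>\<^bsub>M\<^esub>y\<in>insert z Y. g y) = g z \<oplus>\<^bsub>M\<^esub> (\<Oplus>\<^bsub>M\<^esub>y\<in>Y. g y)"
    using insert by (intro M.M.finsum_insert) auto
  ultimately show ?case
    using insert(1,2) by (simp add: algebra_simps)
qed

lemma ex_coordinate_hom: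
  assumes "\<And>x. x \<in> P \<Longrightarrow> \<phi> x \<in> carrier R" "P \<subseteq> carrier M"
  shows "\<exists>h\<in>hom (free_Abelian_group pairs) (add_monoid N).
    \<forall>x\<in>carrier N. \<forall>y\<in>P. h (frag_of (x, y)) = \<phi> y \<odot>\<^bsub>N\<^esub> x"
proof -
  \<comment> \<open>The free group asks for a value on every pair, while \<open>\<phi>\<close> is
    controlled on \<open>P\<close> only. Zero is an arbitrary choice elsewhere, so \<open>h\<close>
    need not respect relators that leave \<open>P\<close>.\<close>
  let ?f = "\<lambda>p. if snd p \<in> P then \<phi> (snd p) \<odot>\<^bsub>N\<^esub> fst p else \<zero>\<^bsub>N\<^esub>"
  have "?f p \<in> carrier N" if "p \<in> pairs" for p
    using that assms(1) by auto
  then obtain h where "h \<in> hom (free_Abelian_group pairs) (add_monoid N)" "\<forall>p\<in>pairs. h (frag_of p) = ?f p"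
    using ex_frag_hom[of N pairs ?f] N.M.abelian_group_axioms by blast
  then show ?thesis
    using assms(2) by (intro bexI[of _ h]) (auto simp: subset_iff)
qed

text \<open>Expanding \<open>s x\<close> and moving scalars to the left turns
  \<open>n \<otimes> s x\<close> into the sum of all \<open>\<phi> y x n \<otimes> y\<close>. So
  \<open>s c\<close> is represented on \<open>Y\<close> with coefficients \<open>h y c\<close> in
  \<open>N\<close>, and it vanishes as soon as these do.\<close>

lemma scale_coordinates:
  assumes Y: "finite Y" "Y \<subseteq> carrier M" and P: "P \<subseteq> carrier M"
    and \<phi>: "\<And>x y. \<lbrakk>x \<in> P; y \<in> Y\<rbrakk> \<Longrightarrow> \<phi> y x \<in> carrier R"
    and lc: "\<And>x. x \<in> P \<Longrightarrow> s \<odot>\<^bsub>M\<^esub> x = M.lincomb Y (\<lambda>y. \<phi> y x)"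
    and h: "\<And>y. y \<in> Y \<Longrightarrow> h y \<in> hom (free_Abelian_group pairs) (add_monoid N)"
    and hf: "\<And>n x y. \<lbrakk>n \<in> carrier N; x \<in> P; y \<in> Y\<rbrakk> \<Longrightarrow> h y (frag_of (n, x)) = \<phi> y x \<odot>\<^bsub>N\<^esub> n"
    and c: "Poly_Mapping.keys c \<subseteq> carrier N \<times> P"
  shows "scale s c - (\<Sum>y\<in>Y. frag_of (h y c, y)) \<in> K"
proof -
  note hom = abelian_group_hom_frag[OF N.M.abelian_group_axioms h]
  have PY: "y \<in> carrier M" if "y \<in> Y" for y
    using Y that by blast
  have "Poly_Mapping.keys c \<subseteq> pairs \<and> scale s c - (\<Sum>y\<in>Y. frag_of (h y c, y)) \<in> K"
    using c
  proof (induction c rule: frag_induction)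
    case zero
    have "(\<Sum>y\<in>Y. frag_of (h y 0, y)) \<in> K"
      by (rule kernel_sum) (use hom(1) kernel_zero_left PY in auto)
    then show ?case
      using kernel_uminus by simp
  next
    case (one p)
    then obtain n x where p: "p = (n, x)" "n \<in> carrier N" "x \<in> P"
      by auto
    have "frag_of (n, M.lincomb Y (\<lambda>y. \<phi> y x)) - (\<Sum>y\<in>Y. frag_of (n, \<phi> y x \<odot>\<^bsub>M\<^esub> y)) \<in> K"
      using Y p \<phi> PY by (intro kernel_finsum) auto
    moreover have "(\<Sum>y\<in>Y. frag_of (h y (frag_of p), y) - frag_of (n, \<phi> y x \<odot>\<^bsub>M\<^esub> y)) \<in> K"
    proof (rule kernel_sum)
      fix y assume y: "y \<in> Y"
      show "frag_of (h y (frag_of p), y) - frag_of (n, \<phi> y x \<odot>\<^bsub>M\<^esub> y) \<in> K"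
        unfolding p(1) hf[OF p(2,3) y] by (rule kernel_smult[OF \<phi>[OF p(3) y] p(2) PY[OF y]])
    qed
    ultimately have "(frag_of (n, M.lincomb Y (\<lambda>y. \<phi> y x)) - (\<Sum>y\<in>Y. frag_of (n, \<phi> y x \<odot>\<^bsub>M\<^esub> y)))
        - (\<Sum>y\<in>Y. frag_of (h y (frag_of p), y) - frag_of (n, \<phi> y x \<odot>\<^bsub>M\<^esub> y)) \<in> K"
      by (rule kernel_diff)
    then have "frag_of (n, M.lincomb Y (\<lambda>y. \<phi> y x)) - (\<Sum>y\<in>Y. frag_of (h y (frag_of p), y)) \<in> K"
      by (simp add: sum_subtractf)
    then show ?case
      using p P lc by auto
  next
    case (diff c d)
    have "(\<Sum>y\<in>Y. frag_of (h y c, y) - frag_of (h y (c - d), y) - frag_of (h y d, y)) \<in> K"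
    proof (rule kernel_sum)
      fix y assume y: "y \<in> Y"
      have hc: "h y c \<in> carrier N" "h y d \<in> carrier N" "h y (c - d) = h y c \<ominus>\<^bsub>N\<^esub> h y d"
        using hom(2)[OF y] hom(5)[OF y] diff by blast+
      then have "h y c = h y (c - d) \<oplus>\<^bsub>N\<^esub> h y d"
        by (simp add: N.M.minus_eq N.M.a_assoc N.M.l_neg)
      then show "frag_of (h y c, y) - frag_of (h y (c - d), y) - frag_of (h y d, y) \<in> K"
        using kernel_add_left[of "h y (c - d)" "h y d" y] hc PY[OF y] by simp
    qed
    then have "(\<Sum>y\<in>Y. frag_of (h y c, y)) - (\<Sum>y\<in>Y. frag_of (h y (c - d), y)) - (\<Sum>y\<in>Y. frag_of (h y d, y)) \<in> K"
      by (simp add: sum_subtractf)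
    then have "(scale s c - (\<Sum>y\<in>Y. frag_of (h y c, y))) - (scale s d - (\<Sum>y\<in>Y. frag_of (h y d, y)))
      + ((\<Sum>y\<in>Y. frag_of (h y c, y)) - (\<Sum>y\<in>Y. frag_of (h y (c - d), y)) - (\<Sum>y\<in>Y. frag_of (h y d, y))) \<in> K"
      using diff kernel_add kernel_diff by blast
    moreover have "Poly_Mapping.keys (c - d) \<subseteq> pairs"
      using diff keys_diff[of c d] by blast
    ultimately show ?case
      by (simp add: algebra_simps)
  qed
  then show ?thesis ..
qed

text \<open>Vanishing in the tensor product involves only finitely many elements of \<open>M\<close>, so it is
  detected by functionals defined merely on a finitely generated submodule.\<close>

definition vanishing_on :: "'e set \<Rightarrow> ('c \<times> 'e \<Rightarrow>\<^sub>0 int) \<Rightarrow> bool"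
  where "vanishing_on B c \<longleftrightarrow> (\<forall>P \<phi> h. B \<subseteq> P \<longrightarrow> P \<subseteq> carrier M \<longrightarrow>
      \<phi> \<in> linear_maps R (M\<lparr>carrier := P\<rparr>) (ring_as_module R) \<longrightarrow>
      h \<in> hom (free_Abelian_group pairs) (add_monoid N) \<longrightarrow>
      (\<forall>x\<in>carrier N. \<forall>y\<in>P. h (frag_of (x, y)) = \<phi> y \<odot>\<^bsub>N\<^esub> x) \<longrightarrow> h c = \<zero>\<^bsub>N\<^esub>)"

lemma vanishing_onI:
  assumes "\<And>P \<phi> h. \<lbrakk>B \<subseteq> P; P \<subseteq> carrier M; \<phi> \<in> linear_maps R (M\<lparr>carrier := P\<rparr>) (ring_as_module R);
    h \<in> hom (free_Abelian_group pairs) (add_monoid N);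
    \<forall>x\<in>carrier N. \<forall>y\<in>P. h (frag_of (x, y)) = \<phi> y \<odot>\<^bsub>N\<^esub> x\<rbrakk> \<Longrightarrow> h c = \<zero>\<^bsub>N\<^esub>"
  shows "vanishing_on B c"
  unfolding vanishing_on_def by (intro allI impI) (rule assms)

lemma vanishing_onD:
  assumes "vanishing_on B c" "B \<subseteq> P" "P \<subseteq> carrier M"
    "\<phi> \<in> linear_maps R (M\<lparr>carrier := P\<rparr>) (ring_as_module R)"
    "h \<in> hom (free_Abelian_group pairs) (add_monoid N)"
    "\<forall>x\<in>carrier N. \<forall>y\<in>P. h (frag_of (x, y)) = \<phi> y \<odot>\<^bsub>N\<^esub> x"
  shows "h c = \<zero>\<^bsub>N\<^esub>"
  using assms(1)[unfolded vanishing_on_def, rule_format, OF assms(2-5)] assms(6) by simp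

text \<open>A relator is killed once the functional is defined and linear on the elements of
  \<open>M\<close> that occur in it. These elements form \<open>B\<close>, and sums of relators take
  unions.\<close>

lemma kernel_finite_support:
  assumes "c \<in> K"
  shows "\<exists>B. finite B \<and> B \<subseteq> carrier M \<and> vanishing_on B c"
  using assms
proof (induction rule: kernel_induct)
  case zero
  show ?case
    by (intro exI[of _ "{}"]) (auto intro!: vanishing_onI abelian_group_hom_frag(1)[OF N.M.abelian_group_axioms])
next
  case (add_left x x' y)
  have "vanishing_on {y} (frag_of (x \<oplus>\<^bsub>N\<^esub> x', y) - frag_of (x, y) - frag_of (x', y))"
  proof (rule vanishing_onI)
    fix P \<phi> h
    assume P: "{y} \<subseteq> P" "P \<subseteq> carrier M" and \<phi>: "\<phi> \<in> linear_maps R (M\<lparr>carrier := P\<rparr>) (ring_as_module R)"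
      and h: "h \<in> hom (free_Abelian_group pairs) (add_monoid N)"
      and hf: "\<forall>x\<in>carrier N. \<forall>y\<in>P. h (frag_of (x, y)) = \<phi> y \<odot>\<^bsub>N\<^esub> x"
    have "\<phi> y \<in> carrier R"
      using \<phi> P by (auto simp: linear_maps_def)
    then show "h (frag_of (x \<oplus>\<^bsub>N\<^esub> x', y) - frag_of (x, y) - frag_of (x', y)) = \<zero>\<^bsub>N\<^esub>"
      using add_left P hf
      by (simp add: abelian_group_hom_frag[OF N.M.abelian_group_axioms h] keys_diff[THEN order_trans]
          N.smult_r_distr N.M.minus_eq N.M.minus_add N.M.r_neg N.M.a_ac)
  qed
  then show ?case
    using add_left by (intro exI[of _ "{y}"]) auto
next
  case (add_right x y y')
  \<comment> \<open>The sum has to be listed too: in \<open>vanishing_on\<close> the set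
    \<open>P\<close> may fail to be closed under addition, and \<open>h\<close> is known on
    \<open>P\<close> only.\<close>
  let ?B = "{y, y', y \<oplus>\<^bsub>M\<^esub> y'}"
  have "vanishing_on ?B (frag_of (x, y \<oplus>\<^bsub>M\<^esub> y') - frag_of (x, y) - frag_of (x, y'))"
  proof (rule vanishing_onI)
    fix P \<phi> h
    assume P: "?B \<subseteq> P" "P \<subseteq> carrier M" and \<phi>: "\<phi> \<in> linear_maps R (M\<lparr>carrier := P\<rparr>) (ring_as_module R)"
      and h: "h \<in> hom (free_Abelian_group pairs) (add_monoid N)"
      and hf: "\<forall>x\<in>carrier N. \<forall>y\<in>P. h (frag_of (x, y)) = \<phi> y \<odot>\<^bsub>N\<^esub> x"
    have "\<phi> y \<in> carrier R" "\<phi> y' \<in> carrier R" "\<phi> (y \<oplus>\<^bsub>M\<^esub> y') = \<phi> y \<oplus> \<phi> y'"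
      using \<phi> P by (auto simp: linear_maps_def)
    then show "h (frag_of (x, y \<oplus>\<^bsub>M\<^esub> y') - frag_of (x, y) - frag_of (x, y')) = \<zero>\<^bsub>N\<^esub>"
      using add_right P hf
      by (simp add: abelian_group_hom_frag[OF N.M.abelian_group_axioms h] keys_diff[THEN order_trans]
          N.smult_l_distr N.M.minus_eq N.M.minus_add N.M.r_neg N.M.a_ac)
  qed
  then show ?case
    using add_right by (intro exI[of _ ?B]) auto
next
  case (smult r x y)
  let ?B = "{y, r \<odot>\<^bsub>M\<^esub> y}"
  have "vanishing_on ?B (frag_of (r \<odot>\<^bsub>N\<^esub> x, y) - frag_of (x, r \<odot>\<^bsub>M\<^esub> y))"
  proof (rule vanishing_onI)
    fix P \<phi> h
    assume P: "?B \<subseteq> P" "P \<subseteq> carrier M" and \<phi>: "\<phi> \<in> linear_maps R (M\<lparr>carrier := P\<rparr>) (ring_as_module R)"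
      and h: "h \<in> hom (free_Abelian_group pairs) (add_monoid N)"
      and hf: "\<forall>x\<in>carrier N. \<forall>y\<in>P. h (frag_of (x, y)) = \<phi> y \<odot>\<^bsub>N\<^esub> x"
    have "\<phi> y \<in> carrier R" "\<phi> (r \<odot>\<^bsub>M\<^esub> y) = r \<otimes> \<phi> y"
      using \<phi> P smult(1) by (auto simp: linear_maps_def)
    then show "h (frag_of (r \<odot>\<^bsub>N\<^esub> x, y) - frag_of (x, r \<odot>\<^bsub>M\<^esub> y)) = \<zero>\<^bsub>N\<^esub>"
      using smult P hf
      by (simp add: abelian_group_hom_frag[OF N.M.abelian_group_axioms h] N.smult_assoc1[symmetric]
          N.m_comm N.M.minus_eq N.M.r_neg)
  qed
  then show ?case
    using smult by (intro exI[of _ ?B]) auto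
next
  case (uminus c)
  then obtain B where B: "finite B" "B \<subseteq> carrier M" "vanishing_on B c" by blast
  have "vanishing_on B (- c)"
  proof (rule vanishing_onI)
    fix P \<phi> h
    assume *: "B \<subseteq> P" "P \<subseteq> carrier M" "\<phi> \<in> linear_maps R (M\<lparr>carrier := P\<rparr>) (ring_as_module R)"
      and h: "h \<in> hom (free_Abelian_group pairs) (add_monoid N)"
      and hf: "\<forall>x\<in>carrier N. \<forall>y\<in>P. h (frag_of (x, y)) = \<phi> y \<odot>\<^bsub>N\<^esub> x"
    show "h (- c) = \<zero>\<^bsub>N\<^esub>"
      using vanishing_onD[OF B(3) * h hf]
      by (simp add: abelian_group_hom_frag(4)[OF N.M.abelian_group_axioms h keys_kernel[OF uminus(1)]])
  qed
  with B(1,2) show ?case by blast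
next
  case (add c d)
  then obtain B C where BC: "finite B" "B \<subseteq> carrier M" "finite C" "C \<subseteq> carrier M"
    "vanishing_on B c" "vanishing_on C d" by blast
  have "vanishing_on (B \<union> C) (c + d)"
  proof (rule vanishing_onI)
    fix P \<phi> h
    assume P: "B \<union> C \<subseteq> P" and *: "P \<subseteq> carrier M" "\<phi> \<in> linear_maps R (M\<lparr>carrier := P\<rparr>) (ring_as_module R)"
      and h: "h \<in> hom (free_Abelian_group pairs) (add_monoid N)"
      and hf: "\<forall>x\<in>carrier N. \<forall>y\<in>P. h (frag_of (x, y)) = \<phi> y \<odot>\<^bsub>N\<^esub> x"
    have "B \<subseteq> P" "C \<subseteq> P" using P by auto
    then show "h (c + d) = \<zero>\<^bsub>N\<^esub>"
      using vanishing_onD[OF BC(5) _ * h hf] vanishing_onD[OF BC(6) _ * h hf]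
      by (simp add: abelian_group_hom_frag(3)[OF N.M.abelian_group_axioms h keys_kernel[OF add(1)] keys_kernel[OF add(2)]])
  qed
  with BC show ?case
    by (intro exI[of _ "B \<union> C"]) simp
qed

end

section \<open>Flatness and faithful flatness from local coordinates\<close>

locale torsion_free_module = dedekind_domain R + module R M for R (structure) and M (structure) +
  assumes torsion_free: "\<lbrakk>r \<in> carrier R; x \<in> carrier M; r \<odot>\<^bsub>M\<^esub> x = \<zero>\<^bsub>M\<^esub>; r \<noteq> \<zero>\<rbrakk> \<Longrightarrow> x = \<zero>\<^bsub>M\<^esub>"
begin

lemma torsion_free_at:
  assumes "maximalideal \<mm> R"
  shows "torsion_free_at R M \<mm>"
  by (intro torsion_free_at.intro dedekind_at.intro dedekind_at_axioms.intro
      torsion_free_at_axioms.intro dedekind_domain_axioms module_axioms assms) (rule torsion_free)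

text \<open>Taking coordinates commutes with \<open>f\<close>: a functional applied to the image of
  \<open>c\<close> yields \<open>f\<close> of the corresponding coordinate of \<open>c\<close>. The
  image vanishes, so by injectivity all coordinates of \<open>c\<close> are zero, and the
  denominator \<open>s\<close> annihilates \<open>c\<close>.\<close>

lemma tensor_map_kernel:
  assumes "module R N" "module R N'" and f: "f \<in> linear_maps R N N'" "inj_on f (carrier N)"
    and c: "Poly_Mapping.keys c \<subseteq> carrier N \<times> carrier M"
    and Fc: "frag_extend (\<lambda>(x, y). frag_of (f x, y)) c \<in> tensor_kernel R N' M"
  shows "c \<in> tensor_kernel R N M"
proof -
  interpret P: module_pair R N M by (intro module_pair.intro assms module_axioms)
  interpret P': module_pair R N' M by (intro module_pair.intro assms module_axioms)
  let ?F = "frag_extend (\<lambda>(x, y). frag_of (f x, y))"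
  have f_closed: "f x \<in> carrier N'" if "x \<in> carrier N" for x
    using f(1) that by (auto simp: linear_maps_def)
  have f_add: "f (x \<oplus>\<^bsub>N\<^esub> y) = f x \<oplus>\<^bsub>N'\<^esub> f y" if "x \<in> carrier N" "y \<in> carrier N" for x y
    using f(1) that by (auto simp: linear_maps_def)
  have f_smult: "f (r \<odot>\<^bsub>N\<^esub> x) = r \<odot>\<^bsub>N'\<^esub> f x" if "r \<in> carrier R" "x \<in> carrier N" for r x
    using f(1) that by (auto simp: linear_maps_def)
  have f_zero: "f \<zero>\<^bsub>N\<^esub> = \<zero>\<^bsub>N'\<^esub>"
    using f_smult[of \<zero> "\<zero>\<^bsub>N\<^esub>"] f_closed by simp
  have f_minus: "f (x \<ominus>\<^bsub>N\<^esub> y) = f x \<ominus>\<^bsub>N'\<^esub> f y" if "x \<in> carrier N" "y \<in> carrier N" for x y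
    using f_add[of x "\<ominus> \<one> \<odot>\<^bsub>N\<^esub> y"] f_smult[of "\<ominus> \<one>" y] f_closed that
    by (simp add: P.N.M.minus_eq P'.N.M.minus_eq P.N.smult_l_minus P'.N.smult_l_minus)
  obtain B where B: "finite B" "B \<subseteq> carrier M"
    and vanish: "P'.vanishing_on B (?F c)"
    using P'.kernel_finite_support[OF Fc] by auto
  have "{s \<in> carrier R. P.scale s c \<in> P.K} = carrier R"
  proof (rule ideal_eq_carrierI[OF P.ideal_scale_kernel[OF c]])
    fix \<mm> assume m: "maximalideal \<mm> R"
    interpret m: torsion_free_at R M \<mm> by (rule torsion_free_at[OF m])
    \<comment> \<open>\<open>B\<close> lets the functionals vanish on the image of \<open>c\<close>;
      the second components of \<open>c\<close> are included so that \<open>c\<close> itself has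
      coordinates.\<close>
    have "finite (B \<union> snd ` Poly_Mapping.keys c)" "B \<union> snd ` Poly_Mapping.keys c \<subseteq> carrier M"
      using B c by auto
    note ex = m.local_coordinates[OF this]
    obtain s Y P \<phi> where s: "s \<in> m.U" and Y: "finite Y" "Y \<subseteq> carrier M"
      and P: "submodule P R M" "B \<union> snd ` Poly_Mapping.keys c \<subseteq> P"
      and \<phi>: "\<forall>y\<in>Y. \<phi> y \<in> linear_maps R (M\<lparr>carrier := P\<rparr>) (ring_as_module R)"
      and lc: "\<forall>x\<in>P. s \<odot>\<^bsub>M\<^esub> x = lincomb Y (\<lambda>y. \<phi> y x)"
    proof -
      from ex show thesis by (elim bexE exE conjE) (rule that)
    qed
    have PM: "P \<subseteq> carrier M"
      by (rule submoduleE(1)[OF P(1)])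
    have \<phi>R: "\<phi> y x \<in> carrier R" if "x \<in> P" "y \<in> Y" for x y
      using \<phi> that by (auto simp: linear_maps_def)
    have "\<forall>y\<in>Y. \<exists>h. h \<in> hom (free_Abelian_group P.pairs) (add_monoid N) \<and>
        (\<forall>n\<in>carrier N. \<forall>x\<in>P. h (frag_of (n, x)) = \<phi> y x \<odot>\<^bsub>N\<^esub> n)"
      using P.ex_coordinate_hom[OF \<phi>R PM] by (simp add: Bex_def)
    then obtain h where h: "\<forall>y\<in>Y. h y \<in> hom (free_Abelian_group P.pairs) (add_monoid N) \<and>
        (\<forall>n\<in>carrier N. \<forall>x\<in>P. h y (frag_of (n, x)) = \<phi> y x \<odot>\<^bsub>N\<^esub> n)"
      by (rule bchoice[THEN exE])
    have ck: "Poly_Mapping.keys c \<subseteq> carrier N \<times> P"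
    proof
      fix p assume p: "p \<in> Poly_Mapping.keys c"
      then have "p \<in> carrier N \<times> carrier M" "snd p \<in> P"
        using c P(2) by auto
      then show "p \<in> carrier N \<times> P" by (cases p) auto
    qed
    have h_zero: "h y c = \<zero>\<^bsub>N\<^esub>" if y: "y \<in> Y" for y
    proof -
      obtain h' where h': "h' \<in> hom (free_Abelian_group P'.pairs) (add_monoid N')"
          "\<forall>n\<in>carrier N'. \<forall>x\<in>P. h' (frag_of (n, x)) = \<phi> y x \<odot>\<^bsub>N'\<^esub> n"
        using P'.ex_coordinate_hom[where \<phi>="\<phi> y" and P=P, OF \<phi>R[OF _ y] PM] by auto
      have hy: "h y \<in> hom (free_Abelian_group P.pairs) (add_monoid N)"
        using h y by blast
      note hom = abelian_group_hom_frag[OF P.N.M.abelian_group_axioms hy]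
      note hom' = abelian_group_hom_frag[OF P'.N.M.abelian_group_axioms h'(1)]
      \<comment> \<open>The supports are carried through the induction because the homomorphism laws
        for differences hold only for sums supported on the given pairs.\<close>
      have "Poly_Mapping.keys c \<subseteq> P.pairs \<and> Poly_Mapping.keys (?F c) \<subseteq> P'.pairs \<and> h' (?F c) = f (h y c)"
        using ck
      proof (induction c rule: frag_induction)
        case zero
        show ?case by (simp add: hom(1) hom'(1) f_zero)
      next
        case (one p)
        then obtain n x where p: "p = (n, x)" "n \<in> carrier N" "x \<in> P" by auto
        then have "h' (frag_of (f n, x)) = f (h y (frag_of (n, x)))"
          using h'(2) h y f_closed f_smult \<phi>R by auto
        then show ?case
          using p PM f_closed by auto
      next
        case (diff a b)
        have keys: "Poly_Mapping.keys (a - b) \<subseteq> P.pairs" "Poly_Mapping.keys (?F a - ?F b) \<subseteq> P'.pairs"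
          using diff keys_diff[of a b] keys_diff[of "?F a" "?F b"] by blast+
        have "h' (?F a - ?F b) = h' (?F a) \<ominus>\<^bsub>N'\<^esub> h' (?F b)"
          using diff by (intro hom'(5)) auto
        also have "\<dots> = f (h y a \<ominus>\<^bsub>N\<^esub> h y b)"
          using diff hom(2) by (simp add: f_minus)
        also have "\<dots> = f (h y (a - b))"
          using diff hom(5) by simp
        finally show ?case
          using keys by (simp add: frag_extend_diff)
      qed
      moreover have "h' (?F c) = \<zero>\<^bsub>N'\<^esub>"
        using P(2) by (intro P'.vanishing_onD[OF vanish _ PM _ h'] bspec[OF \<phi> y]) auto
      ultimately have "f (h y c) = f \<zero>\<^bsub>N\<^esub>"
        by (simp add: f_zero)
      then show ?thesis
        using inj_onD[OF f(2)] hom(2)[OF c] by simp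
    qed
    have "P.scale s c - (\<Sum>y\<in>Y. frag_of (h y c, y)) \<in> P.K"
      by (rule P.scale_coordinates[OF Y PM, where \<phi>=\<phi>]) (use \<phi>R lc h ck in auto)
    moreover have "(\<Sum>y\<in>Y. frag_of (h y c, y)) \<in> P.K"
      using h_zero Y(2) P.kernel_zero_left by (intro P.kernel_sum) auto
    ultimately have "(P.scale s c - (\<Sum>y\<in>Y. frag_of (h y c, y))) + (\<Sum>y\<in>Y. frag_of (h y c, y)) \<in> P.K"
      by (rule P.kernel_add)
    then show "\<exists>s\<in>{s \<in> carrier R. P.scale s c \<in> P.K}. s \<notin> \<mm>"
      using s by auto
  qed
  then have "P.scale \<one> c \<in> P.K"
    by (auto simp: set_eq_iff)
  then show ?thesis
    by (simp add: P.scale_one[OF c])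
qed

lemma flat: "flat TYPE('n) R M"
  unfolding flat_def
proof (intro allI impI)
  fix N N' :: "('a, 'n) module" and f
  assume *: "module R N" "module R N'" and f: "f \<in> linear_maps R N N'" "inj_on f (carrier N)"
  show "inj_on (tensor_map R N' M f) (carrier (tensor_product R N M))"
    unfolding inj_on_tensor_map_iff[OF * module_axioms f(1)]
    by (intro allI impI tensor_map_kernel[OF * f])
qed

text \<open>The annihilator of a nonzero \<open>n\<close> lies in some \<open>\<mm>\<close>. Take
  the \<open>x\<close> of \<open>ndiv\<close>: from \<open>n \<otimes> x = 0\<close> every
  coordinate of \<open>s x\<close> annihilates \<open>n\<close>, so it is in \<open>\<mm>\<close>
  and locally a multiple of \<open>\<pi>\<close>. Then \<open>x\<close> is locally divisible by
  \<open>\<pi>\<close>, a contradiction.\<close>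

lemma faithfully_flatI:
  assumes ndiv: "\<And>\<mm>. maximalideal \<mm> R \<Longrightarrow>
    \<exists>x\<in>carrier M. \<forall>u\<in>carrier R - \<mm>. \<forall>y\<in>carrier M. u \<odot>\<^bsub>M\<^esub> x \<noteq> dedekind_at.\<pi> R \<mm> \<odot>\<^bsub>M\<^esub> y"
  shows "faithfully_flat TYPE('n) R M"
  unfolding faithfully_flat_def
proof (intro conjI allI impI flat)
  fix N :: "('a, 'n) module"
  assume N: "module R N" and triv: "carrier (tensor_product R N M) = {\<one>\<^bsub>tensor_product R N M\<^esub>}"
  interpret P: module_pair R N M by (intro module_pair.intro N module_axioms)
  have triv: "frag_of (n, x) \<in> P.K" if "n \<in> carrier N" "x \<in> carrier M" for n x
    using triv that P.tensor_product_trivial_iff by blast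
  have "n = \<zero>\<^bsub>N\<^esub>" if n: "n \<in> carrier N" for n
  proof (rule ccontr)
    assume n0: "n \<noteq> \<zero>\<^bsub>N\<^esub>"
    let ?I = "{r \<in> carrier R. r \<odot>\<^bsub>N\<^esub> n = \<zero>\<^bsub>N\<^esub>}"
    have "ideal ?I R"
      using P.N.ideal_colon_submodule[OF P.N.submodule_zero n] by simp
    moreover have "\<one> \<notin> ?I"
      using n n0 by simp
    then have "?I \<noteq> carrier R" by blast
    ultimately obtain \<mm> where m: "maximalideal \<mm> R" "?I \<subseteq> \<mm>"
      using exists_maximalideal by blast
    interpret m: torsion_free_at R M \<mm> by (rule torsion_free_at[OF m(1)])
    obtain x where x: "x \<in> carrier M" and xm: "\<And>u y. \<lbrakk>u \<in> m.U; y \<in> carrier M\<rbrakk> \<Longrightarrow> u \<odot>\<^bsub>M\<^esub> x \<noteq> m.\<pi> \<odot>\<^bsub>M\<^esub> y"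
      using ndiv[OF m(1)] by blast
    obtain B where B: "finite B" "B \<subseteq> carrier M"
      and vanish: "P.vanishing_on B (frag_of (n, x))"
      using P.kernel_finite_support[OF triv[OF n x]] by auto
    have "finite (insert x B)" "insert x B \<subseteq> carrier M"
      using B x by auto
    note ex = m.local_coordinates[OF this]
    obtain s Y P \<phi> where s: "s \<in> m.U" and Y: "finite Y" "Y \<subseteq> carrier M"
      and P: "submodule P R M" "insert x B \<subseteq> P"
      and \<phi>: "\<forall>y\<in>Y. \<phi> y \<in> linear_maps R (M\<lparr>carrier := P\<rparr>) (ring_as_module R)"
      and lc: "\<forall>x\<in>P. s \<odot>\<^bsub>M\<^esub> x = lincomb Y (\<lambda>y. \<phi> y x)"
    proof -
      from ex show thesis by (elim bexE exE conjE) (rule that)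
    qed
    have PM: "P \<subseteq> carrier M"
      by (rule submoduleE(1)[OF P(1)])
    have xP: "x \<in> P" using P(2) by blast
    have \<phi>R: "\<phi> y x' \<in> carrier R" if "x' \<in> P" "y \<in> Y" for x' y
      using \<phi> that by (auto simp: linear_maps_def)
    have \<phi>m: "\<phi> y x \<in> \<mm>" if y: "y \<in> Y" for y
    proof -
      obtain h where h: "h \<in> hom (free_Abelian_group P.pairs) (add_monoid N)"
          "\<forall>n\<in>carrier N. \<forall>x\<in>P. h (frag_of (n, x)) = \<phi> y x \<odot>\<^bsub>N\<^esub> n"
        using P.ex_coordinate_hom[where \<phi>="\<phi> y" and P=P, OF \<phi>R[OF _ y] PM] by auto
      have "h (frag_of (n, x)) = \<zero>\<^bsub>N\<^esub>"
        using P(2) by (intro P.vanishing_onD[OF vanish _ PM _ h] bspec[OF \<phi> y]) auto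
      then have "\<phi> y x \<in> ?I"
        using h(2) n xP \<phi>R[OF xP y] by simp
      then show ?thesis using m(2) by blast
    qed
    have "\<exists>d\<in>carrier R. m.\<nu> \<otimes> \<phi> y x = m.\<pi> \<otimes> d" if "y \<in> Y" for y
      using m.nu_mult \<phi>m[OF that] by blast
    then obtain d where d: "\<And>y. y \<in> Y \<Longrightarrow> d y \<in> carrier R" "\<And>y. y \<in> Y \<Longrightarrow> m.\<nu> \<otimes> \<phi> y x = m.\<pi> \<otimes> d y"
      by metis
    have nu: "m.\<nu> \<in> carrier R"
      using m.nu_U by simp
    have \<phi>Y: "(\<lambda>y. \<phi> y x) \<in> Y \<rightarrow> carrier R" and dY: "d \<in> Y \<rightarrow> carrier R"
      using \<phi>R[OF xP] d(1) by auto
    have "(m.\<nu> \<otimes> s) \<odot>\<^bsub>M\<^esub> x = m.\<nu> \<odot>\<^bsub>M\<^esub> lincomb Y (\<lambda>y. \<phi> y x)"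
      using bspec[OF lc xP] nu s x by (simp add: smult_assoc1)
    also have "\<dots> = lincomb Y (\<lambda>y. m.\<nu> \<otimes> \<phi> y x)"
      by (rule lincomb_smult[OF Y \<phi>Y nu, symmetric])
    also have "\<dots> = lincomb Y (\<lambda>y. m.\<pi> \<otimes> d y)"
      by (rule lincomb_cong[OF Y(2)]) (use d in auto)
    also have "\<dots> = m.\<pi> \<odot>\<^bsub>M\<^esub> lincomb Y d"
      by (rule lincomb_smult[OF Y dY]) simp
    finally show False
      using xm[OF m.mult_U[OF m.nu_U s] lincomb_closed[OF Y(2) dY]] by simp
  qed
  then show "carrier N = {\<zero>\<^bsub>N\<^esub>}"
    by auto
qed

end

section \<open>Properties of localizations\<close>

locale dedekind_module_at = dedekind_at R \<mm> + module R M for R (structure) and M (structure) and \<mm>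
begin

sublocale loc: localized_module R M U
  by (intro localized_module.intro module_axioms localized_module_axioms.intro one_U mult_U) auto

lemma domain_ring_at: "domain (ring_at R \<mm>)"
  by (rule loc.ms.domain_loc_ring[OF domain_axioms]) (use m.zero_closed in auto)

lemma ring_frac_zero_iff:
  "\<lbrakk>a \<in> carrier R; s \<in> U\<rbrakk> \<Longrightarrow> loc.ms.rng.frac a s = \<zero>\<^bsub>ring_at R \<mm>\<^esub> \<longleftrightarrow> a = \<zero>"
  using one_U U_nonzero by (auto simp: loc.ms.frac_eq_zero_iff integral_iff)

text \<open>\<open>r/1\<close> is a nonzero element of the domain \<open>R\<^sub>\<mm>\<close> and
  kills \<open>x/1\<close>, so \<open>flat_regular_smult_zero\<close> gives
  \<open>x/1 = 0\<close>.\<close>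

lemma flat_torsion:
  assumes "flat TYPE(('a \<times> 'a) set set) (ring_at R \<mm>) (module_at R \<mm> M)"
    and r: "r \<in> carrier R" "r \<noteq> \<zero>" and x: "x \<in> carrier M" "r \<odot>\<^bsub>M\<^esub> x = \<zero>\<^bsub>M\<^esub>"
  shows "\<exists>u\<in>U. u \<odot>\<^bsub>M\<^esub> x = \<zero>\<^bsub>M\<^esub>"
proof -
  interpret L: domain "ring_at R \<mm>" by (rule domain_ring_at)
  let ?a = "loc.ms.rng.frac r \<one>"
  have "loc.frac x \<one> = \<zero>\<^bsub>module_at R \<mm> M\<^esub>"
  proof (rule L.flat_regular_smult_zero[OF loc.module_loc_module assms(1)])
    show a: "?a \<in> carrier (ring_at R \<mm>)"
      using r one_U by (intro loc.ms.frac_closed)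
    show "b = \<zero>\<^bsub>ring_at R \<mm>\<^esub>" if "b \<in> carrier (ring_at R \<mm>)" "?a \<otimes>\<^bsub>ring_at R \<mm>\<^esub> b = \<zero>\<^bsub>ring_at R \<mm>\<^esub>" for b
      using L.integral[OF that(2) a that(1)] r one_U by (simp add: ring_frac_zero_iff)
    show "loc.frac x \<one> \<in> carrier (module_at R \<mm> M)"
      using x one_U by (intro loc.frac_closed)
    show "?a \<odot>\<^bsub>module_at R \<mm> M\<^esub> loc.frac x \<one> = \<zero>\<^bsub>module_at R \<mm> M\<^esub>"
      using r x one_U by (simp add: loc.smult_frac loc.zero_loc_module)
  qed
  then show ?thesis
    using x(1) one_U by (simp add: loc.frac_eq_zero_iff)
qed

text \<open>Otherwise \<open>\<pi>\<close> would divide all of \<open>M\<^sub>\<mm>\<close>, and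
  \<open>faithfully_flat_divisible_unit\<close> would make \<open>\<pi>/1\<close> a unit although
  \<open>\<pi>\<close> is in \<open>\<mm>\<close>.\<close>

lemma faithfully_flat_not_divisible:
  assumes "faithfully_flat TYPE(('a \<times> 'a) set set) (ring_at R \<mm>) (module_at R \<mm> M)"
  shows "\<exists>x\<in>carrier M. \<forall>u\<in>U. \<forall>y\<in>carrier M. u \<odot>\<^bsub>M\<^esub> x \<noteq> \<pi> \<odot>\<^bsub>M\<^esub> y"
proof (rule ccontr)
  assume neg: "\<not> ?thesis"
  interpret L: domain "ring_at R \<mm>" by (rule domain_ring_at)
  let ?a = "loc.ms.rng.frac \<pi> \<one>"
  have "\<exists>b\<in>carrier (ring_at R \<mm>). ?a \<otimes>\<^bsub>ring_at R \<mm>\<^esub> b = \<one>\<^bsub>ring_at R \<mm>\<^esub>"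
  proof (rule L.faithfully_flat_divisible_unit[OF loc.module_loc_module assms])
    show "?a \<in> carrier (ring_at R \<mm>)"
      using one_U by (intro loc.ms.frac_closed) auto
    fix A assume "A \<in> carrier (module_at R \<mm> M)"
    then obtain x s where A: "A = loc.frac x s" and x: "x \<in> carrier M" "s \<in> U"
      by (rule loc.loc_module_cases)
    obtain u y where u: "u \<in> U" "y \<in> carrier M" "u \<odot>\<^bsub>M\<^esub> x = \<pi> \<odot>\<^bsub>M\<^esub> y"
      using neg x(1) by blast
    have us: "u \<otimes> s \<in> U" using mult_U[OF u(1) x(2)] .
    have "loc.frac x s = loc.frac (\<pi> \<odot>\<^bsub>M\<^esub> y) (u \<otimes> s)"
    proof (rule loc.frac_eqI[OF x(1) _ x(2) us])
      show "\<pi> \<odot>\<^bsub>M\<^esub> y \<in> carrier M" using u by simp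
      have "(u \<otimes> s) \<odot>\<^bsub>M\<^esub> x = s \<odot>\<^bsub>M\<^esub> (u \<odot>\<^bsub>M\<^esub> x)"
        using u(1) x by (simp add: smult_assoc1[symmetric] m_comm)
      then show "(u \<otimes> s) \<odot>\<^bsub>M\<^esub> x = s \<odot>\<^bsub>M\<^esub> (\<pi> \<odot>\<^bsub>M\<^esub> y)"
        by (simp add: u(3))
    qed
    then have "A = ?a \<odot>\<^bsub>module_at R \<mm> M\<^esub> loc.frac y (u \<otimes> s)"
      using A u us one_U by (simp add: loc.smult_frac)
    then show "\<exists>B\<in>carrier (module_at R \<mm> M). A = ?a \<odot>\<^bsub>module_at R \<mm> M\<^esub> B"
      using loc.frac_closed[OF u(2) us] by blast
  qed
  then obtain B where "B \<in> carrier (ring_at R \<mm>)" "?a \<otimes>\<^bsub>ring_at R \<mm>\<^esub> B = \<one>\<^bsub>ring_at R \<mm>\<^esub>"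
    by blast
  then obtain b t where b: "b \<in> carrier R" "t \<in> U" "?a \<otimes>\<^bsub>ring_at R \<mm>\<^esub> loc.ms.rng.frac b t = \<one>\<^bsub>ring_at R \<mm>\<^esub>"
    by (metis loc.ms.loc_ring_cases)
  then have "loc.ms.rng.frac (\<pi> \<otimes> b) t = loc.ms.rng.frac \<one> \<one>"
    using one_U by (simp add: loc.ms.mult_frac loc.ms.one_loc_ring)
  then obtain u where u: "u \<in> U" "u \<otimes> (\<pi> \<otimes> b) = u \<otimes> t"
    using b one_U by (subst (asm) loc.ms.rng.frac_eq_iff) auto
  have "u \<otimes> (\<pi> \<otimes> b) \<in> \<mm>"
    using u(1) b(1) pi_mem m.I_l_closed m.I_r_closed by simp
  then show False
    using u mult_U[OF u(1) b(2)] by simp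
qed

text \<open>This is \<open>ohm_rush_separated\<close> over \<open>R\<^sub>\<mm>\<close> for
  \<open>\<pi>/1\<close>. Its condition \<open>sep\<close> holds because a nonzero \<open>c\<close>
  is locally a unit times some \<open>\<pi> [^] k\<close>, which \<open>\<pi> [^] Suc k\<close> does
  not divide.\<close>

lemma ohm_rush_divisible:
  assumes "ohm_rush (ring_at R \<mm>) (module_at R \<mm> M)"
    and f: "f \<in> carrier M" "\<And>n::nat. \<exists>u\<in>U. \<exists>y\<in>carrier M. u \<odot>\<^bsub>M\<^esub> f = \<pi> [^] n \<odot>\<^bsub>M\<^esub> y"
  shows "\<exists>u\<in>U. u \<odot>\<^bsub>M\<^esub> f = \<zero>\<^bsub>M\<^esub>"
proof -
  interpret L: domain "ring_at R \<mm>" by (rule domain_ring_at)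
  let ?a = "loc.ms.rng.frac \<pi> \<one>"
  have pow: "?a [^]\<^bsub>ring_at R \<mm>\<^esub> n = loc.ms.rng.frac (\<pi> [^] n) \<one>" for n :: nat
    by (rule loc.ms.pow_frac) simp
  have "loc.frac f \<one> = \<zero>\<^bsub>module_at R \<mm> M\<^esub>"
  proof (rule module.ohm_rush_separated[OF loc.module_loc_module assms(1)])
    show "?a \<in> carrier (ring_at R \<mm>)"
      using one_U by (intro loc.ms.frac_closed) auto
    show "loc.frac f \<one> \<in> carrier (module_at R \<mm> M)"
      using f(1) one_U by (intro loc.frac_closed)
    show "\<exists>y\<in>carrier (module_at R \<mm> M). loc.frac f \<one> = ?a [^]\<^bsub>ring_at R \<mm>\<^esub> n \<odot>\<^bsub>module_at R \<mm> M\<^esub> y" for n :: nat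
    proof -
      obtain u y where u: "u \<in> U" "y \<in> carrier M" "u \<odot>\<^bsub>M\<^esub> f = \<pi> [^] n \<odot>\<^bsub>M\<^esub> y"
        using f(2) by blast
      then have "loc.frac f \<one> = loc.frac (\<pi> [^] n \<odot>\<^bsub>M\<^esub> y) u"
        using f(1) one_U by (intro loc.frac_eqI) auto
      then have "loc.frac f \<one> = ?a [^]\<^bsub>ring_at R \<mm>\<^esub> n \<odot>\<^bsub>module_at R \<mm> M\<^esub> loc.frac y u"
        using u one_U by (simp add: pow loc.smult_frac)
      then show ?thesis
        using loc.frac_closed[OF u(2,1)] by blast
    qed
    fix C assume C: "C \<in> carrier (ring_at R \<mm>)"
      and div: "\<And>n::nat. \<exists>D\<in>carrier (ring_at R \<mm>). C = ?a [^]\<^bsub>ring_at R \<mm>\<^esub> n \<otimes>\<^bsub>ring_at R \<mm>\<^esub> D"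
    obtain c s where c: "C = loc.ms.rng.frac c s" "c \<in> carrier R" "s \<in> U"
      using C by (rule loc.ms.loc_ring_cases)
    have "c = \<zero>"
    proof (rule ccontr)
      assume "c \<noteq> \<zero>"
      then obtain k u e where k: "u \<in> U" "e \<in> U" "u \<otimes> c = e \<otimes> \<pi> [^] (k::nat)"
        using factor_pi_pow[OF c(2)] by blast
      obtain D where D: "D \<in> carrier (ring_at R \<mm>)" "C = ?a [^]\<^bsub>ring_at R \<mm>\<^esub> Suc k \<otimes>\<^bsub>ring_at R \<mm>\<^esub> D"
        using div by blast
      obtain d t where d: "D = loc.ms.rng.frac d t" "d \<in> carrier R" "t \<in> U"
        using D(1) by (rule loc.ms.loc_ring_cases)
      have "loc.ms.rng.frac c s = loc.ms.rng.frac (\<pi> [^] Suc k \<otimes> d) t"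
        using D(2) d one_U unfolding c(1) pow by (simp add: loc.ms.mult_frac)
      then obtain w where w: "w \<in> U" "w \<otimes> (t \<otimes> c) = w \<otimes> (s \<otimes> (\<pi> [^] Suc k \<otimes> d))"
        using c d by (subst (asm) loc.ms.rng.frac_eq_iff) auto
      have R: "u \<in> carrier R" "e \<in> carrier R" "t \<in> carrier R" "s \<in> carrier R" "w \<in> carrier R" "w \<noteq> \<zero>"
        using k d c w U_nonzero by auto
      then have tc: "t \<otimes> c = s \<otimes> (\<pi> [^] Suc k \<otimes> d)"
        using w(2) c(2) d(2) m_lcancel[of w "t \<otimes> c" "s \<otimes> (\<pi> [^] Suc k \<otimes> d)"] by simp
      \<comment> \<open>This excludes \<open>\<pi> = \<zero>\<close>, so that
        \<open>\<pi> [^] k\<close> can be cancelled below.\<close>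
      have "t \<otimes> c \<noteq> \<zero>"
        using R(3) d(3) c(2) \<open>c \<noteq> \<zero>\<close> U_nonzero integral_iff by blast
      then have "\<pi> [^] Suc k \<noteq> \<zero>"
        using tc R(4) d(2) by (auto simp del: nat_pow_Suc)
      then have pk: "\<pi> [^] k \<noteq> \<zero>"
        by auto
      have "\<pi> [^] k \<otimes> (t \<otimes> e) = t \<otimes> (e \<otimes> \<pi> [^] k)"
        using R by (simp add: m_ac)
      also have "\<dots> = u \<otimes> (t \<otimes> c)"
        unfolding k(3)[symmetric] using R c(2) by (simp add: m_lcomm)
      also have "\<dots> = \<pi> [^] k \<otimes> (\<pi> \<otimes> (u \<otimes> (s \<otimes> d)))"
        unfolding tc using R d(2) by (simp add: m_ac)
      finally have "t \<otimes> e = \<pi> \<otimes> (u \<otimes> (s \<otimes> d))"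
        using pk R d(2) by (simp add: m_lcancel)
      moreover have "\<pi> \<otimes> (u \<otimes> (s \<otimes> d)) \<in> \<mm>"
        using pi_mem R d(2) by (intro m.I_r_closed) auto
      ultimately show False
        using mult_U[OF d(3) k(2)] by simp
    qed
    then show "C = \<zero>\<^bsub>ring_at R \<mm>\<^esub>"
      using c by (simp add: ring_frac_zero_iff)
  qed
  then show ?thesis
    using f(1) one_U by (simp add: loc.frac_eq_zero_iff)
qed

text \<open>The preimage of \<open>b M\<^sub>\<mm>\<close> in \<open>M\<close>, written without
  denominators. Being a submodule, it can bound \<open>ideal_mult_module\<close>, which is defined
  as a span.\<close>

lemma submodule_locally_divisible:
  assumes b: "b \<in> carrier R"
  shows "submodule {f \<in> carrier M. \<exists>u\<in>U. \<exists>x\<in>carrier M. u \<odot>\<^bsub>M\<^esub> f = b \<odot>\<^bsub>M\<^esub> x} R M"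
proof (rule submoduleI)
  show "\<zero>\<^bsub>M\<^esub> \<in> {f \<in> carrier M. \<exists>u\<in>U. \<exists>x\<in>carrier M. u \<odot>\<^bsub>M\<^esub> f = b \<odot>\<^bsub>M\<^esub> x}"
    using one_U b by (auto intro!: bexI[of _ \<one>] bexI[of _ "\<zero>\<^bsub>M\<^esub>"])
next
  fix f assume "f \<in> {f \<in> carrier M. \<exists>u\<in>U. \<exists>x\<in>carrier M. u \<odot>\<^bsub>M\<^esub> f = b \<odot>\<^bsub>M\<^esub> x}"
  then obtain u x where f: "f \<in> carrier M" "u \<in> U" "x \<in> carrier M" "u \<odot>\<^bsub>M\<^esub> f = b \<odot>\<^bsub>M\<^esub> x"
    by auto
  have "u \<odot>\<^bsub>M\<^esub> (\<ominus>\<^bsub>M\<^esub> f) = b \<odot>\<^bsub>M\<^esub> (\<ominus>\<^bsub>M\<^esub> x)"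
    using f b by (simp add: smult_r_minus)
  then show "\<ominus>\<^bsub>M\<^esub> f \<in> {f \<in> carrier M. \<exists>u\<in>U. \<exists>x\<in>carrier M. u \<odot>\<^bsub>M\<^esub> f = b \<odot>\<^bsub>M\<^esub> x}"
    using f(1-3) M.a_inv_closed by blast
next
  fix f g assume "f \<in> {f \<in> carrier M. \<exists>u\<in>U. \<exists>x\<in>carrier M. u \<odot>\<^bsub>M\<^esub> f = b \<odot>\<^bsub>M\<^esub> x}"
    "g \<in> {f \<in> carrier M. \<exists>u\<in>U. \<exists>x\<in>carrier M. u \<odot>\<^bsub>M\<^esub> f = b \<odot>\<^bsub>M\<^esub> x}"
  then obtain u x v y where f: "f \<in> carrier M" "u \<in> U" "x \<in> carrier M" "u \<odot>\<^bsub>M\<^esub> f = b \<odot>\<^bsub>M\<^esub> x"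
    and g: "g \<in> carrier M" "v \<in> U" "y \<in> carrier M" "v \<odot>\<^bsub>M\<^esub> g = b \<odot>\<^bsub>M\<^esub> y"
    by auto
  have uv: "u \<in> carrier R" "v \<in> carrier R" using f g by auto
  have "(u \<otimes> v) \<odot>\<^bsub>M\<^esub> (f \<oplus>\<^bsub>M\<^esub> g) = v \<odot>\<^bsub>M\<^esub> (u \<odot>\<^bsub>M\<^esub> f) \<oplus>\<^bsub>M\<^esub> u \<odot>\<^bsub>M\<^esub> (v \<odot>\<^bsub>M\<^esub> g)"
    using uv f(1) g(1) by (simp add: smult_assoc1[symmetric] smult_r_distr m_comm)
  also have "\<dots> = b \<odot>\<^bsub>M\<^esub> (v \<odot>\<^bsub>M\<^esub> x \<oplus>\<^bsub>M\<^esub> u \<odot>\<^bsub>M\<^esub> y)"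
    unfolding f(4) g(4) using uv f(3) g(3) b by (simp add: smult_assoc1[symmetric] smult_r_distr m_comm)
  finally have "(u \<otimes> v) \<odot>\<^bsub>M\<^esub> (f \<oplus>\<^bsub>M\<^esub> g) = b \<odot>\<^bsub>M\<^esub> (v \<odot>\<^bsub>M\<^esub> x \<oplus>\<^bsub>M\<^esub> u \<odot>\<^bsub>M\<^esub> y)" .
  moreover have "v \<odot>\<^bsub>M\<^esub> x \<oplus>\<^bsub>M\<^esub> u \<odot>\<^bsub>M\<^esub> y \<in> carrier M" "f \<oplus>\<^bsub>M\<^esub> g \<in> carrier M"
    using uv f g by simp_all
  ultimately show "f \<oplus>\<^bsub>M\<^esub> g \<in> {f \<in> carrier M. \<exists>u\<in>U. \<exists>x\<in>carrier M. u \<odot>\<^bsub>M\<^esub> f = b \<odot>\<^bsub>M\<^esub> x}"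
    using mult_U[OF f(2) g(2)] by blast
next
  fix r f assume r: "r \<in> carrier R" and "f \<in> {f \<in> carrier M. \<exists>u\<in>U. \<exists>x\<in>carrier M. u \<odot>\<^bsub>M\<^esub> f = b \<odot>\<^bsub>M\<^esub> x}"
  then obtain u x where f: "f \<in> carrier M" "u \<in> U" "x \<in> carrier M" "u \<odot>\<^bsub>M\<^esub> f = b \<odot>\<^bsub>M\<^esub> x"
    by auto
  have "u \<odot>\<^bsub>M\<^esub> (r \<odot>\<^bsub>M\<^esub> f) = r \<odot>\<^bsub>M\<^esub> (u \<odot>\<^bsub>M\<^esub> f)"
    using f(1,2) r by (simp add: smult_assoc1[symmetric] m_comm)
  also have "\<dots> = b \<odot>\<^bsub>M\<^esub> (r \<odot>\<^bsub>M\<^esub> x)"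
    unfolding f(4) using f(3) r b by (simp add: smult_assoc1[symmetric] m_comm)
  finally show "r \<odot>\<^bsub>M\<^esub> f \<in> {f \<in> carrier M. \<exists>u\<in>U. \<exists>x\<in>carrier M. u \<odot>\<^bsub>M\<^esub> f = b \<odot>\<^bsub>M\<^esub> x}"
    using f r smult_closed[OF r f(1)] smult_closed[OF r f(3)] by blast
qed auto

text \<open>\<open>ideal_locally_below\<close> settles the generators of \<open>I M\<close>, and the
  locally divisible elements form a submodule.\<close>

lemma locally_divisible_if_below:
  assumes "ideal I R" "a \<in> carrier R" "\<And>t. t \<in> U \<Longrightarrow> t \<otimes> a \<notin> I" and f: "f \<in> ideal_mult_module R I M"
  shows "\<exists>u\<in>U. \<exists>x\<in>carrier M. u \<odot>\<^bsub>M\<^esub> f = (a \<otimes> \<pi>) \<odot>\<^bsub>M\<^esub> x"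
proof -
  let ?H = "{f \<in> carrier M. \<exists>u\<in>U. \<exists>x\<in>carrier M. u \<odot>\<^bsub>M\<^esub> f = (a \<otimes> \<pi>) \<odot>\<^bsub>M\<^esub> x}"
  have "ideal_mult_module R I M \<subseteq> ?H"
  proof (rule ideal_mult_module_subset)
    show "submodule ?H R M"
      using assms(2) by (intro submodule_locally_divisible) simp
    fix i x assume i: "i \<in> I" and x: "x \<in> carrier M"
    have iR: "i \<in> carrier R"
      by (rule ideal.Icarr[OF assms(1) i])
    obtain u d where u: "u \<in> U" "d \<in> carrier R" "u \<otimes> i = a \<otimes> \<pi> \<otimes> d"
      using ideal_locally_below[OF assms(1-3) i] by blast
    have "u \<odot>\<^bsub>M\<^esub> (i \<odot>\<^bsub>M\<^esub> x) = (u \<otimes> i) \<odot>\<^bsub>M\<^esub> x"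
      using u(1) iR x by (simp add: smult_assoc1)
    also have "\<dots> = (a \<otimes> \<pi>) \<odot>\<^bsub>M\<^esub> (d \<odot>\<^bsub>M\<^esub> x)"
      unfolding u(3) using u(2) x assms(2) by (simp add: smult_assoc1)
    finally show "i \<odot>\<^bsub>M\<^esub> x \<in> ?H"
      using u(1) smult_closed[OF u(2) x] smult_closed[OF iR x] by blast
  qed
  then show ?thesis
    using f by blast
qed

text \<open>By maximality \<open>\<one> = \<mu> \<oplus> w \<otimes> a\<close> with
  \<open>\<mu>\<close> in \<open>\<mm>\<close>; after multiplication by \<open>\<nu>\<close> the
  part \<open>\<mu>\<close> becomes a multiple of \<open>\<pi>\<close>. The gain is that
  \<open>w\<close>, which may depend on \<open>I\<close>, gives way to \<open>\<nu>\<close>, which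
  does not.\<close>

lemma mem_ideal_step:
  assumes "ideal I R" and z: "z \<in> carrier R" "\<pi> \<otimes> z \<in> I" and w: "w \<in> U" "w \<otimes> z \<in> I"
  shows "\<nu> \<otimes> z \<in> I"
proof -
  interpret I: ideal I R by fact
  have wR: "w \<in> carrier R" using w by simp
  have "ideal (\<mm> <+>\<^bsub>R\<^esub> PIdl w) R"
    by (rule add_ideals[OF m.is_ideal cgenideal_ideal[OF wR]])
  moreover have "\<mm> \<subseteq> \<mm> <+>\<^bsub>R\<^esub> PIdl w"
  proof
    fix c assume c: "c \<in> \<mm>"
    have "\<zero> \<in> PIdl w"
      using wR by (auto simp: cgenideal_iff intro!: bexI[of _ \<zero>])
    moreover have "c = c \<oplus> \<zero>"
      using m.Icarr[OF c] by (simp add: abelian_monoid.r_zero[OF abelian_group.axioms(1)[OF is_abelian_group]])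
    ultimately show "c \<in> \<mm> <+>\<^bsub>R\<^esub> PIdl w"
      unfolding set_add_def' using c by blast
  qed
  moreover have "w \<in> \<mm> <+>\<^bsub>R\<^esub> PIdl w"
  proof -
    have "w = \<zero> \<oplus> w" using wR by (simp add: abelian_monoid.l_zero[OF abelian_group.axioms(1)[OF is_abelian_group]])
    then show ?thesis
      unfolding set_add_def' using cgenideal_self[OF wR] m.zero_closed by blast
  qed
  ultimately have "\<mm> <+>\<^bsub>R\<^esub> PIdl w = carrier R"
    using m.I_maximal[of "\<mm> <+>\<^bsub>R\<^esub> PIdl w"] w(1) ideal.Icarr[of "\<mm> <+>\<^bsub>R\<^esub> PIdl w" R] by blast
  then have "\<one> \<in> \<mm> <+>\<^bsub>R\<^esub> PIdl w"
    by simp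
  then obtain \<mu> a where \<mu>: "\<mu> \<in> \<mm>" "a \<in> carrier R" "\<one> = \<mu> \<oplus> w \<otimes> a"
    unfolding set_add_def' by (auto simp: cgenideal_iff[OF wR])
  then have \<mu>R: "\<mu> \<in> carrier R" using m.Icarr by blast
  obtain d where d: "d \<in> carrier R" "\<nu> \<otimes> \<mu> = \<pi> \<otimes> d"
    using nu_mult[OF \<mu>(1)] by blast
  have nu: "\<nu> \<in> carrier R" using nu_U by simp
  have "\<nu> \<otimes> z = \<nu> \<otimes> ((\<mu> \<oplus> w \<otimes> a) \<otimes> z)"
    using \<mu>(3)[symmetric] z(1) by simp
  also have "\<dots> = (\<nu> \<otimes> \<mu>) \<otimes> z \<oplus> (\<nu> \<otimes> a) \<otimes> (w \<otimes> z)"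
    using nu \<mu>R \<mu>(2) wR z(1) by (simp add: l_distr r_distr m_ac)
  also have "\<dots> = d \<otimes> (\<pi> \<otimes> z) \<oplus> (\<nu> \<otimes> a) \<otimes> (w \<otimes> z)"
    unfolding d(2) using d(1) z(1) by (simp add: m_ac)
  also have "\<dots> \<in> I"
    by (rule I.a_closed[OF I.I_l_closed[OF z(2) d(1)] I.I_l_closed[OF w(2)]]) (use nu \<mu>(2) in auto)
  finally show ?thesis .
qed

text \<open>Each application of \<open>mem_ideal_step\<close> trades a factor \<open>\<pi>\<close>
  for a factor \<open>\<nu>\<close>. The element \<open>w\<close> enters every step but leaves no
  trace in the result.\<close>

lemma mem_ideal_pow:
  assumes "ideal I R" and w: "w \<in> U" and z: "z \<in> carrier R" "w \<otimes> z \<in> I"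
    and e: "e \<in> carrier R" "e \<otimes> \<pi> [^] (l::nat) \<otimes> z \<in> I"
  shows "\<nu> [^] l \<otimes> e \<otimes> z \<in> I"
  using e
proof (induction l arbitrary: e)
  case 0
  then show ?case using z by simp
next
  case (Suc l)
  interpret I: ideal I R by fact
  have nu: "\<nu> \<in> carrier R" using nu_U by simp
  have wR: "w \<in> carrier R" using w by simp
  let ?z = "e \<otimes> \<pi> [^] l \<otimes> z"
  have "\<nu> \<otimes> ?z \<in> I"
  proof (rule mem_ideal_step[OF assms(1) _ _ w])
    show "?z \<in> carrier R" using Suc z by simp
    have "\<pi> \<otimes> ?z = e \<otimes> \<pi> [^] Suc l \<otimes> z"
      using Suc.prems(1) z by (simp add: m_ac)
    then show "\<pi> \<otimes> ?z \<in> I" using Suc.prems(2) by simp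
    have "w \<otimes> ?z = (e \<otimes> \<pi> [^] l) \<otimes> (w \<otimes> z)"
      using Suc.prems(1) z wR by (simp add: m_ac)
    then show "w \<otimes> ?z \<in> I"
      using I.I_l_closed[OF z(2), of "e \<otimes> \<pi> [^] l"] Suc.prems(1) by simp
  qed
  then have "(\<nu> \<otimes> e) \<otimes> \<pi> [^] l \<otimes> z \<in> I"
    using Suc.prems(1) z nu by (simp add: m_assoc)
  then have "\<nu> [^] l \<otimes> (\<nu> \<otimes> e) \<otimes> z \<in> I"
    using Suc.prems(1) nu by (intro Suc.IH) auto
  then show ?case
    using Suc.prems(1) nu by (simp add: m_assoc)
qed

end

section \<open>Gluing the local Ohm-Rush properties\<close>

context torsion_free_module begin

lemma dedekind_module_at: "maximalideal \<mm> R \<Longrightarrow> dedekind_module_at R M \<mm>"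
  by (intro dedekind_module_at.intro dedekind_at.intro dedekind_at_axioms.intro
      dedekind_domain_axioms module_axioms)

text \<open>In the application \<open>E\<close> consists of the multiplications by elements of \<open>S\<close>, and \<open>r\<close> comes from
  the finite generation over \<open>S\<close> of the module of all \<open>x\<close> having a nonzero \<open>R\<close>-multiple in \<open>S f\<close>.\<close>

lemma mem_content_mult:
  assumes f: "f \<in> carrier M" "f \<noteq> \<zero>\<^bsub>M\<^esub>"
    and separated: "\<And>\<mm>. maximalideal \<mm> R \<Longrightarrow> \<exists>n::nat. \<forall>u\<in>carrier R - \<mm>. \<forall>y\<in>carrier M.
      u \<odot>\<^bsub>M\<^esub> f \<noteq> dedekind_at.\<pi> R \<mm> [^] n \<odot>\<^bsub>M\<^esub> y"
    and E: "E \<subseteq> linear_maps R M M" "\<And>u. u \<in> carrier R \<Longrightarrow> (\<lambda>z. u \<odot>\<^bsub>M\<^esub> z) \<in> E"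
    and r: "r \<in> carrier R" "r \<noteq> \<zero>"
    and uniform: "\<And>x s e. \<lbrakk>x \<in> carrier M; s \<in> carrier R; s \<noteq> \<zero>; e \<in> E; s \<odot>\<^bsub>M\<^esub> x = e f\<rbrakk>
      \<Longrightarrow> \<exists>e\<in>E. r \<odot>\<^bsub>M\<^esub> x = e f"
  shows "f \<in> ideal_mult_module R (content R M f) M"
proof -
  have r_mem: "r \<in> I" if I: "ideal I R" and fI: "f \<in> ideal_mult_module R I M" for I
  proof -
    have "{t \<in> carrier R. t \<otimes> r \<in> I} = carrier R"
    proof (rule ideal_eq_carrierI[OF colon_ideal[OF r(1) I]], rule ccontr)
      fix \<mm> assume m: "maximalideal \<mm> R" and neg: "\<not> (\<exists>u\<in>{t \<in> carrier R. t \<otimes> r \<in> I}. u \<notin> \<mm>)"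
      interpret m: dedekind_module_at R M \<mm> by (rule dedekind_module_at[OF m])
      have "t \<otimes> r \<notin> I" if "t \<in> m.U" for t
        using neg that by blast
      from m.locally_divisible_if_below[OF I r(1) this fI]
      obtain u x where u: "u \<in> m.U" "x \<in> carrier M" "u \<odot>\<^bsub>M\<^esub> f = (r \<otimes> m.\<pi>) \<odot>\<^bsub>M\<^esub> x"
        by blast
      have uR: "u \<in> carrier R" "u \<noteq> \<zero>"
        using u(1) m.U_nonzero by auto
      have "m.\<pi> \<noteq> \<zero>"
      proof
        assume "m.\<pi> = \<zero>"
        then have "u \<odot>\<^bsub>M\<^esub> f = \<zero>\<^bsub>M\<^esub>"
          using u(2,3) r(1) by simp
        then show False
          using torsion_free[OF uR(1) f(1) _ uR(2)] f(2) by blast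
      qed
      then have "r \<otimes> m.\<pi> \<noteq> \<zero>"
        using r by (simp add: integral_iff)
      then obtain e where e: "e \<in> E" "r \<odot>\<^bsub>M\<^esub> x = e f"
        using uniform[OF u(2) _ _ E(2)[OF uR(1)], of "r \<otimes> m.\<pi>"] u(3) r(1) by auto
      have e_closed: "e y \<in> carrier M" and e_smult: "t \<in> carrier R \<Longrightarrow> e (t \<odot>\<^bsub>M\<^esub> y) = t \<odot>\<^bsub>M\<^esub> e y"
        if "y \<in> carrier M" for t y
        using e(1) E(1) that by (auto simp: linear_maps_def)
      have uf: "u \<odot>\<^bsub>M\<^esub> f = m.\<pi> \<odot>\<^bsub>M\<^esub> e f"
        using u(2,3) r(1) by (simp add: m_comm[of r] smult_assoc1 e(2))
      \<comment> \<open>As \<open>e\<close> is \<open>R\<close>-linear, it maps the witness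
        \<open>y\<close> for \<open>n\<close> to the witness \<open>e y\<close> for
        \<open>Suc n\<close>.\<close>
      have "\<exists>y\<in>carrier M. u [^] n \<odot>\<^bsub>M\<^esub> f = m.\<pi> [^] n \<odot>\<^bsub>M\<^esub> y" for n :: nat
      proof (induction n)
        case 0
        then show ?case using f(1) by auto
      next
        case (Suc n)
        then obtain y where y: "y \<in> carrier M" "u [^] n \<odot>\<^bsub>M\<^esub> f = m.\<pi> [^] n \<odot>\<^bsub>M\<^esub> y" by blast
        have "u [^] Suc n \<odot>\<^bsub>M\<^esub> f = u [^] n \<odot>\<^bsub>M\<^esub> (u \<odot>\<^bsub>M\<^esub> f)"
          using uR f(1) by (simp add: smult_assoc1)
        also have "\<dots> = m.\<pi> \<odot>\<^bsub>M\<^esub> (u [^] n \<odot>\<^bsub>M\<^esub> e f)"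
          unfolding uf using uR e_closed[OF f(1)] by (simp add: smult_assoc1[symmetric] m_comm)
        also have "u [^] n \<odot>\<^bsub>M\<^esub> e f = m.\<pi> [^] n \<odot>\<^bsub>M\<^esub> e y"
          using e_smult[OF f(1), of "u [^] n"] e_smult[OF y(1), of "m.\<pi> [^] n"] uR y(2) by simp
        also have "m.\<pi> \<odot>\<^bsub>M\<^esub> (m.\<pi> [^] n \<odot>\<^bsub>M\<^esub> e y) = m.\<pi> [^] Suc n \<odot>\<^bsub>M\<^esub> e y"
          using e_closed[OF y(1)] by (simp add: smult_assoc1[symmetric] m_comm)
        finally show ?case
          using e_closed[OF y(1)] by blast
      qed
      moreover have "u [^] n \<in> m.U" for n :: nat
        by (rule m.pow_U[OF u(1)])
      ultimately show False
        using separated[OF m] by blast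
    qed
    then have "\<one> \<otimes> r \<in> I"
      using one_closed by blast
    then show ?thesis using r(1) by simp
  qed
  let ?C = "content R M f"
  \<comment> \<open>The unit ideal is thus a member of the family defining the content; an empty
    family would have the whole type as its intersection.\<close>
  have "f \<in> ideal_mult_module R (carrier R) M"
    using smult_in_ideal_mult_module[of \<one> "carrier R" f M R] f(1) by simp
  then have "?C \<subseteq> carrier R"
    using oneideal by (auto simp: content_def)
  have H: "submodule (ideal_mult_module R ?C M) R M"
    unfolding ideal_mult_module_def using \<open>?C \<subseteq> carrier R\<close> by (intro submodule_submodule_span) auto
  have "{t \<in> carrier R. t \<odot>\<^bsub>M\<^esub> f \<in> ideal_mult_module R ?C M} = carrier R"
  proof (rule ideal_eq_carrierI[OF ideal_colon_submodule[OF H f(1)]])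
    fix \<mm> assume m: "maximalideal \<mm> R"
    interpret m: dedekind_module_at R M \<mm> by (rule dedekind_module_at[OF m])
    define Q where "Q n \<longleftrightarrow> (\<exists>u\<in>m.U. \<exists>y\<in>carrier M. u \<odot>\<^bsub>M\<^esub> f = m.\<pi> [^] n \<odot>\<^bsub>M\<^esub> y)" for n :: nat
    have "Q 0"
      unfolding Q_def using f(1) m.one_U by (intro bexI[of _ \<one>] bexI[of _ f]) auto
    have "\<exists>n. \<not> Q n"
      unfolding Q_def using separated[OF m] by blast
    have "\<exists>k. Q k \<and> \<not> Q (Suc k)"
    proof (rule ccontr)
      assume *: "\<nexists>k. Q k \<and> \<not> Q (Suc k)"
      have "Q n" for n
        by (induction n) (use * \<open>Q 0\<close> in auto)
      with \<open>\<exists>n. \<not> Q n\<close> show False by simp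
    qed
    then obtain k where k: "Q k" "\<not> Q (Suc k)" by blast
    then obtain u y where u: "u \<in> m.U" "y \<in> carrier M" "u \<odot>\<^bsub>M\<^esub> f = m.\<pi> [^] k \<odot>\<^bsub>M\<^esub> y"
      unfolding Q_def by blast
    obtain j v e where e: "v \<in> m.U" "e \<in> m.U" "v \<otimes> r = e \<otimes> m.\<pi> [^] (j::nat)"
      using m.factor_pi_pow[OF r] by blast
    \<comment> \<open>\<open>e\<close> and \<open>j\<close> come from the local factorization of
      \<open>r\<close>, and \<open>\<nu> [^] j\<close> is what \<open>mem_ideal_pow\<close> charges
      for removing \<open>\<pi> [^] j\<close>. Nothing here refers to an ideal \<open>I\<close>, so
      \<open>?g \<otimes> m.\<pi> [^] k\<close> will lie in the whole intersection.\<close>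
    let ?g = "m.\<nu> [^] j \<otimes> e"
    have g: "?g \<in> m.U"
      by (rule m.mult_U[OF m.pow_U[OF m.nu_U] e(2)])
    have "?g \<otimes> m.\<pi> [^] k \<in> I" if I: "ideal I R" and fI: "f \<in> ideal_mult_module R I M" for I
    proof -
      interpret I: ideal I R by fact
      \<comment> \<open>Otherwise \<open>f\<close> would be locally divisible by
        \<open>\<pi> [^] Suc k\<close>, against the choice of \<open>k\<close>.\<close>
      have "\<exists>w\<in>m.U. w \<otimes> m.\<pi> [^] k \<in> I"
      proof (rule ccontr)
        assume "\<not> (\<exists>w\<in>m.U. w \<otimes> m.\<pi> [^] k \<in> I)"
        then have "t \<otimes> m.\<pi> [^] k \<notin> I" if "t \<in> m.U" for t
          using that by blast
        from m.locally_divisible_if_below[OF I _ this fI]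
        have "\<exists>u\<in>m.U. \<exists>x\<in>carrier M. u \<odot>\<^bsub>M\<^esub> f = (m.\<pi> [^] k \<otimes> m.\<pi>) \<odot>\<^bsub>M\<^esub> x"
          by simp
        then show False
          using k(2) by (simp add: Q_def)
      qed
      then obtain w where w: "w \<in> m.U" "w \<otimes> m.\<pi> [^] k \<in> I" by blast
      have "v \<otimes> r \<in> I"
        using r_mem[OF I fI] e(1) I.I_l_closed by blast
      then have "m.\<pi> [^] k \<otimes> (e \<otimes> m.\<pi> [^] j) \<in> I"
        unfolding e(3) by (rule I.I_l_closed) simp
      then have "e \<otimes> m.\<pi> [^] j \<otimes> m.\<pi> [^] k \<in> I"
        using e(2) by (simp add: m_comm)
      then show ?thesis
        using e(2) by (intro m.mem_ideal_pow[OF I w(1) _ w(2)]) auto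
    qed
    then have "?g \<otimes> m.\<pi> [^] k \<in> ?C"
      by (simp add: content_def)
    then have "(?g \<otimes> m.\<pi> [^] k) \<odot>\<^bsub>M\<^esub> y \<in> ideal_mult_module R ?C M"
      using u(2) by (rule smult_in_ideal_mult_module)
    also have "(?g \<otimes> m.\<pi> [^] k) \<odot>\<^bsub>M\<^esub> y = ?g \<odot>\<^bsub>M\<^esub> (m.\<pi> [^] k \<odot>\<^bsub>M\<^esub> y)"
      using g u(2) by (intro smult_assoc1) auto
    also have "\<dots> = (?g \<otimes> u) \<odot>\<^bsub>M\<^esub> f"
      unfolding u(3)[symmetric] using g u(1) f(1) by (intro smult_assoc1[symmetric]) auto
    finally show "\<exists>t\<in>{t \<in> carrier R. t \<odot>\<^bsub>M\<^esub> f \<in> ideal_mult_module R ?C M}. t \<notin> \<mm>"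
      using m.mult_U[OF g u(1)] by blast
  qed
  then have "\<one> \<odot>\<^bsub>M\<^esub> f \<in> ideal_mult_module R ?C M"
    using one_closed by blast
  then show ?thesis using f(1) by simp
qed

end

text \<open>Here \<open>R\<close> plays the role of \<open>S\<close>, and \<open>D\<close> that of
  the Dedekind domain. The elements with some nonzero multiplier from \<open>D\<close> into
  \<open>R f\<close> form a submodule, since in a domain the product of two multipliers serves both.
  It is finitely generated, so a product of multipliers of the generators serves all its
  elements.\<close>

lemma (in noetherian_module) uniform_multiplier:
  assumes "domain D" and \<phi>: "\<phi> \<in> ring_hom D R" and f: "f \<in> carrier M"
  shows "\<exists>d\<in>carrier D. d \<noteq> \<zero>\<^bsub>D\<^esub> \<and> (\<forall>x\<in>carrier M. \<forall>s\<in>carrier D. \<forall>a\<in>carrier R.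
    s \<noteq> \<zero>\<^bsub>D\<^esub> \<longrightarrow> \<phi> s \<odot>\<^bsub>M\<^esub> x = a \<odot>\<^bsub>M\<^esub> f \<longrightarrow> (\<exists>a\<in>carrier R. \<phi> d \<odot>\<^bsub>M\<^esub> x = a \<odot>\<^bsub>M\<^esub> f))"
proof -
  interpret D: domain D by fact
  note hom [simp] = ring_hom_closed[OF \<phi>] ring_hom_mult[OF \<phi>]
  have cyclic: "submodule {a \<odot>\<^bsub>M\<^esub> f | a. a \<in> carrier R} R M"
  proof (rule submoduleI)
    show "{a \<odot>\<^bsub>M\<^esub> f | a. a \<in> carrier R} \<subseteq> carrier M" using f by auto
    show "\<zero>\<^bsub>M\<^esub> \<in> {a \<odot>\<^bsub>M\<^esub> f | a. a \<in> carrier R}"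
      using f by (auto intro!: exI[of _ \<zero>])
    show "\<ominus>\<^bsub>M\<^esub> x \<in> {a \<odot>\<^bsub>M\<^esub> f | a. a \<in> carrier R}" if "x \<in> {a \<odot>\<^bsub>M\<^esub> f | a. a \<in> carrier R}" for x
      using that f smult_l_minus[of _ f, symmetric] by auto
    show "x \<oplus>\<^bsub>M\<^esub> y \<in> {a \<odot>\<^bsub>M\<^esub> f | a. a \<in> carrier R}"
      if "x \<in> {a \<odot>\<^bsub>M\<^esub> f | a. a \<in> carrier R}" "y \<in> {a \<odot>\<^bsub>M\<^esub> f | a. a \<in> carrier R}" for x y
      using that f smult_l_distr[of _ _ f, symmetric] by auto
    show "b \<odot>\<^bsub>M\<^esub> x \<in> {a \<odot>\<^bsub>M\<^esub> f | a. a \<in> carrier R}"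
      if "b \<in> carrier R" "x \<in> {a \<odot>\<^bsub>M\<^esub> f | a. a \<in> carrier R}" for b x
      using that f smult_assoc1[of _ _ f, symmetric] by auto
  qed
  let ?Sf = "{a \<odot>\<^bsub>M\<^esub> f | a. a \<in> carrier R}"
  define W where "W d = {x \<in> carrier M. \<phi> d \<odot>\<^bsub>M\<^esub> x \<in> ?Sf}" for d
  have mono: "W d \<subseteq> W (e \<otimes>\<^bsub>D\<^esub> d)" if "d \<in> carrier D" "e \<in> carrier D" for d e
  proof
    fix x assume "x \<in> W d"
    then have x: "x \<in> carrier M" "\<phi> d \<odot>\<^bsub>M\<^esub> x \<in> ?Sf" by (simp_all add: W_def)
    have "\<phi> e \<odot>\<^bsub>M\<^esub> (\<phi> d \<odot>\<^bsub>M\<^esub> x) \<in> ?Sf"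
      using that by (intro submoduleE(4)[OF cyclic _ x(2)]) simp
    then show "x \<in> W (e \<otimes>\<^bsub>D\<^esub> d)"
      using that x(1) by (simp add: W_def smult_assoc1)
  qed
  have W: "submodule (W d) R M" if d: "d \<in> carrier D" for d
  proof (rule submoduleI)
    show "W d \<subseteq> carrier M" by (auto simp: W_def)
    show "\<zero>\<^bsub>M\<^esub> \<in> W d"
      using d f by (auto simp: W_def intro!: exI[of _ \<zero>])
    show "\<ominus>\<^bsub>M\<^esub> x \<in> W d" if "x \<in> W d" for x
      using that d submoduleE(3)[OF cyclic] by (simp add: W_def smult_r_minus)
    show "x \<oplus>\<^bsub>M\<^esub> y \<in> W d" if "x \<in> W d" "y \<in> W d" for x y
      using that d submoduleE(5)[OF cyclic] by (simp add: W_def smult_r_distr)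
    show "b \<odot>\<^bsub>M\<^esub> x \<in> W d" if b: "b \<in> carrier R" and x: "x \<in> W d" for b x
    proof -
      have "\<phi> d \<odot>\<^bsub>M\<^esub> (b \<odot>\<^bsub>M\<^esub> x) = b \<odot>\<^bsub>M\<^esub> (\<phi> d \<odot>\<^bsub>M\<^esub> x)"
        using b x d by (simp add: W_def smult_assoc1[symmetric] R.m_comm)
      then show ?thesis
        using b x submoduleE(4)[OF cyclic, of b "\<phi> d \<odot>\<^bsub>M\<^esub> x"] by (simp add: W_def)
    qed
  qed
  define V where "V = {x \<in> carrier M. \<exists>d\<in>carrier D. d \<noteq> \<zero>\<^bsub>D\<^esub> \<and> x \<in> W d}"
  have VI: "x \<in> V" if "d \<in> carrier D" "d \<noteq> \<zero>\<^bsub>D\<^esub>" "x \<in> W d" for x d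
    using that W by (auto simp: V_def W_def)
  have "submodule V R M"
  proof (rule submoduleI)
    show "V \<subseteq> carrier M" by (auto simp: V_def)
    show "\<zero>\<^bsub>M\<^esub> \<in> V"
      using f by (intro VI[of "\<one>\<^bsub>D\<^esub>"]) (auto simp: W_def intro!: exI[of _ \<zero>])
    show "\<ominus>\<^bsub>M\<^esub> x \<in> V" if "x \<in> V" for x
      using that VI submoduleE(3)[OF W] unfolding V_def by blast
    show "b \<odot>\<^bsub>M\<^esub> x \<in> V" if "b \<in> carrier R" "x \<in> V" for b x
      using that VI submoduleE(4)[OF W] unfolding V_def by blast
    fix x y assume "x \<in> V" "y \<in> V"
    then obtain d e where d: "d \<in> carrier D" "d \<noteq> \<zero>\<^bsub>D\<^esub>" "x \<in> W d" and e: "e \<in> carrier D" "e \<noteq> \<zero>\<^bsub>D\<^esub>" "y \<in> W e"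
      by (auto simp: V_def)
    have "x \<in> W (e \<otimes>\<^bsub>D\<^esub> d)" "y \<in> W (e \<otimes>\<^bsub>D\<^esub> d)"
      using mono[OF d(1) e(1)] mono[OF e(1) d(1)] d e by (auto simp: D.m_comm)
    then show "x \<oplus>\<^bsub>M\<^esub> y \<in> V"
      using d e submoduleE(5)[OF W] by (intro VI[of "e \<otimes>\<^bsub>D\<^esub> d"]) (auto simp: D.integral_iff)
  qed
  then obtain A where A: "A \<subseteq> carrier M" "finite A" "V = submodule_span R M A"
    using finitely_gen by blast
  have "A \<subseteq> V"
    unfolding A(3) by (auto simp: submodule_span_def)
  with A(2) have "\<exists>d\<in>carrier D. d \<noteq> \<zero>\<^bsub>D\<^esub> \<and> A \<subseteq> W d"
  proof (induction A rule: finite_induct)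
    case empty
    then show ?case
      by (intro bexI[of _ "\<one>\<^bsub>D\<^esub>"]) auto
  next
    case (insert x A)
    then obtain d e where d: "d \<in> carrier D" "d \<noteq> \<zero>\<^bsub>D\<^esub>" "A \<subseteq> W d" and e: "e \<in> carrier D" "e \<noteq> \<zero>\<^bsub>D\<^esub>" "x \<in> W e"
      by (auto simp: V_def)
    have "insert x A \<subseteq> W (e \<otimes>\<^bsub>D\<^esub> d)"
      using mono[OF d(1) e(1)] mono[OF e(1) d(1)] d e by (auto simp: D.m_comm)
    then show ?case
      using d e by (intro bexI[of _ "e \<otimes>\<^bsub>D\<^esub> d"]) (auto simp: D.integral_iff)
  qed
  then obtain d where d: "d \<in> carrier D" "d \<noteq> \<zero>\<^bsub>D\<^esub>" "A \<subseteq> W d" by blast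
  have VW: "V \<subseteq> W d"
    unfolding A(3) by (rule submodule_span_subset[OF W[OF d(1)] d(3)])
  have "\<exists>a\<in>carrier R. \<phi> d \<odot>\<^bsub>M\<^esub> x = a \<odot>\<^bsub>M\<^esub> f"
    if "x \<in> carrier M" "s \<in> carrier D" "a \<in> carrier R" "s \<noteq> \<zero>\<^bsub>D\<^esub>" "\<phi> s \<odot>\<^bsub>M\<^esub> x = a \<odot>\<^bsub>M\<^esub> f" for x s a
  proof -
    have "x \<in> W s"
      using that by (auto simp: W_def)
    then have "x \<in> W d"
      using VI[OF that(2,4)] VW by blast
    then show ?thesis
      by (auto simp: W_def)
  qed
  with d(1,2) show ?thesis by blast
qed

theorem theorem3p4:
  fixes R :: "('r, 'p) ring_scheme" and S :: "('s, 'q) ring_scheme"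
    and \<phi> :: "'r \<Rightarrow> 's" and M :: "('s, 'm, 'k) module_scheme"
  assumes "dedekind_domain R"
    and "cring S"
    and "\<phi> \<in> ring_hom R S"
    and "noetherian_module S M"
    and "\<And>\<mm>. maximalideal \<mm> R \<Longrightarrow>
           faithfully_flat TYPE(('r \<times> 'r) set set)
             (ring_at R \<mm>) (module_at R \<mm> (restrict_scalars \<phi> M)) \<and>
           ohm_rush (ring_at R \<mm>) (module_at R \<mm> (restrict_scalars \<phi> M))"
  shows "faithfully_flat TYPE('n) R (restrict_scalars \<phi> M) \<and>
         ohm_rush R (restrict_scalars \<phi> M)"
proof -
  interpret R: dedekind_domain R by fact
  interpret S: noetherian_module S M by fact
  let ?M = "restrict_scalars \<phi> M"
  have mod: "module R ?M"
    by (rule module_restrict_scalars[OF R.is_cring assms(3) S.module_axioms])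
  interpret M: module R ?M by (rule mod)
  have at: "dedekind_module_at R ?M \<mm>" if "maximalideal \<mm> R" for \<mm>
    by (intro dedekind_module_at.intro dedekind_at.intro dedekind_at_axioms.intro
        R.dedekind_domain_axioms mod that)
  \<comment> \<open>The annihilator of \<open>x\<close> is the colon ideal of the zero submodule, so
    the local-global principle applies to it.\<close>
  have local_zero: "x = \<zero>\<^bsub>?M\<^esub>"
    if x: "x \<in> carrier ?M" and loc: "\<And>\<mm>. maximalideal \<mm> R \<Longrightarrow> \<exists>u\<in>carrier R - \<mm>. u \<odot>\<^bsub>?M\<^esub> x = \<zero>\<^bsub>?M\<^esub>" for x
  proof -
    have "{r \<in> carrier R. r \<odot>\<^bsub>?M\<^esub> x \<in> {\<zero>\<^bsub>?M\<^esub>}} = carrier R"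
      by (rule R.ideal_eq_carrierI[OF M.ideal_colon_submodule[OF M.submodule_zero x]]) (use loc in blast)
    then have "\<one>\<^bsub>R\<^esub> \<odot>\<^bsub>?M\<^esub> x = \<zero>\<^bsub>?M\<^esub>"
      using R.one_closed by blast
    then show ?thesis
      using M.smult_one[OF x] by metis
  qed
  have "torsion_free_module R ?M"
  proof (intro torsion_free_module.intro torsion_free_module_axioms.intro R.dedekind_domain_axioms mod)
    fix r x assume r: "r \<in> carrier R" "r \<noteq> \<zero>\<^bsub>R\<^esub>" and x: "x \<in> carrier ?M" "r \<odot>\<^bsub>?M\<^esub> x = \<zero>\<^bsub>?M\<^esub>"
    show "x = \<zero>\<^bsub>?M\<^esub>"
    proof (rule local_zero[OF x(1)])
      fix \<mm> assume m: "maximalideal \<mm> R"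
      show "\<exists>u\<in>carrier R - \<mm>. u \<odot>\<^bsub>?M\<^esub> x = \<zero>\<^bsub>?M\<^esub>"
        by (rule dedekind_module_at.flat_torsion[OF at[OF m] _ r x])
          (use assms(5)[OF m] in \<open>simp add: faithfully_flat_def\<close>)
    qed
  qed
  then interpret T: torsion_free_module R ?M .
  have "faithfully_flat TYPE('n) R ?M"
    by (rule T.faithfully_flatI)
      (use dedekind_module_at.faithfully_flat_not_divisible[OF at] assms(5) in blast)
  moreover have "ohm_rush R ?M"
    unfolding ohm_rush_def
  proof
    fix f assume f: "f \<in> carrier ?M"
    show "f \<in> ideal_mult_module R (content R ?M f) ?M"
    proof (cases "f = \<zero>\<^bsub>?M\<^esub>")
      case True
      have "\<zero>\<^bsub>?M\<^esub> \<in> ideal_mult_module R (content R ?M f) ?M"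
        unfolding ideal_mult_module_def submodule_span_def using M.submodule_zero_closed by blast
      with True show ?thesis by metis
    next
      case False
      have fM: "f \<in> carrier M" using f by simp
      obtain r where r: "r \<in> carrier R" "r \<noteq> \<zero>\<^bsub>R\<^esub>"
        and uniform: "\<forall>x\<in>carrier M. \<forall>s\<in>carrier R. \<forall>a\<in>carrier S. s \<noteq> \<zero>\<^bsub>R\<^esub> \<longrightarrow>
          \<phi> s \<odot>\<^bsub>M\<^esub> x = a \<odot>\<^bsub>M\<^esub> f \<longrightarrow> (\<exists>a\<in>carrier S. \<phi> r \<odot>\<^bsub>M\<^esub> x = a \<odot>\<^bsub>M\<^esub> f)"
        using S.uniform_multiplier[OF R.domain_axioms assms(3) fM] by auto
      \<comment> \<open>Scalars from \<open>S\<close> enter the gluing argument only as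
        \<open>R\<close>-linear endomorphisms, linear because \<open>S\<close> is commutative;
        \<open>\<phi>\<close> places the multiplications by \<open>R\<close> among them.\<close>
      let ?E = "(\<lambda>a z. a \<odot>\<^bsub>M\<^esub> z) ` carrier S"
      show ?thesis
      proof (rule T.mem_content_mult[OF f False _ _ _ r, of ?E])
        fix \<mm> assume m: "maximalideal \<mm> R"
        show "\<exists>n::nat. \<forall>u\<in>carrier R - \<mm>. \<forall>y\<in>carrier ?M. u \<odot>\<^bsub>?M\<^esub> f \<noteq> dedekind_at.\<pi> R \<mm> [^]\<^bsub>R\<^esub> n \<odot>\<^bsub>?M\<^esub> y"
        proof (rule ccontr)
          assume neg: "\<not> ?thesis"
          interpret m: dedekind_module_at R ?M \<mm> by (rule at[OF m])
          have "\<exists>u\<in>carrier R - \<mm>. u \<odot>\<^bsub>?M\<^esub> f = \<zero>\<^bsub>?M\<^esub>"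
            using assms(5)[OF m] neg by (intro m.ohm_rush_divisible[OF _ f]) auto
          then obtain u where u: "u \<in> carrier R" "u \<notin> \<mm>" "u \<odot>\<^bsub>?M\<^esub> f = \<zero>\<^bsub>?M\<^esub>" by blast
          moreover have "u \<noteq> \<zero>\<^bsub>R\<^esub>"
            using m.U_nonzero[of u] u by blast
          ultimately show False
            using T.torsion_free[OF _ f] False by blast
        qed
      next
        show "?E \<subseteq> linear_maps R ?M ?M"
          using ring_hom_closed[OF assms(3)]
          by (auto simp: linear_maps_def S.smult_r_distr S.smult_assoc1[symmetric] S.R.m_comm)
        show "(\<lambda>z. u \<odot>\<^bsub>?M\<^esub> z) \<in> ?E" if "u \<in> carrier R" for u
          using ring_hom_closed[OF assms(3) that] by auto
      next
        fix x s e
        assume "x \<in> carrier ?M" "s \<in> carrier R" "s \<noteq> \<zero>\<^bsub>R\<^esub>" "e \<in> ?E" "s \<odot>\<^bsub>?M\<^esub> x = e f"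
        then obtain a where a: "x \<in> carrier M" "s \<in> carrier R" "s \<noteq> \<zero>\<^bsub>R\<^esub>" "a \<in> carrier S"
            "\<phi> s \<odot>\<^bsub>M\<^esub> x = a \<odot>\<^bsub>M\<^esub> f"
          by auto
        have "\<exists>a\<in>carrier S. \<phi> r \<odot>\<^bsub>M\<^esub> x = a \<odot>\<^bsub>M\<^esub> f"
          using uniform[rule_format, OF a(1,2,4,3,5)] .
        then show "\<exists>e\<in>?E. r \<odot>\<^bsub>?M\<^esub> x = e f"
          by auto
      qed
    qed
  qed
  ultimately show ?thesis ..
qed

end
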